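(* Let $\omega>0$, $l\ge0$, $\mu>0$ and $\lambda=\frac{1}{4\omega^2}-\mu^2$. The equation $z^2E''+((-l+1)z+\mu(1-z^2))E'+(\lambda+\mu(l-1)z)E=0$ has a nontrivial polynomial solution if and only if $l\in\mathbb N$, $c_1=0$ and $c_0\neq0$, where $c_0,c_1$ are the Stokes multipliers of system (L) with the same $\omega,l,\mu$.
   Context: System (L): $u'=z^{-2}\big(-(lz+\mu(1+z^2))u+\frac{z}{2i\omega}v\big)$, $v'=\frac{1}{2i\omega z}u$. $F(z)=\operatorname{diag}(z^{-l}e^{\mu(1/z-z)},1)$. $S_\pm$ are sectors with vertex $0$ containing the closed upper/lower half-plane minus $0$, closures avoiding $i\mathbb R_\mp$, with $S_-=\overline{S_+}$. $H_\pm$ are the unique invertible matrix functions holomorphic on $S_\pm$, $C^\infty$ on $\overline{S_\pm}\setminus\{\infty\}$, $H_\pm(0)=\mathrm{Id}$, transforming (L) via $w=H_\pm\tilde w$ into $\tilde u'=-z^{-2}(lz+\mu(1+z^2))\tilde u$, $\tilde v'=0$. $W_\pm=H_\pm F$ (branch on $S_-$ by counterclockwise continuation from $S_+$); $W_{+,1}=H_+F$ with branch on $S_+$ continued counterclockwise from $S_-$. With $\Sigma_0\ni\mathbb R_-$, $\Sigma_1\ni\mathbb R_+$ the components of $S_+\cap S_-$, the Stokes matrices are defined by $W_-=W_+C_0$ on $\Sigma_0$, $W_{+,1}=W_-C_1$ on $\Sigma_1$, and $C_0=\begin{pmatrix}1&c_0\\0&1\end{pmatrix}$, $C_1=\begin{pmatrix}1&0\\c_1&1\end{pmatrix}$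 (Stokes multipliers $c_0,c_1$). *)

theory Defs
  imports "HOL-Analysis.Analysis" "HOL-Computational_Algebra.Polynomial"
begin

definition mat2 :: "complex \<Rightarrow> complex \<Rightarrow> complex \<Rightarrow> complex \<Rightarrow> complex^2^2" where
  "mat2 a b c d = (\<chi> i j. if i = 1 then (if j = 1 then a else b) else (if j = 1 then c else d))"

definition sector :: "real \<Rightarrow> real \<Rightarrow> complex set" where
  "sector lo hi = {z. z \<noteq> 0 \<and> (\<exists>\<theta>. lo < \<theta> \<and> \<theta> < hi \<and> z = of_real (cmod z) * cis \<theta>)}"

definition sysL :: "real \<Rightarrow> real \<Rightarrow> real \<Rightarrow> complex \<Rightarrow> complex^2^2" where
  "sysL \<omega> l \<mu> z = mat2 (- (of_real l * z + of_real \<mu> * (1 + z^2)) / z^2) (1 / (2 * \<i> * of_real \<omega> * z))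
                       (1 / (2 * \<i> * of_real \<omega> * z)) 0"

definition sysD :: "real \<Rightarrow> real \<Rightarrow> complex \<Rightarrow> complex^2^2" where
  "sysD l \<mu> z = mat2 (- (of_real l * z + of_real \<mu> * (1 + z^2)) / z^2) 0 0 0"

text \<open>The branch of F(z) = diag(z^(-l) e^(mu(1/z - z)), 1) at z = r cis theta, using the
  argument theta for z^(-l) = r^(-l) e^(-i l theta).\<close>
definition Fbr :: "real \<Rightarrow> real \<Rightarrow> real \<Rightarrow> real \<Rightarrow> complex^2^2" where
  "Fbr l \<mu> r \<theta> = (let z = of_real r * cis \<theta> in
     mat2 (of_real (r powr (- l)) * exp (- \<i> * of_real (l * \<theta>)) * exp (of_real \<mu> * (1 / z - z))) 0 0 1)"

text \<open>H is an admissible normalizing transformation on the sector S: invertible, holomorphic on S,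
  smooth up to the boundary (all complex derivatives extend continuously to the closure, which
  contains the vertex 0), H(0) = Id, and w = H w~ transforms (L) into the diagonal system, i.e.
  H' = A H - H D on S.\<close>
definition normalizing :: "real \<Rightarrow> real \<Rightarrow> real \<Rightarrow> complex set \<Rightarrow> (complex \<Rightarrow> complex^2^2) \<Rightarrow> bool" where
  "normalizing \<omega> l \<mu> S H \<longleftrightarrow>
     (\<forall>z\<in>closure S. invertible (H z)) \<and>
     (\<forall>i j. (\<lambda>z. H z $ i $ j) holomorphic_on S) \<and>
     continuous_on (closure S) H \<and>
     (\<forall>k i j. \<exists>g. continuous_on (closure S) g \<and> (\<forall>z\<in>S. g z = (deriv ^^ k) (\<lambda>w. H w $ i $ j) z)) \<and>
     H 0 = mat 1 \<and>
     (\<forall>z\<in>S. \<forall>i j. ((\<lambda>w. H w $ i $ j) has_field_derivative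
          ((sysL \<omega> l \<mu> z ** H z - H z ** sysD l \<mu> z) $ i $ j)) (at z))"

text \<open>(c0, c1) are the Stokes multipliers w.r.t. sectors S+ = sector (-a) (pi+b),
  S- = conj S+ = sector (-pi-b) a, with 0 < a, b < pi/2.  Arguments: on S+ the branch uses
  arg in (-a, pi+b); W- uses the counterclockwise continuation, arg in (pi-b, 2pi+a);
  W_{+,1} uses arg in (2pi-a, 3pi+b).  Sigma0 = args (pi-b, pi+b), Sigma1 = args (-a, a).\<close>
definition stokes_data :: "real \<Rightarrow> real \<Rightarrow> real \<Rightarrow> real \<Rightarrow> real \<Rightarrow> complex \<Rightarrow> complex \<Rightarrow> bool" where
  "stokes_data \<omega> l \<mu> a b c0 c1 \<longleftrightarrow>
     (\<exists>Hp Hm. normalizing \<omega> l \<mu> (sector (- a) (pi + b)) Hp \<and>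
              normalizing \<omega> l \<mu> (sector (- pi - b) a) Hm \<and>
       (\<forall>r \<theta>. r > 0 \<and> pi - b < \<theta> \<and> \<theta> < pi + b \<longrightarrow>
          Hm (of_real r * cis \<theta>) ** Fbr l \<mu> r \<theta> =
          Hp (of_real r * cis \<theta>) ** Fbr l \<mu> r \<theta> ** mat2 1 c0 0 1) \<and>
       (\<forall>r \<theta>. r > 0 \<and> - a < \<theta> \<and> \<theta> < a \<longrightarrow>
          Hp (of_real r * cis \<theta>) ** Fbr l \<mu> r (\<theta> + 2 * pi) =
          Hm (of_real r * cis \<theta>) ** Fbr l \<mu> r (\<theta> + 2 * pi) ** mat2 1 0 c1 1))"

definition stokes_multipliers :: "real \<Rightarrow> real \<Rightarrow> real \<Rightarrow> complex \<times> complex" where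
  "stokes_multipliers \<omega> l \<mu> = (THE c. \<exists>a b. 0 < a \<and> a < pi / 2 \<and> 0 < b \<and> b < pi / 2 \<and>
        stokes_data \<omega> l \<mu> a b (fst c) (snd c))"

definition stokes_c0 :: "real \<Rightarrow> real \<Rightarrow> real \<Rightarrow> complex" where
  "stokes_c0 \<omega> l \<mu> = fst (stokes_multipliers \<omega> l \<mu>)"

definition stokes_c1 :: "real \<Rightarrow> real \<Rightarrow> real \<Rightarrow> complex" where
  "stokes_c1 \<omega> l \<mu> = snd (stokes_multipliers \<omega> l \<mu>)"

end

theory Submission
  imports "Jordan_Normal_Form.Determinant" "HOL-Complex_Analysis.Complex_Analysis"
    "HOL-Real_Asymp.Real_Asymp" Defs
begin

text \<open>If \<open>c\<^sub>1 = 0\<close> (\<open>c\<^sub>0 = 0\<close>), the first (second) columns of \<open>H\<^sub>+\<close> and \<open>H\<^sub>-\<close> glue to a function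
  holomorphic near and at \<open>0\<close>, hence entire.  So \<open>c\<^sub>1 = 0\<close> means that the equation of the theorem
  has an entire solution with value \<open>1\<close> at \<open>0\<close>, and \<open>c\<^sub>0 = 0\<close> means the same for the equation
  \<open>z\<^sup>2 E'' + ((l + 1) z + \<mu> (1 - z\<^sup>2)) E' + (\<lambda> - \<mu> (l + 1) z) E = 0\<close>.  For \<open>l = n\<close> the \<open>n\<close>-th derivative
  maps solutions of the first equation to solutions of the second one.  If \<open>c\<^sub>1 = 0 \<noteq> c\<^sub>0\<close>, the image of
  the entire solution vanishes at \<open>0\<close>, hence everywhere, and the solution is a polynomial.  Conversely,
  a polynomial solution \<open>p\<close> has degree \<open>n - 1\<close>.  If also \<open>c\<^sub>0 = 0\<close>, the \<open>n\<close>-fold primitive of the entire solution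
  of the second equation solves the first one with right-hand side a nonzero multiple of
  \<open>z ^ (n - 1)\<close>.  As the equation is self-adjoint with respect to a pairing on the unit circle,
  \<open>p\<close> is orthogonal to \<open>z ^ (n - 1)\<close> and then, by a recursion, to all lower powers.  This is a linear
  system for the coefficients of \<open>p\<close> whose matrix is the Toeplitz matrix of the modified Bessel
  functions \<open>I\<^sub>m(2 \<mu>)\<close> with \<open>m = i + 1 - j\<close>.  Its determinant is positive, since the Bessel functions
  are the heat kernel on \<open>\<int>\<close>; thus \<open>p = 0\<close>.\<close>

text \<open>The multipliers are given by a definite description, so nothing can be said about them
  before normalizing transformations are shown to exist and the multipliers to be independent of the
  sectors: this is the analytic half of the proof. The obstacle is that 0 is an irregular singular
  point, where a formal power series solution need not converge. Existence therefore starts from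
  genuine solutions in \<open>1 / z\<close>, and smoothness at the vertex is recovered afterwards,
  one derivative at a time. Eliminating one entry from a column of \<open>H\<close> gives a scalar
  equation with zero-order coefficient \<open>1 / (4 * \<omega>\<^sup>2)\<close>. A factor exp
  (\<mu> z) or exp (- \<mu> z), combined with z -> - z for the first column, moves the constant to
  \<lambda> and leads to the two equations of the overview. Bessel functions enter because the
  Sturm-Liouville weight contains exp (- \<mu> (z + 1 / z)), whose Laurent coefficients are, up to
  sign, I_m(2 \<mu>). The positivity argument is that of Karlin and McGregor: the determinant counts
  non-colliding walks.\<close>

no_notation fps_nth (infixl "$" 75)
no_notation Matrix.vec_index (infixl "$" 100)

section \<open>Positivity of Toeplitz determinants of a lattice heat flow\<close>

text \<open>Row \<open>i\<close> is the kernel read from a particle at \<open>x i\<close> to the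
  sites 0, ..., n - 1. Only the positions of the rows vary, so that moving one particle changes a
  single row.\<close>

definition toep :: "nat \<Rightarrow> (int \<Rightarrow> real) \<Rightarrow> (nat \<Rightarrow> int) \<Rightarrow> real" where
  "toep n f x = Determinant.det (Matrix.mat n n (\<lambda>(i, j). f (x i - int j)))"

lemma toep_alt:
  "toep n f x = (\<Sum>p | p permutes {0..<n}. signof p * (\<Prod>i = 0..<n. f (x i - int (p i))))"
proof -
  have "(\<Prod>i = 0..<n. Matrix.mat n n (\<lambda>(i, j). f (x i - int j)) $$ (i, p i)) =
      (\<Prod>i = 0..<n. f (x i - int (p i)))" if "p permutes {0..<n}" for p
    using permutes_in_image[OF that] by (intro prod.cong) auto
  then show ?thesis
    unfolding toep_def Determinant.det_def by (auto intro!: sum.cong)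
qed

lemma toep_collision:
  assumes "i < n" "j < n" "i \<noteq> j" "x i = x j"
  shows "toep n f x = 0"
  unfolding toep_def
  by (rule Determinant.det_identical_rows[OF _ \<open>i \<noteq> j\<close> \<open>i < n\<close> \<open>j < n\<close>]) (use assms in \<open>auto simp: Matrix.row_def\<close>)

text \<open>For use in contraposition: a nonzero determinant makes the linear system for the
  coefficients \<open>a j\<close> injective.\<close>

lemma toep_dependent:
  assumes "k < n" "a k \<noteq> 0" "\<And>i. i < n \<Longrightarrow> (\<Sum>j<n. a j * f (x i - int j)) = 0"
  shows "toep n f x = 0"
proof -
  let ?A = "Matrix.mat n n (\<lambda>(i, j). f (x i - int j))"
  let ?v = "Matrix.vec n a"
  have "?A *\<^sub>v ?v = 0\<^sub>v n"
    using assms(3) by (intro eq_vecI) (auto simp: scalar_prod_def lessThan_atLeast0 mult.commute)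
  moreover have "?v \<noteq> 0\<^sub>v n"
    using assms(1,2) by (metis index_vec index_zero_vec(1))
  moreover have "?v \<in> carrier_vec n" by simp
  ultimately show ?thesis
    unfolding toep_def by (subst det_0_iff_vec_prod_zero[of _ n]) (auto intro!: exI[of _ ?v])
qed

text \<open>\<open>I t\<close> is exp (t A) applied to \<kappa> times the delta function at 0, where
  A is the adjacency operator of the integers. In contrast to the Laplacian, A has no diagonal term,
  so all its entries are nonnegative. \<open>I_bound\<close> controls the Taylor remainder.\<close>

locale lattice_heat_flow =
  fixes I :: "real \<Rightarrow> int \<Rightarrow> real" and T B \<kappa> :: real
  assumes deriv_I: "\<And>t m. ((\<lambda>t. I t m) has_real_derivative (I t (m - 1) + I t (m + 1))) (at t)"
    and I_0: "\<And>m. I 0 m = (if m = 0 then \<kappa> else 0)"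
    and kappa_pos: "\<kappa> > 0" and T_pos: "T > 0"
    and I_bound: "\<And>t m. 0 \<le> t \<Longrightarrow> t \<le> T \<Longrightarrow> \<bar>I t m\<bar> \<le> B"
begin

definition nbrs :: "nat \<Rightarrow> (nat \<Rightarrow> int) \<Rightarrow> ((nat \<Rightarrow> int) \<Rightarrow> real) \<Rightarrow> real" where
  "nbrs n x g = (\<Sum>i<n. g (x(i := x i - 1)) + g (x(i := x i + 1)))"

text \<open>These are the time derivatives of \<open>toep n (I t) x\<close>, but defined by particle
  moves, so that their sign at time 0 can be read off from walks; \<open>deriv_dtoep\<close>
  identifies the two.\<close>

fun dtoep :: "nat \<Rightarrow> nat \<Rightarrow> real \<Rightarrow> (nat \<Rightarrow> int) \<Rightarrow> real" where
  "dtoep n 0 t x = toep n (I t) x"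
| "dtoep n (Suc m) t x = nbrs n x (dtoep n m t)"

text \<open>The product rule differentiates one factor of each term, and by the heat equation this
  amounts to moving one row position by a step in either direction.\<close>

lemma deriv_toep:
  "((\<lambda>t. toep n (I t) x) has_real_derivative nbrs n x (toep n (I t))) (at t)"
proof -
  define P where "P = {p. p permutes {0..<n}}"
  have prod_deriv: "((\<lambda>t. \<Prod>i = 0..<n. I t (x i - int (p i))) has_real_derivative
     (\<Sum>k = 0..<n. (\<Prod>i = 0..<n. I t ((x(k := x k - 1)) i - int (p i))) +
        (\<Prod>i = 0..<n. I t ((x(k := x k + 1)) i - int (p i))))) (at t)" (is "(_ has_real_derivative ?d) _") for p
  proof -
    have 1: "((\<lambda>t. \<Prod>i \<in> {0..<n}. I t (x i - int (p i))) has_field_derivative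
        (\<Sum>k\<in>{0..<n}. (I t (x k - int (p k) - 1) + I t (x k - int (p k) + 1)) *
           (\<Prod>i\<in>{0..<n} - {k}. I t (x i - int (p i))))) (at t)"
      by (rule has_field_derivative_prod) (rule deriv_I)
    have 2: "(\<Prod>i = 0..<n. I t ((x(k := y)) i - int (p i))) =
        I t (y - int (p k)) * (\<Prod>i\<in>{0..<n} - {k}. I t (x i - int (p i)))"
      if "k \<in> {0..<n}" for k y
      using that by (subst prod.remove[of _ k]) (auto intro!: prod.cong)
    show ?thesis
      using 1 by (rule DERIV_cong) (auto intro!: sum.cong simp: 2 distrib_right algebra_simps simp del: fun_upd_apply)
  qed
  have "((\<lambda>t. \<Sum>p\<in>P. signof p * (\<Prod>i = 0..<n. I t (x i - int (p i)))) has_real_derivative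
     (\<Sum>p\<in>P. signof p * (\<Sum>k = 0..<n. (\<Prod>i = 0..<n. I t ((x(k := x k - 1)) i - int (p i))) +
        (\<Prod>i = 0..<n. I t ((x(k := x k + 1)) i - int (p i)))))) (at t)"
    by (intro DERIV_sum DERIV_cmult prod_deriv)
  then show ?thesis
    unfolding toep_alt nbrs_def P_def[symmetric] sum_distrib_left sum.distrib ring_distribs
      lessThan_atLeast0 by (simp only: sum.swap[of _ "{0..<n}" P])
qed

lemma deriv_dtoep:
  "((\<lambda>t. dtoep n m t x) has_real_derivative dtoep n (Suc m) t x) (at t)"
proof (induction m arbitrary: x)
  case 0
  have "dtoep n 0 = (\<lambda>t. toep n (I t))" by (simp add: fun_eq_iff)
  then show ?case using deriv_toep by simp
next
  case (Suc m)
  have "((\<lambda>t. \<Sum>i<n. dtoep n m t (x(i := x i - 1)) + dtoep n m t (x(i := x i + 1))) has_real_derivative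
      (\<Sum>i<n. dtoep n (Suc m) t (x(i := x i - 1)) + dtoep n (Suc m) t (x(i := x i + 1)))) (at t)"
    by (intro DERIV_sum DERIV_add Suc.IH)
  then show ?case
    by (simp only: dtoep.simps(2)[of n "Suc m"] dtoep.simps(2)[of n m _ x] nbrs_def)
qed

text \<open>A derivative that vanishes at \<open>x\<close> for every t has vanishing time derivative
  there. So equal rows of the determinant are needed at order 0 only.\<close>

lemma dtoep_collision:
  assumes "i < n" "j < n" "i \<noteq> j" "x i = x j"
  shows "dtoep n m t x = 0"
proof (induction m arbitrary: t)
  case 0
  then show ?case using toep_collision[OF assms] by simp
next
  case (Suc m)
  have "((\<lambda>t. dtoep n m t x) has_real_derivative 0) (at t)" by (simp add: Suc.IH)
  then show ?case using deriv_dtoep DERIV_unique by blast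
qed

lemma toep_bound:
  assumes "0 \<le> t" "t \<le> T"
  shows "\<bar>toep n (I t) x\<bar> \<le> fact n * B ^ n"
proof -
  have "\<bar>toep n (I t) x\<bar> \<le> (\<Sum>p | p permutes {0..<n}. \<bar>signof p * (\<Prod>i = 0..<n. I t (x i - int (p i)))\<bar>)"
    unfolding toep_alt by (rule sum_abs)
  also have "\<dots> \<le> (\<Sum>p | p permutes {0..<n}. B ^ n)"
  proof (rule sum_mono)
    fix p
    have "\<bar>\<Prod>i = 0..<n. I t (x i - int (p i))\<bar> \<le> (\<Prod>i = 0..<n. B)"
      unfolding abs_prod by (rule prod_mono) (use I_bound assms in auto)
    then show "\<bar>signof p * (\<Prod>i = 0..<n. I t (x i - int (p i)))\<bar> \<le> B ^ n"
      by (simp add: abs_mult sign_def)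
  qed
  also have "\<dots> = fact n * B ^ n"
    by (simp add: card_permutations[of _ n])
  finally show ?thesis .
qed

lemma dtoep_bound:
  assumes "0 \<le> t" "t \<le> T"
  shows "\<bar>dtoep n m t x\<bar> \<le> (2 * real n) ^ m * (fact n * B ^ n)"
proof (induction m arbitrary: x)
  case 0
  then show ?case using toep_bound[OF assms] by simp
next
  case (Suc m)
  have "\<bar>dtoep n (Suc m) t x\<bar> \<le> (\<Sum>i<n. 2 * ((2 * real n) ^ m * (fact n * B ^ n)))"
    unfolding dtoep.simps nbrs_def
    by (intro order.trans[OF sum_abs] sum_mono order.trans[OF abs_triangle_ineq])
      (simp only: mult_2[of "_ ^ m * _"], intro add_mono Suc.IH)
  then show ?case by (simp add: algebra_simps)
qed

text \<open>At time 0 the kernel is a multiple of the Kronecker delta, so a permutation contributes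
  only if \<open>x i = p i\<close> for all i. As \<open>x\<close> increases, this permutation must
  be the identity, of sign +1.\<close>

lemma toep_0_nonneg:
  assumes "\<And>i j. i < j \<Longrightarrow> j < n \<Longrightarrow> x i < x j"
  shows "toep n (I 0) x \<ge> 0"
  unfolding toep_alt
proof (rule sum_nonneg)
  fix p assume "p \<in> {p. p permutes {0..<n}}"
  then have p: "p permutes {0..<n}" by simp
  show "0 \<le> signof p * (\<Prod>i = 0..<n. I 0 (x i - int (p i)))"
  proof (cases "\<exists>i<n. x i \<noteq> int (p i)")
    case True
    then obtain i where "i < n" "x i \<noteq> int (p i)" by blast
    then have "(\<Prod>i = 0..<n. I 0 (x i - int (p i))) = 0"
      by (intro prod_zero) (auto simp: I_0 intro!: bexI[of _ i])
    then show ?thesis by (simp only: mult_zero_right order.refl)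
  next
    case False
    then have mono: "p i < p j" if "i < j" "j < n" for i j
      using assms[OF that] that by auto
    have lt: "p i < n" if "i < n" for i
      using permutes_in_image[OF p, of i] that by simp
    \<comment> \<open>An increasing self-map of {0..<n} lies above the identity when counted from
      the bottom and below it when counted from the top.\<close>
    have ge: "i \<le> p i" if "i < n" for i
      using that
    proof (induction i)
      case (Suc i)
      then show ?case using mono[of i "Suc i"] by simp
    qed simp
    have le: "p (n - 1 - d) \<le> n - 1 - d" if "d < n" for d
      using that
    proof (induction d)
      case 0
      then show ?case using lt[of "n - 1"] by simp
    next
      case (Suc d)
      have "p (n - 1 - Suc d) < p (n - 1 - d)" by (rule mono) (use Suc.prems in auto)
      then show ?case using Suc by linarith
    qed
    have "p i = i" for i
    proof (cases "i < n")
      case True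
      then show ?thesis using ge[of i] le[of "n - 1 - i"] by simp
    next
      case False
      then show ?thesis using p by (simp add: permutes_def)
    qed
    then have "p = id" by (simp add: fun_eq_iff)
    then show ?thesis using kappa_pos by (auto simp: sign_id I_0 intro!: prod_nonneg)
  qed
qed

text \<open>The exponential of the discrete Laplacian acts on non-colliding particle configurations:
  a move either keeps the configuration ordered or produces a collision, where the
  determinant vanishes.\<close>

lemma dtoep_0_nonneg:
  assumes "\<And>i j. i < j \<Longrightarrow> j < n \<Longrightarrow> x i < x j"
  shows "dtoep n m 0 x \<ge> 0"
  using assms
proof (induction m arbitrary: x)
  case 0
  then show ?case using toep_0_nonneg by simp
next
  case (Suc m)
  have key: "dtoep n m 0 (x(k := x k + e)) \<ge> 0" if "k < n" "\<bar>e\<bar> = 1" for k e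
  proof (cases "\<exists>i<n. i \<noteq> k \<and> x i = x k + e")
    case True
    then obtain i where "i < n" "i \<noteq> k" "x i = x k + e" by blast
    then show ?thesis
      using dtoep_collision[of i n k "x(k := x k + e)"] that by simp
  next
    case False
    have "(x(k := x k + e)) i < (x(k := x k + e)) j" if "i < j" "j < n" for i j
      using Suc.prems[OF that] False that \<open>\<bar>e\<bar> = 1\<close> by (auto simp: abs_if split: if_splits) (smt (verit) order.strict_trans)+
    then show ?thesis by (rule Suc.IH)
  qed
  show ?case
    unfolding dtoep.simps nbrs_def
    by (intro sum_nonneg add_nonneg_nonneg) (use key[of _ 1] key[of _ "-1"] in auto)
qed

text \<open>The top k particles stand one site to the right of the packed configuration. Moving the
  lowest of them back causes no collision and leads to the case k - 1; the packed configuration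
  itself has determinant \<kappa>^n.\<close>

lemma dtoep_0_pos:
  assumes "k \<le> n"
  shows "dtoep n k 0 (\<lambda>i. if i < n - k then int i else int i + 1) > 0"
  using assms
proof (induction k)
  case 0
  have x: "toep n (I 0) (\<lambda>i. if i < n then int i else int i + 1) = toep n (I 0) int"
    unfolding toep_alt by (intro sum.cong prod.cong refl arg_cong2[where f = "(*)"]) auto
  have "Determinant.det (Matrix.mat n n (\<lambda>(i, j). I 0 (int i - int j))) =
      prod_list (diag_mat (Matrix.mat n n (\<lambda>(i, j). I 0 (int i - int j))))"
    by (rule det_upper_triangular[of _ n]) (auto simp: I_0)
  also have "\<dots> = \<kappa> ^ n"
  proof -
    have "diag_mat (Matrix.mat n n (\<lambda>(i, j). I 0 (int i - int j))) = replicate n \<kappa>"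
      by (rule nth_equalityI) (auto simp: diag_mat_def I_0)
    then show ?thesis by (simp add: prod_list_replicate)
  qed
  finally show ?case using x kappa_pos by (simp add: toep_def)
next
  case (Suc k)
  define x where "x = (\<lambda>i. if i < n - Suc k then int i else int i + 1)"
  define q where "q = n - Suc k"
  have q: "q < n" using Suc.prems by (simp add: q_def)
  have "x(q := x q - 1) = (\<lambda>i. if i < n - k then int i else int i + 1)"
    using Suc.prems by (auto simp: x_def q_def fun_eq_iff)
  then have pos: "dtoep n k 0 (x(q := x q - 1)) > 0" using Suc by simp
  have nn: "dtoep n k 0 (x(i := x i + e)) \<ge> 0" if "i < n" "\<bar>e\<bar> = 1" for i e
  proof (cases "\<exists>j<n. j \<noteq> i \<and> x j = x i + e")
    case True
    then show ?thesis
      using dtoep_collision[of _ n i "x(i := x i + e)"] that by fastforce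
  next
    case False
    have "(x(i := x i + e)) j < (x(i := x i + e)) j'" if "j < j'" "j' < n" for j j'
    proof -
      have "x j < x j'" using that by (auto simp: x_def)
      then show ?thesis using False that \<open>\<bar>e\<bar> = 1\<close>
        by (auto simp: abs_if split: if_splits) (smt (verit) order.strict_trans)+
    qed
    then show ?thesis by (rule dtoep_0_nonneg)
  qed
  have "0 < (\<Sum>i<n. dtoep n k 0 (x(i := x i - 1)) + dtoep n k 0 (x(i := x i + 1)))"
    by (rule sum_pos2[of _ q])
      (use q pos nn[of _ 1] nn[of _ "-1"] in \<open>auto intro: add_pos_nonneg\<close>)
  then show ?case by (simp add: nbrs_def x_def)
qed

text \<open>Taylor expansion at time 0: all coefficients are nonnegative, and the n-th one is
  positive because n moves carry the shifted configuration to the packed one. The lower bound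
  \<open>c\<close> does not depend on the order M, and the remainder (2 n T)^M / M! disappears as M
  tends to infinity.\<close>

theorem toep_shift_pos: "toep n (I T) (\<lambda>i. int i + 1) > 0"
proof -
  define x where "x = (\<lambda>i::nat. int i + 1)"
  have incr: "x i < x j" if "i < j" for i j using that by (simp add: x_def)
  define c where "c = dtoep n n 0 x / fact n * T ^ n"
  have c: "c > 0"
    using dtoep_0_pos[of n n] T_pos by (simp add: c_def x_def)
  define C where "C = (fact n * B ^ n :: real)"
  have lower: "toep n (I T) x \<ge> c - C * ((2 * real n * T) ^ M / fact M)" if M: "M > n" for M
  proof -
    have "\<exists>t>0. t < T \<and> dtoep n 0 T x = (\<Sum>m<M. dtoep n m 0 x / fact m * T ^ m) + dtoep n M t x / fact M * T ^ M"
      by (rule Maclaurin[where diff = "\<lambda>m t. dtoep n m t x"]) (use M T_pos deriv_dtoep in auto)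
    then obtain t where t: "0 < t" "t < T"
      and eq: "toep n (I T) x = (\<Sum>m<M. dtoep n m 0 x / fact m * T ^ m) + dtoep n M t x / fact M * T ^ M"
      by auto
    have "c \<le> (\<Sum>m<M. dtoep n m 0 x / fact m * T ^ m)"
      unfolding c_def by (rule member_le_sum) (use M T_pos incr dtoep_0_nonneg in auto)
    moreover have "\<bar>dtoep n M t x / fact M * T ^ M\<bar> \<le> C * ((2 * real n * T) ^ M / fact M)"
    proof -
      have "\<bar>dtoep n M t x / fact M * T ^ M\<bar> = \<bar>dtoep n M t x\<bar> * (T ^ M / fact M)"
        using T_pos by (simp add: abs_mult)
      also have "\<dots> \<le> ((2 * real n) ^ M * C) * (T ^ M / fact M)"
        using dtoep_bound[of t n M x] t T_pos by (intro mult_right_mono) (auto simp: C_def)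
      finally show ?thesis by (simp add: power_mult_distrib algebra_simps)
    qed
    ultimately show ?thesis using eq by linarith
  qed
  have "(\<lambda>M. (2 * real n * T) ^ M / fact M) \<longlonglongrightarrow> 0"
    using summable_LIMSEQ_zero[OF summable_exp[of "2 * real n * T"]] by (simp add: field_simps)
  then have "(\<lambda>M. c - C * ((2 * real n * T) ^ M / fact M)) \<longlonglongrightarrow> c - C * 0"
    by (intro tendsto_intros)
  then have "(\<lambda>M. c - C * ((2 * real n * T) ^ M / fact M)) \<longlonglongrightarrow> c" by simp
  moreover have "\<forall>\<^sub>F M in sequentially. c - C * ((2 * real n * T) ^ M / fact M) \<le> toep n (I T) x"
    using eventually_gt_at_top[of n] by eventually_elim (rule lower)
  ultimately have "c \<le> toep n (I T) x"
    by (rule tendsto_upperbound) simp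
  then show ?thesis using c by (simp add: x_def)
qed

end

section \<open>A Volterra equation near infinity\<close>

text \<open>In the coordinate \<open>x = 1 / z\<close> the second order equation is
  \<open>h'' = (\<mu> + \<mu> / x\<^sup>2 + k / x) h' - c / x\<^sup>2 h\<close>.  It is solved by successive approximation, integrating
  along the rays \<open>x + t (1 - \<i>)\<close>: on them \<open>Re x\<close> increases, so that \<open>exp (- \<mu> x)\<close> decays, and
  they do not leave the regions \<open>Om r\<close>, which contain the closed lower half-plane near infinity.\<close>

definition ray :: "complex \<Rightarrow> real \<Rightarrow> complex" where
  "ray x t = x + of_real t * (1 - \<i>)"

text \<open>A union of two half-planes: the direction 1 - \<i> points into the first, and the second
  is bounded by a line parallel to it. \<open>Om 0\<close> is the plane without the closed wedge
  around the positive imaginary axis.\<close>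

definition Om :: "real \<Rightarrow> complex set" where
  "Om r = {x. Re x - Im x > r \<or> Re x + Im x < - r}"

lemma ray_simps [simp]:
  "Re (ray x t) = Re x + t" "Im (ray x t) = Im x - t" "ray x 0 = x"
  "ray (ray x s) t = ray x (s + t)"
  by (auto simp: ray_def algebra_simps)

lemma Om_ray: "x \<in> Om r \<Longrightarrow> 0 \<le> t \<Longrightarrow> ray x t \<in> Om r"
  by (auto simp: Om_def)

lemma open_Om: "open (Om r)"
  unfolding Om_def by (intro open_Collect_disj open_Collect_less continuous_intros)

lemma Om_antimono: "r \<le> s \<Longrightarrow> Om s \<subseteq> Om r"
  by (auto simp: Om_def)

lemma Om_0_E:
  assumes "x \<in> Om 0" obtains r where "r > 0" "x \<in> Om r"
proof
  show "max (Re x - Im x) (- (Re x + Im x)) / 2 > 0"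
    "x \<in> Om (max (Re x - Im x) (- (Re x + Im x)) / 2)"
    using assms by (auto simp: Om_def max_def field_simps)
qed

lemma Om_0_not_0: "x \<in> Om r \<Longrightarrow> r \<ge> 0 \<Longrightarrow> x \<noteq> 0"
  by (auto simp: Om_def)

lemma norm_sq_AB: "(cmod x)\<^sup>2 = ((Re x - Im x)\<^sup>2 + (Re x + Im x)\<^sup>2) / 2"
  unfolding cmod_power2 by (simp add: power2_eq_square algebra_simps)

lemma Om_norm_ge:
  assumes "x \<in> Om r" "r \<ge> 0"
  shows "r\<^sup>2 \<le> 2 * (cmod x)\<^sup>2"
proof -
  have "r\<^sup>2 \<le> (Re x - Im x)\<^sup>2 \<or> r\<^sup>2 \<le> (Re x + Im x)\<^sup>2"
    using assms by (auto simp: Om_def abs_le_square_iff[symmetric])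
  moreover have "2 * (cmod x)\<^sup>2 = (Re x - Im x)\<^sup>2 + (Re x + Im x)\<^sup>2"
    unfolding norm_sq_AB by simp
  ultimately show ?thesis
    using zero_le_power2[of "Re x - Im x"] zero_le_power2[of "Re x + Im x"] by linarith
qed

lemma Om_norm_ge_half:
  assumes "x \<in> Om r" "r \<ge> 0"
  shows "r \<le> 2 * cmod x"
proof -
  have "r\<^sup>2 \<le> 4 * (cmod x)\<^sup>2"
    using Om_norm_ge[OF assms] zero_le_power2[of "cmod x"] by linarith
  then have "r\<^sup>2 \<le> (2 * cmod x)\<^sup>2" by (simp add: power_mult_distrib)
  then show ?thesis by (rule power2_le_imp_le) simp
qed

text \<open>Along a ray \<open>Re x - Im x\<close> grows at speed 2, so this bound makes 1 / |x|^2
  integrable with a multiple of arctan as majorant. This is the origin of the weight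
  \<open>wt\<close>.\<close>

lemma Om_norm_weight:
  assumes "x \<in> Om r" "r > 0"
  shows "1 + (Re x - Im x)\<^sup>2 \<le> (2 / r\<^sup>2 + 2) * (cmod x)\<^sup>2"
proof -
  have "1 \<le> 2 / r\<^sup>2 * (cmod x)\<^sup>2"
    using Om_norm_ge[OF assms(1)] assms(2) by (simp add: field_simps)
  moreover have "(Re x - Im x)\<^sup>2 \<le> 2 * (cmod x)\<^sup>2"
    unfolding norm_sq_AB by simp
  ultimately show ?thesis by (simp add: algebra_simps)
qed

lemma norm_dir: "cmod (1 - \<i>) = sqrt 2"
  by (simp add: cmod_def)

lemma norm_dir_le: "cmod (1 - \<i>) \<le> 2"
  by (simp add: norm_dir real_le_lsqrt)

lemma has_vector_derivative_ray:
  assumes "(f has_field_derivative f') (at (ray x t))"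
  shows "((\<lambda>t. f (ray x t)) has_vector_derivative (1 - \<i>) * f') (at t)"
proof -
  have "(ray x has_vector_derivative (1 - \<i>)) (at t)"
    unfolding ray_def[abs_def] by (auto intro!: derivative_eq_intros)
  then show ?thesis
    using field_vector_diff_chain_at[of "ray x" "1 - \<i>" t f f'] assms by (simp add: o_def)
qed

text \<open>Integrals along rays are never formed; increments are compared with an explicit real
  function \<open>D\<close>. The factor 2 bounds the speed |1 - \<i>| = sqrt 2.\<close>

lemma ray_increment_bound:
  assumes der: "\<And>y. y \<in> Om 0 \<Longrightarrow> (\<Phi> has_field_derivative F y) (at y)"
    and x: "x \<in> Om 0" and st: "0 \<le> s" "s \<le> t"
    and D: "\<And>u. u \<ge> 0 \<Longrightarrow> (D has_real_derivative D' u) (at u)"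
    and bound: "\<And>u. u \<ge> 0 \<Longrightarrow> 2 * cmod (F (ray x u)) \<le> D' u"
  shows "cmod (\<Phi> (ray x t) - \<Phi> (ray x s)) \<le> D t - D s"
proof (cases "s = t")
  case False
  have vd: "((\<lambda>t. \<Phi> (ray x t)) has_vector_derivative (1 - \<i>) * F (ray x u)) (at u)" if "u \<ge> 0" for u
    by (rule has_vector_derivative_ray) (use der Om_ray[OF x that] in blast)
  show ?thesis
  proof (rule differentiable_bound_general[where f = "\<lambda>t. \<Phi> (ray x t)" and \<phi> = D])
    show "s < t" using st False by simp
    show "continuous_on {s..t} (\<lambda>t. \<Phi> (ray x t))"
      using vd st by (intro continuous_at_imp_continuous_on ballI has_vector_derivative_continuous[OF vd]) auto
    show "continuous_on {s..t} D"
      using D st by (intro continuous_at_imp_continuous_on ballI DERIV_isCont[OF D]) auto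
    show "((\<lambda>t. \<Phi> (ray x t)) has_vector_derivative (1 - \<i>) * F (ray x u)) (at u)" if "s < u" for u
      using vd that st by simp
    show "(D has_vector_derivative D' u) (at u)" if "s < u" for u
      using D[of u] that st by (simp add: has_real_derivative_iff_has_vector_derivative)
    show "cmod ((1 - \<i>) * F (ray x u)) \<le> D' u" if "s < u" for u
      using bound[of u] that st mult_right_mono[OF norm_dir_le norm_ge_zero, of "F (ray x u)"]
      by (simp add: norm_mult)
  qed
qed simp

lemma tail_bound:
  assumes der: "\<And>y. y \<in> Om 0 \<Longrightarrow> (\<Phi> has_field_derivative F y) (at y)"
    and x: "x \<in> Om 0"
    and tail: "((\<lambda>t. \<Phi> (ray x t)) \<longlongrightarrow> L) at_top"
    and D: "\<And>u. u \<ge> 0 \<Longrightarrow> (D has_real_derivative D' u) (at u)"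
    and D_lim: "(D \<longlongrightarrow> d) at_top"
    and bound: "\<And>u. u \<ge> 0 \<Longrightarrow> 2 * cmod (F (ray x u)) \<le> D' u"
  shows "cmod (\<Phi> x - L) \<le> d - D 0"
proof -
  have "((\<lambda>t. cmod (\<Phi> (ray x t) - \<Phi> x)) \<longlongrightarrow> cmod (L - \<Phi> x)) at_top"
    by (intro tendsto_intros tail)
  moreover have "((\<lambda>t. D t - D 0) \<longlongrightarrow> d - D 0) at_top"
    by (intro tendsto_intros D_lim)
  moreover have "\<forall>\<^sub>F t in at_top. cmod (\<Phi> (ray x t) - \<Phi> x) \<le> D t - D 0"
    using eventually_ge_at_top[of 0]
  proof eventually_elim
    case (elim t)
    then show ?case
      using ray_increment_bound[OF der x order.refl elim D bound] by simp
  qed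
  ultimately have "cmod (L - \<Phi> x) \<le> d - D 0"
    using tendsto_le trivial_limit_at_top_linorder by blast
  then show ?thesis by (simp add: norm_minus_commute)
qed

lemma starlike_Om: "starlike (Om 0)"
proof -
  \<comment> \<open>The centre \<open>1 - 2 * \<i>\<close> lies in both half-planes of
    \<open>Om 0\<close>, so the segment to a point stays in the half-plane of that point.\<close>
  have "closed_segment (1 - 2 * \<i>) x \<subseteq> Om 0" if "x \<in> Om 0" for x
  proof
    fix y assume "y \<in> closed_segment (1 - 2 * \<i>) x"
    then obtain u where u: "0 \<le> u" "u \<le> 1" and y: "y = (1 - u) *\<^sub>R (1 - 2 * \<i>) + u *\<^sub>R x"
      by (auto simp: closed_segment_def)
    have e1: "Re y - Im y = (1 - u) * 3 + u * (Re x - Im x)"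
      and e2: "Re y + Im y = - ((1 - u) + u * - (Re x + Im x))"
      by (simp_all add: y algebra_simps)
    have pos: "(1 - u) * a + u * b > 0" if "a > 0" "b > 0" for a b :: real
      using u that by (cases "u = 0") (auto intro: add_nonneg_pos)
    show "y \<in> Om 0"
      using that pos[of 3 "Re x - Im x"] pos[of 1 "- (Re x + Im x)"] e1 e2 by (auto simp: Om_def)
  qed
  moreover have "1 - 2 * \<i> \<in> Om 0" by (simp add: Om_def)
  ultimately show ?thesis by (auto simp: starlike_def)
qed

lemma arctan_shift_tendsto: "((\<lambda>t. c * arctan t) \<longlongrightarrow> c * (pi / 2)) at_top"
  by (intro tendsto_intros tendsto_arctan_at_top)

text \<open>This replaces the integral from infinity. A primitive \<open>P\<close> has a limit
  \<open>L x\<close> along the ray from x, and \<open>L\<close> is locally constant because the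
  difference of \<open>P\<close> along neighbouring rays tends to 0; hence \<open>P - L\<close> is
  still a primitive. Continuity of \<open>K\<close> makes the bound locally uniform in the starting
  point.\<close>

lemma tail_primitive:
  assumes hol: "F holomorphic_on Om 0"
    and bound: "\<And>r. r > 0 \<Longrightarrow> \<exists>K. continuous_on (Om r) K \<and>
      (\<forall>x\<in>Om r. \<forall>t\<ge>0. cmod (F (ray x t)) \<le> K x / (1 + t\<^sup>2))"
  obtains \<Phi> where "\<And>x. x \<in> Om 0 \<Longrightarrow> (\<Phi> has_field_derivative F x) (at x)"
    and "\<And>x. x \<in> Om 0 \<Longrightarrow> ((\<lambda>t. \<Phi> (ray x t)) \<longlongrightarrow> 0) at_top"
proof -
  obtain P where P: "\<And>x. x \<in> Om 0 \<Longrightarrow> (P has_field_derivative F x) (at x)"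
    using holomorphic_starlike_primitive[OF _ starlike_Om open_Om, of F "{}"] hol
    by (auto simp: holomorphic_on_imp_continuous_on holomorphic_on_def open_Om at_within_open[OF _ open_Om])
  define L where "L x = Lim at_top (\<lambda>t. P (ray x t))" for x
  have lim: "((\<lambda>t. P (ray x t)) \<longlongrightarrow> L x) at_top" if "x \<in> Om 0" for x
  proof -
    obtain r where r: "r > 0" "x \<in> Om r" using Om_0_E[OF \<open>x \<in> Om 0\<close>] by blast
    obtain K where K: "\<And>t. t \<ge> 0 \<Longrightarrow> cmod (F (ray x t)) \<le> K x / (1 + t\<^sup>2)"
      using bound[OF r(1)] r(2) by blast
    define D where "D t = 2 * K x * arctan t" for t
    have D: "(D has_real_derivative 2 * K x / (1 + t\<^sup>2)) (at t)" for t
      unfolding D_def by (auto intro!: derivative_eq_intros simp: field_simps)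
    have inc: "cmod (P (ray x t) - P (ray x s)) \<le> D t - D s" if "0 \<le> s" "s \<le> t" for s t
      by (rule ray_increment_bound[OF P \<open>x \<in> Om 0\<close> that D]) (use mult_left_mono[OF K, of _ 2] in auto)
    have Dlim: "(D \<longlongrightarrow> 2 * K x * (pi / 2)) at_top"
      unfolding D_def by (rule arctan_shift_tendsto)
    have "\<exists>l. ((\<lambda>t. P (ray x t)) \<longlongrightarrow> l) at_top"
    proof -
      have "Cauchy (\<lambda>n. P (ray x (real n)))"
      proof (rule CauchyI')
        fix e :: real assume "e > 0"
        have "(\<lambda>n. D (real n)) \<longlonglongrightarrow> 2 * K x * (pi / 2)"
          using Dlim filterlim_compose filterlim_real_sequentially by blast
        then have "Cauchy (\<lambda>n. D (real n))" by (rule LIMSEQ_imp_Cauchy)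
        then obtain M where M: "\<And>m n. m \<ge> M \<Longrightarrow> n \<ge> M \<Longrightarrow> \<bar>D (real m) - D (real n)\<bar> < e"
          using \<open>e > 0\<close> unfolding Cauchy_iff by (metis real_norm_def)
        show "\<exists>M. \<forall>m\<ge>M. \<forall>n>m. dist (P (ray x (real m))) (P (ray x (real n))) < e"
        proof (intro exI allI impI)
          fix m n assume "m \<ge> M" "n > m"
          then show "dist (P (ray x (real m))) (P (ray x (real n))) < e"
            using M[of n m] inc[of "real m" "real n"] by (simp add: dist_norm norm_minus_commute)
        qed
      qed
      then obtain l where l: "(\<lambda>n. P (ray x (real n))) \<longlonglongrightarrow> l"
        using Cauchy_convergent convergent_def by blast
      have ev: "cmod (P (ray x t) - l) \<le> 2 * K x * (pi / 2) - D t" if "t \<ge> 0" for t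
      proof -
        have 1: "(\<lambda>n. cmod (P (ray x (real n)) - P (ray x t))) \<longlonglongrightarrow> cmod (l - P (ray x t))"
          by (intro tendsto_intros l)
        have 2: "(\<lambda>n. D (real n) - D t) \<longlonglongrightarrow> 2 * K x * (pi / 2) - D t"
          by (intro tendsto_intros filterlim_compose[OF Dlim filterlim_real_sequentially])
        have "\<forall>\<^sub>F n in sequentially. cmod (P (ray x (real n)) - P (ray x t)) \<le> D (real n) - D t"
          using eventually_ge_at_top[of "nat \<lceil>t\<rceil>"]
          by eventually_elim (rule inc, use that in linarith, linarith)
        then have "cmod (l - P (ray x t)) \<le> 2 * K x * (pi / 2) - D t"
          using tendsto_le[OF _ 2 1] by simp
        then show ?thesis by (simp add: norm_minus_commute)
      qed
      have "((\<lambda>t. 2 * K x * (pi / 2) - D t) \<longlongrightarrow> 0) at_top"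
        using tendsto_diff[OF tendsto_const[of "2 * K x * (pi / 2)"] Dlim] by (simp only: diff_self)
      then have "((\<lambda>t. P (ray x t) - l) \<longlongrightarrow> 0) at_top"
        by (rule Lim_null_comparison[rotated])
          (use ev in \<open>auto simp: eventually_at_top_linorder\<close>)
      then have "((\<lambda>t. P (ray x t)) \<longlongrightarrow> l) at_top" by (rule iffD2[OF Lim_null])
      then show ?thesis by (rule exI)
    qed
    then show ?thesis
      unfolding L_def using tendsto_Lim trivial_limit_at_top_linorder by blast
  qed
  have L_ray: "L (ray x s) = L x" if "x \<in> Om 0" "s \<ge> 0" for x s
  proof -
    have "((\<lambda>t. P (ray (ray x s) t)) \<longlongrightarrow> L x) at_top"
      using filterlim_compose[OF lim[OF that(1)], of "\<lambda>t. s + t" at_top]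
        filterlim_tendsto_add_at_top[OF tendsto_const filterlim_ident, of s] by simp
    then show ?thesis
      using lim[OF Om_ray[OF that]] tendsto_unique trivial_limit_at_top_linorder by blast
  qed
  have loc: "\<exists>\<delta>>0. ball x \<delta> \<subseteq> Om 0 \<and> (\<forall>y\<in>ball x \<delta>. L y = L x)" if "x \<in> Om 0" for x
  proof -
    obtain r where r: "r > 0" "x \<in> Om r" using Om_0_E[OF \<open>x \<in> Om 0\<close>] by blast
    obtain K where K: "continuous_on (Om r) K"
      "\<And>x t. x \<in> Om r \<Longrightarrow> t \<ge> 0 \<Longrightarrow> cmod (F (ray x t)) \<le> K x / (1 + t\<^sup>2)"
      using bound[OF r(1)] by blast
    have "isCont K x" using K(1) r(2) open_Om continuous_on_eq_continuous_at by blast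
    then have "\<forall>\<^sub>F y in nhds x. K y < K x + 1"
      by (intro order_tendstoD(2)[of K "K x"]) (auto simp: isCont_def tendsto_at_iff_tendsto_nhds)
    moreover have "\<forall>\<^sub>F y in nhds x. y \<in> Om r"
      using r(2) open_Om by (rule eventually_nhds_in_open[rotated])
    ultimately have "\<forall>\<^sub>F y in nhds x. K y < K x + 1 \<and> y \<in> Om r" by eventually_elim simp
    then obtain \<delta> where \<delta>: "\<delta> > 0" "\<And>y. y \<in> ball x \<delta> \<Longrightarrow> K y < K x + 1 \<and> y \<in> Om r"
      unfolding eventually_nhds_metric by (auto simp: dist_commute)
    have sub: "ball x \<delta> \<subseteq> Om 0" using \<delta>(2) Om_antimono[of 0 r] r(1) by auto
    have "L y = L x" if y: "y \<in> ball x \<delta>" for y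
    proof -
      have est: "cmod (P (ray y t) - P (ray x t)) \<le> (K x + 1) * cmod (y - x) * (1 / (1 + t\<^sup>2))" if "t \<ge> 0" for t
      proof -
        have "cmod (P (ray y t) - P (ray x t)) \<le> (K x + 1) / (1 + t\<^sup>2) * cmod (y - x)"
        proof (rule field_differentiable_bound[of "ball x \<delta>" "\<lambda>z. P (ray z t)" "\<lambda>z. F (ray z t)"])
          fix z assume z: "z \<in> ball x \<delta>"
          have "(P has_field_derivative F (ray z t)) (at (ray z t))"
            by (rule P) (use z sub \<open>t \<ge> 0\<close> Om_ray in blast)
          moreover have "((\<lambda>z. ray z t) has_field_derivative 1) (at z)"
            unfolding ray_def by (auto intro!: derivative_eq_intros)
          ultimately have "((\<lambda>z. P (ray z t)) has_field_derivative F (ray z t)) (at z)"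
            using DERIV_chain2 by fastforce
          then show "((\<lambda>z. P (ray z t)) has_field_derivative F (ray z t)) (at z within ball x \<delta>)"
            by (rule has_field_derivative_at_within)
          have "cmod (F (ray z t)) \<le> K z / (1 + t\<^sup>2)" using K(2) \<delta>(2)[OF z] \<open>t \<ge> 0\<close> by blast
          also have "\<dots> \<le> (K x + 1) / (1 + t\<^sup>2)"
            using \<delta>(2)[OF z] by (intro divide_right_mono) auto
          finally show "cmod (F (ray z t)) \<le> (K x + 1) / (1 + t\<^sup>2)" .
        qed (use y \<delta> in auto)
        then show ?thesis by (simp add: field_simps)
      qed
      have "((\<lambda>t::real. 1 / (1 + t\<^sup>2)) \<longlongrightarrow> 0) at_top"
        by real_asymp
      then have "((\<lambda>t. (K x + 1) * cmod (y - x) * (1 / (1 + t\<^sup>2))) \<longlongrightarrow> 0) at_top"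
        by (rule tendsto_mult_right_zero)
      then have "((\<lambda>t. P (ray y t) - P (ray x t)) \<longlongrightarrow> 0) at_top"
        by (rule Lim_null_comparison[rotated])
          (use est in \<open>auto simp: eventually_at_top_linorder\<close>)
      moreover have "((\<lambda>t. P (ray y t) - P (ray x t)) \<longlongrightarrow> L y - L x) at_top"
        using y sub \<open>x \<in> Om 0\<close> by (intro tendsto_diff lim) auto
      ultimately have "L y - L x = 0"
        using tendsto_unique trivial_limit_at_top_linorder by blast
      then show ?thesis by simp
    qed
    then show ?thesis using \<delta>(1) sub by blast
  qed
  show ?thesis
  proof (rule that[of "\<lambda>x. P x - L x"])
    fix x assume x: "x \<in> Om 0"
    obtain \<delta> where \<delta>: "\<delta> > 0" "\<forall>y\<in>ball x \<delta>. L y = L x" using loc[OF x] by blast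
    have "((\<lambda>y. P y - L x) has_field_derivative F x - 0) (at x)"
      by (intro DERIV_diff P[OF x] DERIV_const)
    then have "((\<lambda>y. P y - L x) has_field_derivative F x) (at x)" by simp
    then show "((\<lambda>x. P x - L x) has_field_derivative F x) (at x)"
    proof (rule has_field_derivative_transform_within_open)
      show "P y - L x = P y - L y" if "y \<in> ball x \<delta>" for y
        by (simp only: bspec[OF \<delta>(2) that])
    qed (use \<delta>(1) in auto)
    have "((\<lambda>t. P (ray x t) - L x) \<longlongrightarrow> L x - L x) at_top"
      by (intro tendsto_intros lim x)
    then have "((\<lambda>t. P (ray x t) - L x) \<longlongrightarrow> 0) at_top" by simp
    moreover have "\<forall>\<^sub>F t in at_top. P (ray x t) - L x = P (ray x t) - L (ray x t)"
      using eventually_ge_at_top[of 0] by eventually_elim (simp add: L_ray x)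
    ultimately show "((\<lambda>t. P (ray x t) - L (ray x t)) \<longlongrightarrow> 0) at_top"
      by (rule Lim_transform_eventually)
  qed
qed

section \<open>Growth of powers and norms along the rays\<close>

lemma powr_le_exp:
  fixes b p \<epsilon> t :: real
  assumes "b \<ge> 0" "p > 0" "\<epsilon> > 0" "t \<ge> 0"
  shows "(1 + b * t) powr p \<le> max 1 (b * p / \<epsilon>) powr p * exp (\<epsilon> * t)"
proof -
  define m where "m = max 1 (b * p / \<epsilon>)"
  have m: "m \<ge> 1" "b * p / \<epsilon> \<le> m" by (simp_all only: m_def max.cobounded1 max.cobounded2)
  have "1 + b * t = 1 + (b * p / \<epsilon>) * (\<epsilon> * t / p)"
    using assms by (simp add: field_simps)
  also have "\<dots> \<le> m + m * (\<epsilon> * t / p)"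
    using m assms by (intro add_mono mult_right_mono) auto
  also have "\<dots> = m * (1 + \<epsilon> * t / p)" by (simp add: algebra_simps)
  also have "\<dots> \<le> m * exp (\<epsilon> * t / p)"
    using m by (intro mult_left_mono exp_ge_add_one_self) auto
  finally have "(1 + b * t) powr p \<le> (m * exp (\<epsilon> * t / p)) powr p"
    using assms by (intro powr_mono2) auto
  also have "\<dots> = m powr p * exp (\<epsilon> * t)"
    using m assms by (simp add: powr_mult exp_powr_real)
  finally show ?thesis by (simp add: m_def)
qed

lemma ratio_powr_le:
  fixes q :: real
  assumes "0 < u" "u \<le> m" "1 / m \<le> u" "\<bar>p\<bar> \<le> q" "m \<ge> 1"
  shows "u powr p \<le> m powr q"
proof (cases "p \<ge> 0")
  case True
  then have "u powr p \<le> m powr p" using assms by (intro powr_mono2) auto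
  also have "\<dots> \<le> m powr q" using assms by (intro powr_mono) auto
  finally show ?thesis .
next
  case False
  have "u powr p = (1 / u) powr (- p)"
    using assms by (simp add: powr_minus powr_divide)
  also have "\<dots> \<le> m powr (- p)"
    using assms False by (intro powr_mono2) (auto simp: field_simps)
  also have "\<dots> \<le> m powr q" using assms False by (intro powr_mono) auto
  finally show ?thesis .
qed

lemma one_plus_sq_shift: "1 + s\<^sup>2 \<le> 2 * (1 + a\<^sup>2) * (1 + (a + s)\<^sup>2)" for a s :: real
proof -
  have "s\<^sup>2 \<le> 2 * (a + s)\<^sup>2 + 2 * a\<^sup>2"
    using zero_le_power2[of "a + (a + s)"] by (simp add: power2_eq_square algebra_simps)
  then have "1 + s\<^sup>2 \<le> 2 * (1 + a\<^sup>2 + (a + s)\<^sup>2)" by simp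
  also have "\<dots> \<le> 2 * (1 + a\<^sup>2 + (a + s)\<^sup>2 + a\<^sup>2 * (a + s)\<^sup>2)" by simp
  finally show ?thesis by (simp add: algebra_simps)
qed

text \<open>Points of \<open>Om r\<close> have modulus at least r / 2, so the displacement, at most
  2 t, is at most 4 t / r relative to either end point.\<close>

lemma norm_ray_bounds:
  assumes "x \<in> Om r" "r > 0" "t \<ge> 0"
  shows "cmod (ray x t) \<le> cmod x * (1 + 4 * t / r)" "cmod x \<le> cmod (ray x t) * (1 + 4 * t / r)"
proof -
  have rb: "r \<le> 2 * cmod y" if "y \<in> Om r" for y
    using Om_norm_ge_half[OF that] assms(2) by simp
  have d: "cmod (of_real t * (1 - \<i>)) \<le> 2 * t"
    using norm_dir_le assms(3) by (simp add: norm_mult mult.commute mult_left_mono)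
  have ray: "ray x t \<in> Om r" using Om_ray assms by blast
  have "cmod (ray x t) \<le> cmod x + 2 * t"
    unfolding ray_def using norm_triangle_le d by (metis add_left_mono norm_triangle_ineq order_trans)
  moreover have "2 * t \<le> cmod x * (4 * t / r)"
    using rb[OF assms(1)] assms(2,3) mult_right_mono[of r "2 * cmod x" "2 * t"] by (simp add: field_simps)
  ultimately show "cmod (ray x t) \<le> cmod x * (1 + 4 * t / r)" by (simp add: algebra_simps)
  have "cmod x = cmod (ray x t - of_real t * (1 - \<i>))" by (simp add: ray_def)
  also have "\<dots> \<le> cmod (ray x t) + 2 * t"
    using d norm_triangle_ineq4[of "ray x t" "of_real t * (1 - \<i>)"] by linarith
  also have "2 * t \<le> cmod (ray x t) * (4 * t / r)"
    using rb[OF ray] assms(2,3) mult_right_mono[of r "2 * cmod (ray x t)" "2 * t"] by (simp add: field_simps)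
  finally show "cmod x \<le> cmod (ray x t) * (1 + 4 * t / r)" by (simp add: algebra_simps)
qed

section \<open>Integrating factor and successive approximation\<close>

locale volterra =
  fixes k \<mu> c :: real
  assumes mu_pos: "\<mu> > 0"
begin

text \<open>The integrating factor: it solves g' = \<open>pp\<close> g. Taking the logarithm of
  \<open>\<i> * x\<close> puts the branch cut on the positive imaginary axis, outside
  \<open>Om 0\<close>.\<close>

definition psi :: "complex \<Rightarrow> complex" where
  "psi x = exp (of_real \<mu> * x - of_real \<mu> / x + of_real k * Ln (\<i> * x))"

definition pp :: "complex \<Rightarrow> complex" where
  "pp x = of_real \<mu> + of_real \<mu> / x\<^sup>2 + of_real k / x"

lemma Om_cut: "x \<in> Om 0 \<Longrightarrow> \<i> * x \<notin> \<real>\<^sub>\<le>\<^sub>0"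
  by (auto simp: Om_def complex_nonpos_Reals_iff)

lemma psi_nonzero [simp]: "psi x \<noteq> 0"
  by (simp add: psi_def)

lemma psi_deriv:
  assumes "x \<in> Om 0"
  shows "(psi has_field_derivative pp x * psi x) (at x)"
proof -
  have "x \<noteq> 0" using Om_0_not_0 assms by auto
  then show ?thesis
    unfolding psi_def[abs_def] pp_def using Om_cut[OF assms]
    by (auto intro!: derivative_eq_intros simp: field_simps power2_eq_square)
qed

text \<open>The exponential gains exp (- \<mu> t) along a ray. Half of this rate pays for the power
  with exponent k and for \<open>(1 + 4 * t / r)\<^sup>2\<close>, which in turn will pay for
  replacing 1 / |\<open>ray x t\<close>|^2 by 1 / |x|^2.\<close>

lemma psi_ratio_bound:
  assumes "r > 0"
  obtains C where "C > 0"
    "\<And>x t. x \<in> Om r \<Longrightarrow> t \<ge> 0 \<Longrightarrow> cmod (psi x / psi (ray x t)) * (1 + 4 * t / r)\<^sup>2 \<le> C * exp (- \<mu> / 2 * t)"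
proof -
  define q where "q = \<bar>k\<bar> + 2"
  define C where "C = exp (4 * \<mu> / r) * max 1 (4 / r * q / (\<mu> / 2)) powr q"
  have "cmod (psi x / psi (ray x t)) * (1 + 4 * t / r)\<^sup>2 \<le> C * exp (- \<mu> / 2 * t)"
    if x: "x \<in> Om r" and t: "t \<ge> 0" for x t
  proof -
    define y where "y = ray x t"
    define m where "m = 1 + 4 / r * t"
    have m: "m \<ge> 1" using t assms by (simp add: m_def)
    have y: "y \<in> Om r" using Om_ray x t by (simp add: y_def)
    have nz: "x \<noteq> 0" "y \<noteq> 0" using Om_0_not_0 x y assms by auto
    have inv: "\<bar>Re (1 / z)\<bar> \<le> 2 / r" if "z \<in> Om r" for z
    proof -
      have "r \<le> 2 * cmod z" using Om_norm_ge_half[OF that] assms by simp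
      moreover have "z \<noteq> 0" using Om_0_not_0 that assms by auto
      ultimately have "cmod (1 / z) \<le> 2 / r"
        using assms by (simp add: norm_divide field_simps)
      then show ?thesis using abs_Re_le_cmod[of "1 / z"] by linarith
    qed
    have "psi x / psi y = exp (of_real \<mu> * (x - y) + of_real \<mu> * (1 / y - 1 / x) + of_real k * (Ln (\<i> * x) - Ln (\<i> * y)))"
      unfolding psi_def exp_diff[symmetric] by (simp add: algebra_simps)
    then have "cmod (psi x / psi y) = exp (\<mu> * (Re x - Re y) + \<mu> * (Re (1 / y) - Re (1 / x)) + k * (ln (cmod x) - ln (cmod y)))"
      using nz by (simp add: norm_mult del: Re_divide)
    also have "\<dots> = exp (\<mu> * (Re x - Re y)) * exp (\<mu> * (Re (1 / y) - Re (1 / x))) * (cmod x / cmod y) powr k"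
      using nz by (simp add: exp_add powr_def ln_div)
    also have "exp (\<mu> * (Re x - Re y)) = exp (- \<mu> * t)" by (simp add: y_def)
    finally have eq: "cmod (psi x / psi y) * m\<^sup>2 =
        exp (- \<mu> * t) * (exp (\<mu> * (Re (1 / y) - Re (1 / x))) * ((cmod x / cmod y) powr k * m\<^sup>2))"
      by (simp only: mult.assoc)
    have p1: "(cmod x / cmod y) powr k * m\<^sup>2 \<le> m powr q"
    proof -
      have "cmod x / cmod y \<le> m" "1 / m \<le> cmod x / cmod y"
        using norm_ray_bounds[OF x assms t] nz m by (auto simp: y_def m_def field_simps)
      then have "(cmod x / cmod y) powr k \<le> m powr \<bar>k\<bar>"
        using nz m by (intro ratio_powr_le) auto
      then have "(cmod x / cmod y) powr k * m\<^sup>2 \<le> m powr \<bar>k\<bar> * m powr 2"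
        using m by (intro mult_mono) (auto simp: powr_numeral)
      then show ?thesis by (simp add: q_def powr_add)
    qed
    have p2: "m powr q \<le> max 1 (4 / r * q / (\<mu> / 2)) powr q * exp (\<mu> / 2 * t)"
      unfolding m_def by (rule powr_le_exp) (use assms mu_pos t in \<open>auto simp: q_def\<close>)
    have p3: "exp (\<mu> * (Re (1 / y) - Re (1 / x))) \<le> exp (4 * \<mu> / r)"
    proof -
      have "Re (1 / y) - Re (1 / x) \<le> 4 / r" using inv[OF x] inv[OF y] by linarith
      then show ?thesis using mu_pos mult_left_mono[of "Re (1 / y) - Re (1 / x)" "4 / r" \<mu>] by (simp add: mult.commute del: Re_divide)
    qed
    have "cmod (psi x / psi y) * m\<^sup>2 \<le> exp (- \<mu> * t) * exp (4 * \<mu> / r) *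
        (max 1 (4 / r * q / (\<mu> / 2)) powr q * exp (\<mu> / 2 * t))"
      unfolding eq mult.assoc[of "exp (- \<mu> * t)"]
      by (intro mult_left_mono mult_mono order.trans[OF p1 p2] p3) (use m in auto)
    also have "\<dots> = C * (exp (- \<mu> * t) * exp (\<mu> / 2 * t))" by (simp add: C_def)
    also have "exp (- \<mu> * t) * exp (\<mu> / 2 * t) = exp (- \<mu> / 2 * t)"
      by (simp add: exp_add[symmetric])
    finally show ?thesis by (simp add: y_def m_def)
  qed
  moreover have "C > 0" by (simp add: C_def)
  ultimately show ?thesis using that by blast
qed


text \<open>A weight in the style of Bielecki: its logarithmic derivative along a ray is - 2
  \<Lambda> / (1 + a^2), where a is the current value of \<open>Re x - Im x\<close>. Integrating
  \<open>wt \<Lambda>\<close> against 1 / |x|^2 therefore gains a factor 1 / \<Lambda>.\<close>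

definition wt :: "real \<Rightarrow> complex \<Rightarrow> real" where
  "wt \<Lambda> x = exp (- \<Lambda> * arctan (Re x - Im x))"

definition good :: "(complex \<Rightarrow> complex) \<Rightarrow> bool" where
  "good h \<longleftrightarrow> h holomorphic_on Om 0 \<and> (\<forall>r>0. \<exists>B. \<forall>x\<in>Om r. cmod (h x) \<le> B)"

text \<open>The weight \<open>wt \<Lambda>\<close> turns the iteration into a contraction for large \<open>\<Lambda>\<close>.\<close>

definition is_step :: "(real \<Rightarrow> real) \<Rightarrow> (complex \<Rightarrow> complex) \<Rightarrow> (complex \<Rightarrow> complex) \<Rightarrow> (complex \<Rightarrow> complex) \<Rightarrow> bool" where
  "is_step C h g1 h1 \<longleftrightarrow>
     (\<forall>x\<in>Om 0. (g1 has_field_derivative pp x * g1 x - of_real c / x\<^sup>2 * h x) (at x)) \<and>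
     (\<forall>x\<in>Om 0. (h1 has_field_derivative g1 x) (at x)) \<and>
     (\<forall>r>0. \<forall>q\<ge>0. \<forall>\<Lambda>>0. (\<forall>x\<in>Om r. cmod (h x) \<le> q * wt \<Lambda> x) \<longrightarrow>
        (\<forall>x\<in>Om r. cmod (g1 x) \<le> C r * q * wt \<Lambda> x / (cmod x)\<^sup>2 \<and>
           cmod (h1 x) \<le> C r * q / \<Lambda> * (wt \<Lambda> x - exp (- \<Lambda> * (pi / 2)))))"

lemma wt_pos [simp]: "wt \<Lambda> x > 0" "wt \<Lambda> x \<ge> 0"
  by (simp_all add: wt_def)

lemma wt_ray_le: "t \<ge> 0 \<Longrightarrow> \<Lambda> \<ge> 0 \<Longrightarrow> wt \<Lambda> (ray x t) \<le> wt \<Lambda> x"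
  by (auto simp: wt_def intro!: mult_left_mono arctan_monotone')

lemma wt_bounds:
  assumes "\<Lambda> \<ge> 0"
  shows "wt \<Lambda> x \<le> exp (\<Lambda> * (pi / 2))" "exp (- \<Lambda> * (pi / 2)) \<le> wt \<Lambda> x"
proof -
  have "- (pi / 2) \<le> arctan (Re x - Im x)" "arctan (Re x - Im x) \<le> pi / 2"
    using arctan_lbound[of "Re x - Im x"] arctan_ubound[of "Re x - Im x"] by auto
  from this[THEN mult_left_mono[OF _ assms]]
  show "wt \<Lambda> x \<le> exp (\<Lambda> * (pi / 2))" "exp (- \<Lambda> * (pi / 2)) \<le> wt \<Lambda> x"
    unfolding wt_def by auto
qed

lemma inverse_ray_sq_le:
  assumes "x \<in> Om r" "r > 0" "t \<ge> 0"
  shows "1 / (cmod (ray x t))\<^sup>2 \<le> (1 + 4 * t / r)\<^sup>2 / (cmod x)\<^sup>2"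
proof -
  have "x \<noteq> 0" "ray x t \<noteq> 0"
    using Om_0_not_0 assms Om_ray[of x r t] by auto
  moreover have "(cmod x)\<^sup>2 \<le> (cmod (ray x t) * (1 + 4 * t / r))\<^sup>2"
    by (intro power_mono norm_ray_bounds(2) assms) auto
  moreover have "1 / R \<le> m / X" if "X > 0" "R > 0" "X \<le> R * m" for X R m :: real
    using that by (simp add: field_simps)
  ultimately show ?thesis by (simp add: power_mult_distrib)
qed

lemma kernel_bound:
  assumes C: "\<And>x t. x \<in> Om r \<Longrightarrow> t \<ge> 0 \<Longrightarrow> cmod (psi x / psi (ray x t)) * (1 + 4 * t / r)\<^sup>2 \<le> C * exp (- \<mu> / 2 * t)"
    and r: "r > 0" and x: "x \<in> Om r" and t: "t \<ge> 0" and h: "cmod (h (ray x t)) \<le> B"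
  shows "cmod (of_real c / (ray x t)\<^sup>2 * h (ray x t) / psi (ray x t))
      \<le> \<bar>c\<bar> * B * C / ((cmod x)\<^sup>2 * cmod (psi x)) * exp (- \<mu> / 2 * t)"
proof -
  have B: "B \<ge> 0" using h norm_ge_zero order_trans by blast
  have "cmod (of_real c / (ray x t)\<^sup>2 * h (ray x t) / psi (ray x t)) =
      \<bar>c\<bar> * cmod (h (ray x t)) * (1 / (cmod (ray x t))\<^sup>2) * cmod (psi x / psi (ray x t)) / cmod (psi x)"
    by (simp add: norm_mult norm_divide norm_power)
  also have "\<dots> \<le> \<bar>c\<bar> * B * ((1 + 4 * t / r)\<^sup>2 / (cmod x)\<^sup>2) * cmod (psi x / psi (ray x t)) / cmod (psi x)"
    using h B inverse_ray_sq_le[OF x r t] by (intro divide_right_mono mult_right_mono mult_mono) auto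
  also have "\<dots> = \<bar>c\<bar> * B / ((cmod x)\<^sup>2 * cmod (psi x)) * (cmod (psi x / psi (ray x t)) * (1 + 4 * t / r)\<^sup>2)"
    by simp
  also have "\<dots> \<le> \<bar>c\<bar> * B / ((cmod x)\<^sup>2 * cmod (psi x)) * (C * exp (- \<mu> / 2 * t))"
    using B by (intro mult_left_mono C x t) auto
  finally show ?thesis by simp
qed

lemma exp_le_rational:
  obtains E where "E > 0" "\<And>t. t \<ge> 0 \<Longrightarrow> exp (- \<mu> / 2 * t) \<le> E / (1 + t\<^sup>2)"
proof -
  define E where "E = max 1 (1 * 2 / (\<mu> / 2)) powr 2"
  have "exp (- \<mu> / 2 * t) \<le> E / (1 + t\<^sup>2)" if t: "t \<ge> 0" for t
  proof -
    have "1 + t\<^sup>2 \<le> (1 + 1 * t) powr 2"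
      using t by (simp add: powr_numeral power2_eq_square algebra_simps)
    also have "\<dots> \<le> E * exp (\<mu> / 2 * t)"
      unfolding E_def by (rule powr_le_exp) (use mu_pos t in auto)
    finally have "(1 + t\<^sup>2) * exp (- \<mu> / 2 * t) \<le> E * (exp (\<mu> / 2 * t) * exp (- \<mu> / 2 * t))"
      by (metis mult.assoc mult_right_mono exp_ge_zero)
    also have "exp (\<mu> / 2 * t) * exp (- \<mu> / 2 * t) = 1"
      by (simp add: exp_add[symmetric])
    finally show ?thesis
      by (simp add: pos_le_divide_eq add_pos_nonneg mult.commute)
  qed
  moreover have "E > 0" by (simp add: E_def)
  ultimately show ?thesis using that by blast
qed

lemma DERIV_imp_holomorphic:
  assumes "\<And>x. x \<in> Om 0 \<Longrightarrow> (f has_field_derivative f' x) (at x)"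
  shows "f holomorphic_on Om 0"
  using assms open_Om field_differentiable_def holomorphic_on_def
  by (metis at_within_open)

text \<open>Variation of constants: \<open>g1\<close> is \<open>psi\<close> times the primitive of -
  c h / (x^2 \<open>psi\<close>) that vanishes at the end of the rays, and \<open>h1\<close> is the
  primitive of \<open>g1\<close> that vanishes there. \<open>C\<close> depends neither on h nor on
  \<Lambda>, so \<Lambda> may be chosen afterwards to beat it.\<close>

lemma step_exists:
  "\<exists>C. (\<forall>r>0. C r > 0) \<and> (\<forall>h. good h \<longrightarrow> (\<exists>g1 h1. is_step C h g1 h1))"
proof -
  have "\<exists>C>0. \<forall>x t. x \<in> Om r \<longrightarrow> t \<ge> 0 \<longrightarrow>
     cmod (psi x / psi (ray x t)) * (1 + 4 * t / r)\<^sup>2 \<le> C * exp (- \<mu> / 2 * t)" if "r > 0" for r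
    using psi_ratio_bound[OF that] by metis
  then obtain Cp where Cp: "\<And>r. r > 0 \<Longrightarrow> Cp r > 0"
    "\<And>r x t. r > 0 \<Longrightarrow> x \<in> Om r \<Longrightarrow> t \<ge> 0 \<Longrightarrow>
     cmod (psi x / psi (ray x t)) * (1 + 4 * t / r)\<^sup>2 \<le> Cp r * exp (- \<mu> / 2 * t)"
    by metis
  \<comment> \<open>The 4 / \<mu> is a factor 2 for the speed of the ray times 2 / \<mu> from
    integrating exp (- \<mu> t / 2).\<close>
  define C1 where "C1 r = 4 * \<bar>c\<bar> * Cp r / \<mu>" for r
  define W where "W r = 2 / r\<^sup>2 + 2" for r :: real
  define C where "C r = C1 r * (1 + W r) + 1" for r
  have C1: "C1 r \<ge> 0" if "r > 0" for r using Cp(1)[OF that] mu_pos by (simp add: C1_def)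
  have W: "W r \<ge> 0" for r by (simp add: W_def)
  have "\<exists>g1 h1. is_step C h g1 h1" if "good h" for h
  proof -
    have holh: "h holomorphic_on Om 0" and bh: "\<And>r. r > 0 \<Longrightarrow> \<exists>B. \<forall>x\<in>Om r. cmod (h x) \<le> B"
      using that by (auto simp: good_def)
    define F where "F x = - (of_real c / x\<^sup>2 * h x / psi x)" for x
    have holpsi: "psi holomorphic_on Om 0"
      using psi_deriv by (rule DERIV_imp_holomorphic)
    have holF: "F holomorphic_on Om 0"
      unfolding F_def by (intro holomorphic_intros holh holpsi) (use Om_0_not_0 in auto)
    have normF: "cmod (F (ray x t)) = cmod (of_real c / (ray x t)\<^sup>2 * h (ray x t) / psi (ray x t))" for x t
      unfolding F_def norm_minus_cancel ..
    obtain E where E: "E > 0" "\<And>t. t \<ge> 0 \<Longrightarrow> exp (- \<mu> / 2 * t) \<le> E / (1 + t\<^sup>2)"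
      using exp_le_rational by blast
    have contpsi: "continuous_on (Om r) psi" if "r > 0" for r
      using holomorphic_on_imp_continuous_on[OF holpsi] Om_antimono[of 0 r] that
      by (auto intro: continuous_on_subset)
    obtain G where G: "\<And>x. x \<in> Om 0 \<Longrightarrow> (G has_field_derivative F x) (at x)"
       "\<And>x. x \<in> Om 0 \<Longrightarrow> ((\<lambda>t. G (ray x t)) \<longlongrightarrow> 0) at_top"
    proof (rule tail_primitive[OF holF])
      fix r :: real assume r: "r > 0"
      obtain B where B: "\<And>x. x \<in> Om r \<Longrightarrow> cmod (h x) \<le> B" using bh[OF r] by blast
      define K where "K x = \<bar>c\<bar> * B * Cp r / ((cmod x)\<^sup>2 * cmod (psi x)) * E" for x
      have "continuous_on (Om r) K"
        unfolding K_def using r Om_0_not_0 by (intro continuous_intros contpsi) auto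
      moreover have "cmod (F (ray x t)) \<le> K x / (1 + t\<^sup>2)" if "x \<in> Om r" "t \<ge> 0" for x t
      proof -
        have B': "cmod (h (ray x t)) \<le> B" using B Om_ray that by blast
        then have "B \<ge> 0" using norm_ge_zero order_trans by blast
        have "cmod (F (ray x t)) \<le> \<bar>c\<bar> * B * Cp r / ((cmod x)\<^sup>2 * cmod (psi x)) * exp (- \<mu> / 2 * t)"
          unfolding normF by (rule kernel_bound[where h = h and t = t, OF Cp(2)[OF r] r that B'])
        also have "\<dots> \<le> \<bar>c\<bar> * B * Cp r / ((cmod x)\<^sup>2 * cmod (psi x)) * (E / (1 + t\<^sup>2))"
          using \<open>B \<ge> 0\<close> Cp(1)[OF r] by (intro mult_left_mono E that) auto
        finally show ?thesis by (simp add: K_def)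
      qed
      ultimately show "\<exists>K. continuous_on (Om r) K \<and> (\<forall>x\<in>Om r. \<forall>t\<ge>0. cmod (F (ray x t)) \<le> K x / (1 + t\<^sup>2))"
        by blast
    qed blast
    define g1 where "g1 x = psi x * G x" for x
    have g1: "(g1 has_field_derivative pp x * g1 x - of_real c / x\<^sup>2 * h x) (at x)" if "x \<in> Om 0" for x
      unfolding g1_def[abs_def]
      by (rule derivative_eq_intros psi_deriv G(1) that refl)+ (simp add: F_def algebra_simps)
    have g1b: "cmod (g1 x) \<le> C1 r * q * wt \<Lambda> x / (cmod x)\<^sup>2"
      if r: "r > 0" and q: "q \<ge> 0" and L: "\<Lambda> > 0" and hb: "\<And>x. x \<in> Om r \<Longrightarrow> cmod (h x) \<le> q * wt \<Lambda> x"
        and x: "x \<in> Om r" for r q \<Lambda> x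
    proof -
      have x0: "x \<in> Om 0" using x Om_antimono[of 0 r] r by auto
      define M where "M = 2 * (\<bar>c\<bar> * (q * wt \<Lambda> x) * Cp r / ((cmod x)\<^sup>2 * cmod (psi x)))"
      have "cmod (G x - 0) \<le> 0 - (- (2 / \<mu>) * M * exp (- \<mu> / 2 * 0))"
      proof (rule tail_bound[OF G(1) x0 G(2)[OF x0]])
        show "((\<lambda>t. - (2 / \<mu>) * M * exp (- \<mu> / 2 * t)) has_real_derivative M * exp (- \<mu> / 2 * u)) (at u)" for u
          using mu_pos by (auto intro!: derivative_eq_intros simp: field_simps)
        have "((\<lambda>t. exp (- \<mu> / 2 * t)) \<longlongrightarrow> 0) at_top"
          using mu_pos by real_asymp
        from tendsto_mult_right_zero[OF this, of "- (2 / \<mu>) * M"]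
        show "((\<lambda>t. - (2 / \<mu>) * M * exp (- \<mu> / 2 * t)) \<longlongrightarrow> 0) at_top" .
        fix u :: real assume u: "u \<ge> 0"
        have "cmod (h (ray x u)) \<le> q * wt \<Lambda> (ray x u)" using hb Om_ray x u by blast
        also have "\<dots> \<le> q * wt \<Lambda> x" using wt_ray_le[OF u] L q by (intro mult_left_mono) auto
        finally have "cmod (h (ray x u)) \<le> q * wt \<Lambda> x" .
        from kernel_bound[where h = h and t = u, OF Cp(2)[OF r] r x u this]
        show "2 * cmod (F (ray x u)) \<le> M * exp (- \<mu> / 2 * u)" unfolding normF M_def by simp
      qed
      then have "cmod (psi x) * cmod (G x) \<le> cmod (psi x) * (2 / \<mu> * M)"
        by (intro mult_left_mono) auto
      also have "\<dots> = C1 r * q * wt \<Lambda> x / (cmod x)\<^sup>2"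
        by (simp add: M_def C1_def)
      finally show ?thesis by (simp add: g1_def norm_mult)
    qed
    have dom: "1 / (cmod (ray x u))\<^sup>2 \<le> W r / (1 + (Re x - Im x + 2 * u)\<^sup>2)"
      if "x \<in> Om r" "u \<ge> 0" "r > 0" for x u r
    proof -
      have "ray x u \<in> Om r" using that Om_ray by blast
      from Om_norm_weight[OF this that(3)] Om_0_not_0[OF this] that(3)
      have "1 + (Re x - Im x + 2 * u)\<^sup>2 \<le> W r * (cmod (ray x u))\<^sup>2" "ray x u \<noteq> 0"
        by (auto simp: W_def algebra_simps)
      then show ?thesis by (simp add: field_simps add_pos_nonneg)
    qed
    obtain h1 where h1: "\<And>x. x \<in> Om 0 \<Longrightarrow> (h1 has_field_derivative g1 x) (at x)"
       "\<And>x. x \<in> Om 0 \<Longrightarrow> ((\<lambda>t. h1 (ray x t)) \<longlongrightarrow> 0) at_top"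
    proof (rule tail_primitive[OF DERIV_imp_holomorphic[OF g1]])
      fix r :: real assume r: "r > 0"
      obtain B where B: "\<And>x. x \<in> Om r \<Longrightarrow> cmod (h x) \<le> B" using bh[OF r] by blast
      \<comment> \<open>Plain boundedness of \<open>h\<close> is restated as a weighted bound with
        \<Lambda> = 1; the factor compensates the lower bound exp (- pi / 2) of
        \<open>wt 1\<close>.\<close>
      define q where "q = max B 0 * exp (1 * (pi / 2))"
      have q: "q \<ge> 0" by (simp add: q_def)
      have hq: "cmod (h x) \<le> q * wt 1 x" if "x \<in> Om r" for x
      proof -
        have "cmod (h x) \<le> max B 0 * 1" using B[OF that] by simp
        also have "\<dots> \<le> max B 0 * (exp (1 * (pi / 2)) * wt 1 x)"
        proof (intro mult_left_mono)
          have "1 = exp (1 * (pi / 2)) * exp (- 1 * (pi / 2))" by (simp add: exp_add[symmetric])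
          also have "\<dots> \<le> exp (1 * (pi / 2)) * wt 1 x" using wt_bounds(2)[of 1 x] by (intro mult_left_mono) auto
          finally show "1 \<le> exp (1 * (pi / 2)) * wt 1 x" .
        qed simp
        finally show ?thesis by (simp add: q_def)
      qed
      define M where "M = C1 r * q * exp (1 * (pi / 2)) * W r"
      have M: "M \<ge> 0" using C1[OF r] q W by (simp add: M_def)
      define K where "K x = M * (2 * (1 + (Re x - Im x)\<^sup>2))" for x
      have "continuous_on (Om r) K"
        unfolding K_def by (intro continuous_intros)
      moreover have "cmod (g1 (ray x t)) \<le> K x / (1 + t\<^sup>2)" if "x \<in> Om r" "t \<ge> 0" for x t
      proof -
        have "cmod (g1 (ray x t)) \<le> C1 r * q * wt 1 (ray x t) * (1 / (cmod (ray x t))\<^sup>2)"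
          using g1b[OF r q _ hq, of "ray x t"] Om_ray that by auto
        also have "\<dots> \<le> C1 r * q * exp (1 * (pi / 2)) * (W r / (1 + (Re x - Im x + 2 * t)\<^sup>2))"
          using dom[OF that r] wt_bounds(1)[of 1 "ray x t"] C1[OF r] q
          by (intro mult_mono mult_left_mono) auto
        also have "\<dots> = M * (1 / (1 + (Re x - Im x + 2 * t)\<^sup>2))" by (simp add: M_def)
        also have "\<dots> \<le> M * (2 * (1 + (Re x - Im x)\<^sup>2) / (1 + t\<^sup>2))"
        proof (intro mult_left_mono M)
          have "t\<^sup>2 \<le> (2 * t)\<^sup>2" by simp
          then have "1 + t\<^sup>2 \<le> 2 * (1 + (Re x - Im x)\<^sup>2) * (1 + (Re x - Im x + 2 * t)\<^sup>2)"
            using one_plus_sq_shift[of "2 * t" "Re x - Im x"] by linarith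
          then show "1 / (1 + (Re x - Im x + 2 * t)\<^sup>2) \<le> 2 * (1 + (Re x - Im x)\<^sup>2) / (1 + t\<^sup>2)"
            by (simp add: divide_simps add_pos_nonneg)
        qed
        finally show ?thesis by (simp add: K_def)
      qed
      ultimately show "\<exists>K. continuous_on (Om r) K \<and> (\<forall>x\<in>Om r. \<forall>t\<ge>0. cmod (g1 (ray x t)) \<le> K x / (1 + t\<^sup>2))"
        by blast
    next
      fix \<Phi>
      assume "\<And>x. x \<in> Om 0 \<Longrightarrow> (\<Phi> has_field_derivative g1 x) (at x)"
        "\<And>x. x \<in> Om 0 \<Longrightarrow> ((\<lambda>t. \<Phi> (ray x t)) \<longlongrightarrow> 0) at_top"
      then show thesis by (rule that)
    qed
    have h1b: "cmod (h1 x) \<le> C1 r * W r * q / \<Lambda> * (wt \<Lambda> x - exp (- \<Lambda> * (pi / 2)))"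
      if r: "r > 0" and q: "q \<ge> 0" and L: "\<Lambda> > 0" and hb: "\<And>x. x \<in> Om r \<Longrightarrow> cmod (h x) \<le> q * wt \<Lambda> x"
        and x: "x \<in> Om r" for r q \<Lambda> x
    proof -
      have x0: "x \<in> Om 0" using x Om_antimono[of 0 r] r by auto
      define M where "M = C1 r * W r * q / \<Lambda>"
      define a where "a = Re x - Im x"
      \<comment> \<open>The majorant of \<open>g1\<close> has an explicit primitive, a multiple of
        the weight itself. Its value at the end of the ray is the constant subtracted in
        \<open>is_step\<close>.\<close>
      have "cmod (h1 x - 0) \<le> - M * exp (- \<Lambda> * (pi / 2)) - (- M * exp (- \<Lambda> * arctan (a + 2 * 0)))"
      proof (rule tail_bound[OF h1(1) x0 h1(2)[OF x0]])
        show "((\<lambda>t. - M * exp (- \<Lambda> * arctan (a + 2 * t))) has_real_derivative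
            2 * \<Lambda> * M * exp (- \<Lambda> * arctan (a + 2 * u)) / (1 + (a + 2 * u)\<^sup>2)) (at u)" for u
          by (auto intro!: derivative_eq_intros simp: field_simps)
        have "((\<lambda>t. arctan (a + 2 * t)) \<longlongrightarrow> pi / 2) at_top"
          by (rule filterlim_compose[OF tendsto_arctan_at_top]) real_asymp
        then show "((\<lambda>t. - M * exp (- \<Lambda> * arctan (a + 2 * t))) \<longlongrightarrow> - M * exp (- \<Lambda> * (pi / 2))) at_top"
          by (intro tendsto_intros)
        fix u :: real assume u: "u \<ge> 0"
        have "cmod (g1 (ray x u)) \<le> C1 r * q * wt \<Lambda> (ray x u) * (1 / (cmod (ray x u))\<^sup>2)"
          using g1b[OF r q L hb, of "ray x u"] Om_ray[OF x u] by simp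
        also have "\<dots> \<le> C1 r * q * wt \<Lambda> (ray x u) * (W r / (1 + (a + 2 * u)\<^sup>2))"
          using dom[OF x u r] C1[OF r] q by (intro mult_left_mono) (auto simp: a_def)
        also have "\<dots> = \<Lambda> * M * exp (- \<Lambda> * arctan (a + 2 * u)) / (1 + (a + 2 * u)\<^sup>2)"
          using L by (simp add: M_def wt_def a_def algebra_simps)
        finally show "2 * cmod (g1 (ray x u)) \<le> 2 * \<Lambda> * M * exp (- \<Lambda> * arctan (a + 2 * u)) / (1 + (a + 2 * u)\<^sup>2)"
          by simp
      qed
      then show ?thesis by (simp add: M_def wt_def a_def algebra_simps)
    qed
    have "is_step C h g1 h1"
      unfolding is_step_def
    proof (intro conjI allI ballI impI)
      fix r q \<Lambda> :: real and x assume r: "r > 0" and q: "q \<ge> 0" and L: "\<Lambda> > 0"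
        and hb: "\<forall>x\<in>Om r. cmod (h x) \<le> q * wt \<Lambda> x" and x: "x \<in> Om r"
      have hb': "\<And>x. x \<in> Om r \<Longrightarrow> cmod (h x) \<le> q * wt \<Lambda> x" using hb by blast
      have le: "C1 r \<le> C r" "C1 r * W r \<le> C r"
        using C1[OF r] W[of r] by (auto simp: C_def algebra_simps)
      have "C1 r * q * wt \<Lambda> x / (cmod x)\<^sup>2 \<le> C r * q * wt \<Lambda> x / (cmod x)\<^sup>2"
        using le q by (intro divide_right_mono mult_right_mono) auto
      then show "cmod (g1 x) \<le> C r * q * wt \<Lambda> x / (cmod x)\<^sup>2"
        using g1b[OF r q L hb' x] by linarith
      have "C1 r * W r * q / \<Lambda> * (wt \<Lambda> x - exp (- \<Lambda> * (pi / 2))) \<le> C r * q / \<Lambda> * (wt \<Lambda> x - exp (- \<Lambda> * (pi / 2)))"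
        using le q L wt_bounds(2)[of \<Lambda> x] by (intro divide_right_mono mult_right_mono) auto
      then show "cmod (h1 x) \<le> C r * q / \<Lambda> * (wt \<Lambda> x - exp (- \<Lambda> * (pi / 2)))"
        using h1b[OF r q L hb' x] by linarith
    qed (use g1 h1(1) in auto)
    then show ?thesis by blast
  qed
  moreover have "C r > 0" if "r > 0" for r
    using C1[OF that] W[of r] by (simp add: C_def add_nonneg_pos)
  ultimately show ?thesis by blast
qed


text \<open>The Neumann series started from (g, h) = (0, 1). With \<Lambda> = 2 C each step halves
  the weighted bound on \<open>Om r\<close>, and the bounds for all r concern the same
  iterates.\<close>

theorem solution_at_infinity:
  obtains h g where
    "\<And>x. x \<in> Om 0 \<Longrightarrow> (h has_field_derivative g x) (at x)"
    "\<And>x. x \<in> Om 0 \<Longrightarrow> (g has_field_derivative pp x * g x - of_real c / x\<^sup>2 * h x) (at x)"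
    "\<And>r. r > 0 \<Longrightarrow> \<exists>B. \<forall>x\<in>Om r. cmod (g x) \<le> B / (cmod x)\<^sup>2"
    "\<And>x. x \<in> Om 0 \<Longrightarrow> ((\<lambda>t. h (ray x t)) \<longlongrightarrow> 1) at_top"
proof -
  obtain C where C: "\<And>r. r > 0 \<Longrightarrow> C r > 0" "\<And>h. good h \<Longrightarrow> \<exists>g1 h1. is_step C h g1 h1"
    using step_exists by blast
  \<comment> \<open>The choice by \<open>SOME\<close> does not involve r: the estimates in
    \<open>is_step\<close> hold on every \<open>Om r\<close> simultaneously.\<close>
  define S :: "nat \<Rightarrow> (complex \<Rightarrow> complex) \<times> (complex \<Rightarrow> complex)" where
    "S = rec_nat (\<lambda>x. 0, \<lambda>x. 1) (\<lambda>_ p. SOME p'. is_step C (snd p) (fst p') (snd p'))"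
  define gs where "gs n = fst (S n)" for n
  define hs where "hs n = snd (S n)" for n
  have init: "gs 0 = (\<lambda>x. 0)" "hs 0 = (\<lambda>x. 1)" by (simp_all add: gs_def hs_def S_def)
  have step': "is_step C (hs n) (gs (Suc n)) (hs (Suc n))" if "good (hs n)" for n
  proof -
    have "\<exists>p'. is_step C (hs n) (fst p') (snd p')" using C(2)[OF that] by auto
    from someI_ex[OF this] show ?thesis by (simp add: gs_def hs_def S_def)
  qed
  define \<Lambda> where "\<Lambda> r = 2 * C r" for r
  have \<Lambda>: "\<Lambda> r > 0" if "r > 0" for r using C(1)[OF that] by (simp add: \<Lambda>_def)
  \<comment> \<open>\<open>Q r\<close> bounds both the weight and its reciprocal, which is why it
    appears squared in the unweighted estimates below.\<close>
  define Q where "Q r = exp (\<Lambda> r * (pi / 2))" for r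
  have Q: "Q r > 0" for r by (simp add: Q_def)
  have good_bound: "good (hs n) \<and> (\<forall>r>0. \<forall>x\<in>Om r. cmod (hs n x) \<le> Q r * (1 / 2) ^ n * wt (\<Lambda> r) x)" for n
  proof (induction n)
    case 0
    have "1 \<le> Q r * wt (\<Lambda> r) x" if "r > 0" for r x
    proof -
      have "1 = Q r * exp (- \<Lambda> r * (pi / 2))" by (simp add: Q_def exp_add[symmetric])
      also have "\<dots> \<le> Q r * wt (\<Lambda> r) x"
        using wt_bounds(2)[of "\<Lambda> r" x] \<Lambda>[OF that] Q[of r] by (intro mult_left_mono) auto
      finally show ?thesis .
    qed
    then show ?case by (auto simp: good_def init)
  next
    case (Suc n)
    then have st: "is_step C (hs n) (gs (Suc n)) (hs (Suc n))" using step' by blast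
    have bd: "cmod (hs (Suc n) x) \<le> Q r * (1 / 2) ^ Suc n * wt (\<Lambda> r) x" if r: "r > 0" and x: "x \<in> Om r" for r x
    proof -
      have "Q r * (1 / 2) ^ n \<ge> 0" using Q[of r] by simp
      then have "cmod (hs (Suc n) x) \<le> C r * (Q r * (1 / 2) ^ n) / \<Lambda> r * (wt (\<Lambda> r) x - exp (- \<Lambda> r * (pi / 2)))"
        using st Suc.IH r \<Lambda>[OF r] x unfolding is_step_def by blast
      also have "C r * (Q r * (1 / 2) ^ n) / \<Lambda> r = Q r * (1 / 2) ^ Suc n"
        using C(1)[OF r] by (simp add: \<Lambda>_def)
      also have "Q r * (1 / 2) ^ Suc n * (wt (\<Lambda> r) x - exp (- \<Lambda> r * (pi / 2))) \<le> Q r * (1 / 2) ^ Suc n * wt (\<Lambda> r) x"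
        using Q[of r] by (intro mult_left_mono) auto
      finally show ?thesis .
    qed
    have "hs (Suc n) holomorphic_on Om 0"
      by (rule DERIV_imp_holomorphic) (use st in \<open>auto simp: is_step_def\<close>)
    moreover have "\<exists>B. \<forall>x\<in>Om r. cmod (hs (Suc n) x) \<le> B" if r: "r > 0" for r
    proof (intro exI ballI)
      fix x assume "x \<in> Om r"
      then have "cmod (hs (Suc n) x) \<le> Q r * (1 / 2) ^ Suc n * wt (\<Lambda> r) x" using bd r by blast
      also have "\<dots> \<le> Q r * (1 / 2) ^ Suc n * exp (\<Lambda> r * (pi / 2))"
        using Q[of r] wt_bounds(1)[of "\<Lambda> r" x] \<Lambda>[OF r] by (intro mult_left_mono) auto
      finally show "cmod (hs (Suc n) x) \<le> Q r * (1 / 2) ^ Suc n * exp (\<Lambda> r * (pi / 2))" .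
    qed
    ultimately show ?case using bd by (auto simp: good_def)
  qed
  have step: "is_step C (hs n) (gs (Suc n)) (hs (Suc n))" for n using step' good_bound by blast
  have qn: "Q r * (1 / 2) ^ n \<ge> 0" for r n using Q[of r] by simp
  have hs_bound: "cmod (hs (Suc n) x) \<le> Q r / 2 * (1 / 2) ^ n * (wt (\<Lambda> r) x - exp (- \<Lambda> r * (pi / 2)))"
    and gs_bound: "cmod (gs (Suc n) x) \<le> C r * Q r * Q r / (cmod x)\<^sup>2 * (1 / 2) ^ n"
    if r: "r > 0" and x: "x \<in> Om r" for n r x
  proof -
    have *: "cmod (gs (Suc n) x) \<le> C r * (Q r * (1 / 2) ^ n) * wt (\<Lambda> r) x / (cmod x)\<^sup>2 \<and>
        cmod (hs (Suc n) x) \<le> C r * (Q r * (1 / 2) ^ n) / \<Lambda> r * (wt (\<Lambda> r) x - exp (- \<Lambda> r * (pi / 2)))"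
      using step[of n] good_bound[of n] r \<Lambda>[OF r] x qn unfolding is_step_def by blast
    have eq: "C r * (Q r * (1 / 2) ^ n) / \<Lambda> r = Q r / 2 * (1 / 2) ^ n"
      using C(1)[OF r] by (simp add: \<Lambda>_def)
    then show "cmod (hs (Suc n) x) \<le> Q r / 2 * (1 / 2) ^ n * (wt (\<Lambda> r) x - exp (- \<Lambda> r * (pi / 2)))"
      using *[unfolded eq] by blast
    have "C r * (Q r * (1 / 2) ^ n) * wt (\<Lambda> r) x / (cmod x)\<^sup>2 \<le> C r * (Q r * (1 / 2) ^ n) * Q r / (cmod x)\<^sup>2"
      using wt_bounds(1)[of "\<Lambda> r" x] \<Lambda>[OF r] C(1)[OF r] qn
      by (intro divide_right_mono mult_left_mono) (auto simp: Q_def)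
    then show "cmod (gs (Suc n) x) \<le> C r * Q r * Q r / (cmod x)\<^sup>2 * (1 / 2) ^ n"
      using * by (simp add: mult_ac)
  qed
  have geo: "summable (\<lambda>n. (1 / 2 :: real) ^ n)" by (rule summable_geometric) simp
  have sum_hs: "summable (\<lambda>n. hs n x)" and sum_gs: "summable (\<lambda>n. gs n x)" if x: "x \<in> Om 0" for x
  proof -
    obtain r where r: "r > 0" "x \<in> Om r" using Om_0_E[OF x] by blast
    have "summable (\<lambda>n. hs (Suc n) x)"
    proof (rule summable_comparison_test'[OF summable_mult[OF geo]])
      show "cmod (hs (Suc n) x) \<le> Q r / 2 * (wt (\<Lambda> r) x - exp (- \<Lambda> r * (pi / 2))) * (1 / 2) ^ n" for n
        using hs_bound[OF r, of n] by (simp only: mult_ac)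
    qed
    then show "summable (\<lambda>n. hs n x)" by (rule iffD1[OF summable_Suc_iff])
    have "summable (\<lambda>n. gs (Suc n) x)"
      by (rule summable_comparison_test'[OF summable_mult[OF geo]]) (rule gs_bound[OF r])
    then show "summable (\<lambda>n. gs n x)" by (rule iffD1[OF summable_Suc_iff])
  qed
  define h where "h x = (\<Sum>n. hs n x)" for x
  define g where "g x = (\<Sum>n. gs n x)" for x
  \<comment> \<open>The inhomogeneity of the iterate \<open>Suc m\<close> is \<open>hs m\<close>,
    and the zeroth one has none. After summation this shift yields the full series
    \<open>h\<close>.\<close>
  have gs_deriv: "(gs n has_field_derivative pp x * gs n x - (case n of 0 \<Rightarrow> 0 | Suc m \<Rightarrow> of_real c / x\<^sup>2 * hs m x)) (at x)"
    and hs_deriv: "(hs n has_field_derivative gs n x) (at x)" if "x \<in> Om 0" for n x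
    using step[of "n - 1"] that by (cases n; simp add: init is_step_def)+
  have unif: "uniformly_convergent_on (ball x \<delta>) (\<lambda>n y. \<Sum>i<n. gs i y)"
             "uniformly_convergent_on (ball x \<delta>) (\<lambda>n y. \<Sum>i<n. pp y * gs i y - (case i of 0 \<Rightarrow> 0 | Suc m \<Rightarrow> of_real c / y\<^sup>2 * hs m y))"
    if r: "r > 0" and sub: "ball x \<delta> \<subseteq> Om r" for x \<delta> r
  proof -
    define A where "A = C r * Q r * Q r * (4 / r\<^sup>2)"
    have A: "A \<ge> 0" using C(1)[OF r] Q[of r] by (simp add: A_def)
    have inv: "1 / (cmod y)\<^sup>2 \<le> 4 / r\<^sup>2" if "y \<in> Om r" for y
    proof -
      have "y \<noteq> 0" using Om_0_not_0[OF that] r by simp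
      moreover have "r\<^sup>2 \<le> (2 * cmod y)\<^sup>2" using Om_norm_ge_half[OF that] r by (intro power_mono) auto
      ultimately show ?thesis using r by (simp add: field_simps power_mult_distrib)
    qed
    have gsb: "cmod (gs n y) \<le> A * (2 * (1 / 2) ^ n)" if "y \<in> ball x \<delta>" for n y
    proof (cases n)
      case (Suc m)
      have y: "y \<in> Om r" using that sub by blast
      have "cmod (gs n y) \<le> C r * Q r * Q r * (1 / (cmod y)\<^sup>2) * (1 / 2) ^ m"
        using gs_bound[OF r y, of m] by (simp add: Suc)
      also have "\<dots> \<le> A * (1 / 2) ^ m"
        unfolding A_def using inv[OF y] C(1)[OF r] Q[of r] by (intro mult_right_mono mult_left_mono) auto
      finally show ?thesis by (simp add: Suc)
    qed (use A in \<open>simp add: init\<close>)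
    show "uniformly_convergent_on (ball x \<delta>) (\<lambda>n y. \<Sum>i<n. gs i y)"
      by (rule Weierstrass_m_test'[OF gsb], assumption) (intro summable_mult geo)
    have hsb: "cmod (hs n y) \<le> Q r * Q r * (1 / 2) ^ n" if "y \<in> ball x \<delta>" for n y
    proof -
      have y: "y \<in> Om r" using that sub by blast
      have "cmod (hs n y) \<le> Q r * (1 / 2) ^ n * wt (\<Lambda> r) y" using good_bound r y by blast
      also have "\<dots> \<le> Q r * (1 / 2) ^ n * Q r"
        using wt_bounds(1)[of "\<Lambda> r" y] \<Lambda>[OF r] Q[of r] by (intro mult_left_mono) (auto simp: Q_def)
      finally show ?thesis by (simp add: mult_ac)
    qed
    define P where "P = \<mu> + \<mu> * (4 / r\<^sup>2) + \<bar>k\<bar> * (2 / r)"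
    have ppb: "cmod (pp y) \<le> P" if "y \<in> Om r" for y
    proof -
      have y0: "y \<noteq> 0" using Om_0_not_0[OF that] r by simp
      have "cmod (pp y) \<le> cmod (of_real \<mu>) + cmod (of_real \<mu> / y\<^sup>2) + cmod (of_real k / y)"
        unfolding pp_def by (intro norm_triangle_le norm_triangle_mono order.refl)
      also have "\<dots> = \<mu> + \<mu> * (1 / (cmod y)\<^sup>2) + \<bar>k\<bar> * (1 / cmod y)"
        using mu_pos by (simp add: norm_divide norm_power)
      also have "\<dots> \<le> P"
        unfolding P_def using inv[OF that] Om_norm_ge_half[OF that] r mu_pos y0
        by (intro add_mono mult_left_mono) (auto simp: field_simps)
      finally show ?thesis .
    qed
    have P: "P \<ge> 0" using mu_pos r by (simp add: P_def)
    have gb: "cmod (pp y * gs n y - (case n of 0 \<Rightarrow> 0 | Suc m \<Rightarrow> of_real c / y\<^sup>2 * hs m y))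
        \<le> (P * A * 2 + \<bar>c\<bar> * (4 / r\<^sup>2) * (Q r * Q r) * 2) * (1 / 2) ^ n" if yb: "y \<in> ball x \<delta>" for n y
    proof -
      have y: "y \<in> Om r" using yb sub by blast
      have "cmod (pp y * gs n y) \<le> P * (A * (2 * (1 / 2) ^ n))"
        unfolding norm_mult by (intro mult_mono ppb y gsb yb P) auto
      moreover have "cmod (case n of 0 \<Rightarrow> 0 | Suc m \<Rightarrow> of_real c / y\<^sup>2 * hs m y)
          \<le> \<bar>c\<bar> * (4 / r\<^sup>2) * (Q r * Q r) * 2 * (1 / 2) ^ n"
      proof (cases n)
        case (Suc m)
        have "cmod (of_real c / y\<^sup>2 * hs m y) = \<bar>c\<bar> * (1 / (cmod y)\<^sup>2) * cmod (hs m y)"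
          by (simp add: norm_mult norm_divide norm_power)
        also have "\<dots> \<le> \<bar>c\<bar> * (4 / r\<^sup>2) * (Q r * Q r * (1 / 2) ^ m)"
          by (intro mult_mono hsb yb inv y mult_left_mono) auto
        also have "\<dots> = \<bar>c\<bar> * (4 / r\<^sup>2) * (Q r * Q r) * 2 * (1 / 2) ^ n" by (simp add: Suc)
        finally show ?thesis by (simp only: Suc nat.case)
      qed (use Q[of r] in simp)
      ultimately show ?thesis
        using norm_triangle_ineq4[of "pp y * gs n y" "case n of 0 \<Rightarrow> 0 | Suc m \<Rightarrow> of_real c / y\<^sup>2 * hs m y"]
        by (simp add: algebra_simps)
    qed
    show "uniformly_convergent_on (ball x \<delta>) (\<lambda>n y. \<Sum>i<n. pp y * gs i y - (case i of 0 \<Rightarrow> 0 | Suc m \<Rightarrow> of_real c / y\<^sup>2 * hs m y))"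
      by (rule Weierstrass_m_test'[OF gb], assumption) (intro summable_mult geo)
  qed
  have ball: "\<exists>\<delta>>0. \<exists>r>0. ball x \<delta> \<subseteq> Om r" if "x \<in> Om 0" for x
    using Om_0_E[OF that] open_Om open_contains_ball by metis
  show ?thesis
  proof
    fix x assume x: "x \<in> Om 0"
    obtain \<delta> r where \<delta>: "\<delta> > 0" "r > 0" "ball x \<delta> \<subseteq> Om r" using ball[OF x] by blast
    have sub: "y \<in> Om 0" if "dist x y < \<delta>" for y
      using that \<delta> Om_antimono[of 0 r] by auto
    show "(h has_field_derivative g x) (at x)"
      unfolding h_def[abs_def] g_def
      by (rule has_field_derivative_series'(2)[OF convex_ball _ unif(1)[OF \<delta>(2,3)], of hs x])
        (use \<delta> x in \<open>auto intro!: has_field_derivative_at_within[OF hs_deriv] sub sum_hs\<close>)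
    have "((\<lambda>y. \<Sum>n. gs n y) has_field_derivative (\<Sum>n. pp x * gs n x - (case n of 0 \<Rightarrow> 0 | Suc m \<Rightarrow> of_real c / x\<^sup>2 * hs m x))) (at x)"
      by (rule has_field_derivative_series'(2)[OF convex_ball _ unif(2)[OF \<delta>(2,3)], of gs x])
        (use \<delta> x in \<open>auto intro!: has_field_derivative_at_within[OF gs_deriv] sub sum_gs\<close>)
    moreover have "(\<Sum>n. pp x * gs n x - (case n of 0 \<Rightarrow> 0 | Suc m \<Rightarrow> of_real c / x\<^sup>2 * hs m x)) =
        pp x * g x - of_real c / x\<^sup>2 * h x"
    proof -
      have "(\<lambda>n. case n of 0 \<Rightarrow> 0 | Suc m \<Rightarrow> of_real c / x\<^sup>2 * hs m x) sums (of_real c / x\<^sup>2 * h x + 0)"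
      proof -
        have "(\<lambda>n. of_real c / x\<^sup>2 * hs n x) sums (of_real c / x\<^sup>2 * h x)"
          unfolding h_def by (intro sums_mult summable_sums sum_hs[OF x])
        then show ?thesis
          using sums_Suc[of "\<lambda>n. case n of 0 \<Rightarrow> 0 | Suc m \<Rightarrow> of_real c / x\<^sup>2 * hs m x"] by simp
      qed
      then have "(\<lambda>n. pp x * gs n x - (case n of 0 \<Rightarrow> 0 | Suc m \<Rightarrow> of_real c / x\<^sup>2 * hs m x)) sums
          (pp x * g x - (of_real c / x\<^sup>2 * h x + 0))"
        by (intro sums_diff sums_mult) (simp_all add: g_def summable_sums sum_gs[OF x])
      then show ?thesis by (simp add: sums_iff)
    qed
    ultimately show "(g has_field_derivative pp x * g x - of_real c / x\<^sup>2 * h x) (at x)"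
      by (simp add: g_def[abs_def])
  next
    fix r :: real assume r: "r > 0"
    show "\<exists>B. \<forall>x\<in>Om r. cmod (g x) \<le> B / (cmod x)\<^sup>2"
    proof (intro exI ballI)
      fix x assume x: "x \<in> Om r"
      then have "x \<in> Om 0" using Om_antimono[of 0 r] r by auto
      then have "g x = (\<Sum>n. gs (Suc n) x)"
        unfolding g_def by (subst suminf_split_head[OF sum_gs]) (simp_all add: init)
      also have "cmod \<dots> \<le> (\<Sum>n. C r * Q r * Q r / (cmod x)\<^sup>2 * (1 / 2) ^ n)"
        by (rule norm_suminf_le[OF gs_bound[OF r x] summable_mult[OF geo]])
      also have "\<dots> = C r * Q r * Q r * 2 / (cmod x)\<^sup>2"
        by (subst suminf_mult[OF geo]) (simp add: suminf_geometric)
      finally show "cmod (g x) \<le> C r * Q r * Q r * 2 / (cmod x)\<^sup>2" .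
    qed
  next
    fix x assume x: "x \<in> Om 0"
    obtain r where r: "r > 0" "x \<in> Om r" using Om_0_E[OF x] by blast
    \<comment> \<open>Keeping the subtracted constant in the bound for \<open>h - 1\<close> is what
      makes it vanish at the end of the ray.\<close>
    have est: "cmod (h (ray x t) - 1) \<le> Q r * (wt (\<Lambda> r) (ray x t) - exp (- \<Lambda> r * (pi / 2)))" if t: "t \<ge> 0" for t
    proof -
      have y: "ray x t \<in> Om r" "ray x t \<in> Om 0" using r x t Om_ray by blast+
      have "h (ray x t) - 1 = (\<Sum>n. hs (Suc n) (ray x t))"
        unfolding h_def by (subst suminf_split_head[OF sum_hs[OF y(2)]]) (simp_all add: init)
      also have "cmod \<dots> \<le> (\<Sum>n. (Q r / 2 * (wt (\<Lambda> r) (ray x t) - exp (- \<Lambda> r * (pi / 2)))) * (1 / 2) ^ n)"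
        by (rule norm_suminf_le[OF _ summable_mult[OF geo]])
          (use hs_bound[OF r(1) y(1)] in \<open>simp add: mult_ac\<close>)
      also have "\<dots> = Q r * (wt (\<Lambda> r) (ray x t) - exp (- \<Lambda> r * (pi / 2)))"
        by (subst suminf_mult[OF geo]) (simp add: suminf_geometric)
      finally show ?thesis .
    qed
    have "((\<lambda>t. arctan (Re x - Im x + 2 * t)) \<longlongrightarrow> pi / 2) at_top"
      by (rule filterlim_compose[OF tendsto_arctan_at_top]) real_asymp
    then have "((\<lambda>t. Q r * (wt (\<Lambda> r) (ray x t) - exp (- \<Lambda> r * (pi / 2)))) \<longlongrightarrow>
        Q r * (exp (- \<Lambda> r * (pi / 2)) - exp (- \<Lambda> r * (pi / 2)))) at_top"
      unfolding wt_def by (intro tendsto_intros) (simp add: algebra_simps)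
    then have "((\<lambda>t. Q r * (wt (\<Lambda> r) (ray x t) - exp (- \<Lambda> r * (pi / 2)))) \<longlongrightarrow> 0) at_top"
      by simp
    then have "((\<lambda>t. h (ray x t) - 1) \<longlongrightarrow> 0) at_top"
      by (rule Lim_null_comparison[OF eventually_mono[OF eventually_ge_at_top[of 0]], rotated]) (rule est)
    then show "((\<lambda>t. h (ray x t)) \<longlongrightarrow> 1) at_top" by (rule iffD2[OF Lim_null])
  qed
qed

end

section \<open>Smooth solutions on sectors\<close>

text \<open>A narrower cone than \<open>Om 0\<close>. On it the modulus along a ray is comparable
  with \<open>cmod x + t\<close>, which gives estimates uniform in x near infinity.\<close>

definition Gx :: "complex set" where
  "Gx = {x. x \<noteq> 0 \<and> 3 * Im x \<le> \<bar>Re x\<bar>}"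

lemma Gx_ray: 
  assumes "x \<in> Gx" "t \<ge> 0"
  shows "ray x t \<in> Gx" "cmod x + t \<le> 7 * cmod (ray x t)"
proof -
  define a b where "a = Re x" and "b = Im x"
  have ab: "3 * b \<le> \<bar>a\<bar>" "a \<noteq> 0 \<or> b \<noteq> 0"
    using assms(1) by (auto simp: Gx_def a_def b_def complex_eq_iff)
  have nx: "(cmod x)\<^sup>2 = a\<^sup>2 + b\<^sup>2" by (simp add: a_def b_def cmod_power2)
  have ny: "(cmod (ray x t))\<^sup>2 = (a + t)\<^sup>2 + (b - t)\<^sup>2" by (simp add: a_def b_def cmod_power2)
  have "(cmod x)\<^sup>2 \<le> (3 * cmod (ray x t))\<^sup>2"
  proof (cases "b \<le> a")
    case True
    have "(a + t)\<^sup>2 + (b - t)\<^sup>2 = a\<^sup>2 + b\<^sup>2 + 2 * t * (a - b) + 2 * t\<^sup>2"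
      by (simp add: power2_eq_square algebra_simps)
    then have le: "a\<^sup>2 + b\<^sup>2 \<le> (a + t)\<^sup>2 + (b - t)\<^sup>2" using True assms(2) by simp
    have "p \<le> 9 * q" if "p \<le> q" "0 \<le> p" for p q :: real using that by linarith
    from this[OF le] have "a\<^sup>2 + b\<^sup>2 \<le> 9 * ((a + t)\<^sup>2 + (b - t)\<^sup>2)" by simp
    then show ?thesis by (simp add: power_mult_distrib nx ny)
  next
    case False
    then have a: "a < 0" "b \<le> - a / 3" using ab(1) by auto
    \<comment> \<open>In this case the ray first approaches the origin. Its distance is controlled
      by a + b, which is constant along the ray and at least 2 |a| / 3 in modulus inside the
      cone.\<close>
    have 1: "(a + t)\<^sup>2 + (b - t)\<^sup>2 = ((a + b)\<^sup>2 + (a - b + 2 * t)\<^sup>2) / 2"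
      by (simp add: power2_eq_square field_simps)
    have "(2 * (- a) / 3)\<^sup>2 \<le> (- (a + b))\<^sup>2" using a by (intro power_mono) auto
    then have 2: "4 * a\<^sup>2 \<le> 9 * (a + b)\<^sup>2" by (simp add: power2_eq_square field_simps)
    have "\<bar>b\<bar> \<le> \<bar>a\<bar>" using a False by auto
    then have "b\<^sup>2 \<le> a\<^sup>2" by (simp add: abs_le_square_iff)
    then have "a\<^sup>2 + b\<^sup>2 \<le> 9 * ((a + t)\<^sup>2 + (b - t)\<^sup>2)"
      unfolding 1 using 2 zero_le_power2[of "a - b + 2 * t"] by argo
    then show ?thesis by (simp add: power_mult_distrib nx ny)
  qed
  then have le: "cmod x \<le> 3 * cmod (ray x t)" by (rule power2_le_imp_le) simp
  have "cmod (of_real t * (1 - \<i>)) \<le> cmod (ray x t) + cmod x"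
    using norm_triangle_ineq4[of "ray x t" x] by (simp add: ray_def)
  moreover have "t * 1 \<le> t * cmod (1 - \<i>)"
    using assms(2) by (intro mult_left_mono) (auto simp: norm_dir)
  ultimately have "t \<le> cmod (ray x t) + cmod x" using assms(2) by (simp add: norm_mult)
  then show "cmod x + t \<le> 7 * cmod (ray x t)" using le by linarith
  have "cmod x > 0" using assms(1) by (simp add: Gx_def)
  then have "cmod (ray x t) > 0" using le by linarith
  then show "ray x t \<in> Gx"
    using assms unfolding Gx_def by auto
qed

lemma Gx_subset_Om:
  assumes "x \<in> Gx" shows "x \<in> Om (cmod x / 3)" "x \<in> Om 0"
proof -
  have "cmod x \<le> \<bar>Re x\<bar> + \<bar>Im x\<bar>" by (rule cmod_le)
  moreover have "cmod x > 0" using assms by (auto simp: Gx_def)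
  moreover have "3 * Im x \<le> \<bar>Re x\<bar>" using assms by (simp add: Gx_def)
  ultimately have "Re x - Im x > cmod x / 3 \<or> Re x + Im x < - (cmod x / 3)"
    by linarith
  then show "x \<in> Om (cmod x / 3)" by (simp add: Om_def)
  then show "x \<in> Om 0" using Om_antimono[of 0 "cmod x / 3"] by auto
qed

section \<open>First order equations near infinity in the cone\<close>

definition Ginf :: "complex filter" where
  "Ginf = inf at_infinity (principal Gx)"

lemma eventually_Ginf: "eventually P Ginf \<longleftrightarrow> (\<exists>b. \<forall>x\<in>Gx. cmod x \<ge> b \<longrightarrow> P x)"
  unfolding Ginf_def eventually_inf_principal eventually_at_infinity by blast

lemma inverse_tendsto_Ginf_0: "((\<lambda>x. 1 / x) \<longlongrightarrow> 0) Ginf"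
proof -
  have "((\<lambda>x::complex. inverse x) \<longlongrightarrow> 0) at_infinity" by (rule tendsto_inverse_0)
  then show ?thesis
    unfolding Ginf_def by (auto simp: inverse_eq_divide intro: tendsto_mono[rotated])
qed

context volterra
begin

text \<open>Homogeneous solutions are multiples of \<open>psi\<close>, which grows exponentially
  along the rays. Polynomial growth of \<open>G\<close> excludes them, and what remains is the
  integral from infinity, whose size is controlled by \<open>R\<close>.\<close>

lemma first_order_limit_0:
  assumes der: "\<And>x. x \<in> Om 0 \<Longrightarrow> (G has_field_derivative pp x * G x + R x) (at x)"
    and growth: "\<forall>\<^sub>F x in Ginf. cmod (G x) \<le> B * cmod x ^ N"
    and R: "(R \<longlongrightarrow> 0) Ginf"
  shows "(G \<longlongrightarrow> 0) Ginf"
proof -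
  obtain C where C: "C > 0" "\<And>x t. x \<in> Om (1 / 3) \<Longrightarrow> t \<ge> 0 \<Longrightarrow>
      cmod (psi x / psi (ray x t)) * (1 + 4 * t / (1 / 3))\<^sup>2 \<le> C * exp (- \<mu> / 2 * t)"
    using psi_ratio_bound[of "1 / 3"] by auto
  obtain b1 where b1: "\<And>x. x \<in> Gx \<Longrightarrow> cmod x \<ge> b1 \<Longrightarrow> cmod (G x) \<le> B * cmod x ^ N"
    using growth unfolding eventually_Ginf by blast
  define \<Phi> where "\<Phi> x = G x / psi x" for x
  have \<Phi>: "(\<Phi> has_field_derivative R x / psi x) (at x)" if "x \<in> Om 0" for x
    unfolding \<Phi>_def[abs_def]
    by (rule derivative_eq_intros der psi_deriv that psi_nonzero refl)+ (simp add: field_simps)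
  have main: "\<exists>b. \<forall>x\<in>Gx. cmod x \<ge> b \<longrightarrow> cmod (G x) \<le> 4 * C / \<mu> * \<epsilon>" if \<epsilon>: "\<epsilon> > 0" for \<epsilon>
  proof -
    have "\<forall>\<^sub>F x in Ginf. cmod (R x) < \<epsilon>" using tendstoD[OF R \<epsilon>] by simp
    then obtain b2 where b2: "\<And>x. x \<in> Gx \<Longrightarrow> cmod x \<ge> b2 \<Longrightarrow> cmod (R x) < \<epsilon>"
      unfolding eventually_Ginf by blast
    \<comment> \<open>By the factor 7 of \<open>Gx_ray\<close> the whole ray from x stays where the
      growth bound and the smallness of \<open>R\<close> hold.\<close>
    define b where "b = 7 * max 1 (max b1 b2)"
    have "cmod (G x) \<le> 4 * C / \<mu> * \<epsilon>" if x: "x \<in> Gx" "cmod x \<ge> b" for x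
    proof -
      have x0: "x \<in> Om 0" by (rule Gx_subset_Om(2)[OF x(1)])
      have xb: "cmod x \<ge> 1" "cmod x \<ge> b1" "cmod x \<ge> b2" using x(2) by (auto simp: b_def)
      have x3: "x \<in> Om (1 / 3)"
        using Gx_subset_Om(1)[OF x(1)] Om_antimono[of "1/3" "cmod x / 3"] xb by auto
      have y: "ray x t \<in> Gx" "cmod (ray x t) \<ge> b1" "cmod (ray x t) \<ge> b2" if "t \<ge> 0" for t
        using Gx_ray[OF x(1) that] x(2) that by (auto simp: b_def)
      have ker: "1 / cmod (psi (ray x t)) * (1 + 12 * t)\<^sup>2 \<le> C / cmod (psi x) * exp (- \<mu> / 2 * t)" if "t \<ge> 0" for t
        using C(2)[OF x3 that] by (simp add: norm_divide field_simps)
      have ker': "1 / cmod (psi (ray x t)) \<le> C / cmod (psi x) * exp (- \<mu> / 2 * t)" if "t \<ge> 0" for t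
      proof -
        have "1 / cmod (psi (ray x t)) * 1 \<le> 1 / cmod (psi (ray x t)) * (1 + 12 * t)\<^sup>2"
          using that by (intro mult_left_mono) auto
        then show ?thesis using ker[OF that] by linarith
      qed
      define M where "M = 2 * \<epsilon> * (C / cmod (psi x))"
      have "cmod (\<Phi> x - 0) \<le> 0 - (- (2 / \<mu>) * M * exp (- \<mu> / 2 * 0))"
      proof (rule tail_bound[OF \<Phi> x0])
        show "((\<lambda>t. - (2 / \<mu>) * M * exp (- \<mu> / 2 * t)) has_real_derivative M * exp (- \<mu> / 2 * u)) (at u)" for u
          using mu_pos by (auto intro!: derivative_eq_intros simp: field_simps)
        have "((\<lambda>t. exp (- \<mu> / 2 * t)) \<longlongrightarrow> 0) at_top"
          using mu_pos by real_asymp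
        from tendsto_mult_right_zero[OF this, of "- (2 / \<mu>) * M"]
        show "((\<lambda>t. - (2 / \<mu>) * M * exp (- \<mu> / 2 * t)) \<longlongrightarrow> 0) at_top" .
        show "2 * cmod (R (ray x u) / psi (ray x u)) \<le> M * exp (- \<mu> / 2 * u)" if u: "u \<ge> 0" for u
        proof -
          have "cmod (R (ray x u)) * (1 / cmod (psi (ray x u))) \<le> \<epsilon> * (C / cmod (psi x) * exp (- \<mu> / 2 * u))"
            using b2[OF y(1,3)[OF u]] ker'[OF u] \<epsilon> by (intro mult_mono) auto
          then show ?thesis by (simp add: M_def norm_divide)
        qed
        have "((\<lambda>t. (1 + 12 * t) ^ N * exp (- \<mu> / 2 * t)) \<longlongrightarrow> 0) at_top"
          using mu_pos by real_asymp
        from tendsto_mult_right_zero[OF this, of "\<bar>B\<bar> * cmod x ^ N * (C / cmod (psi x))"]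
        have lim: "((\<lambda>t. \<bar>B\<bar> * cmod x ^ N * (C / cmod (psi x)) * ((1 + 12 * t) ^ N * exp (- \<mu> / 2 * t))) \<longlongrightarrow> 0) at_top" .
        have "cmod (\<Phi> (ray x t)) \<le> \<bar>B\<bar> * cmod x ^ N * (C / cmod (psi x)) * ((1 + 12 * t) ^ N * exp (- \<mu> / 2 * t))"
          if t: "t \<ge> 0" for t
        proof -
          have "cmod (G (ray x t)) \<le> B * cmod (ray x t) ^ N" by (rule b1[OF y(1,2)[OF t]])
          also have "\<dots> \<le> \<bar>B\<bar> * (cmod x * (1 + 12 * t)) ^ N"
            using norm_ray_bounds(1)[OF x3 _ t] t by (intro mult_mono power_mono) auto
          finally have "cmod (G (ray x t)) * (1 / cmod (psi (ray x t))) \<le>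
             \<bar>B\<bar> * (cmod x * (1 + 12 * t)) ^ N * (C / cmod (psi x) * exp (- \<mu> / 2 * t))"
            using ker'[OF t] t by (intro mult_mono) auto
          then show ?thesis by (simp add: \<Phi>_def norm_divide power_mult_distrib mult_ac)
        qed
        then show "((\<lambda>t. \<Phi> (ray x t)) \<longlongrightarrow> 0) at_top"
          by (intro Lim_null_comparison[OF eventually_mono[OF eventually_ge_at_top[of 0]] lim])
      qed
      then have "cmod (psi x) * cmod (\<Phi> x) \<le> cmod (psi x) * (2 / \<mu> * M)"
        by (intro mult_left_mono) auto
      also have "cmod (psi x) * cmod (\<Phi> x) = cmod (G x)" by (simp add: \<Phi>_def norm_divide)
      also have "cmod (psi x) * (2 / \<mu> * M) = 4 * C / \<mu> * \<epsilon>" by (simp add: M_def)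
      finally show ?thesis .
    qed
    then show ?thesis by blast
  qed
  show ?thesis
  proof (rule tendstoI)
    fix e :: real assume e: "e > 0"
    define \<epsilon> where "\<epsilon> = e * \<mu> / (8 * C)"
    have "\<epsilon> > 0" "4 * C / \<mu> * \<epsilon> < e" using e C(1) mu_pos by (auto simp: \<epsilon>_def)
    with main[of \<epsilon>] show "\<forall>\<^sub>F x in Ginf. dist (G x) 0 < e"
      unfolding eventually_Ginf by (metis dist_0_norm dist_commute order.strict_trans1)
  qed
qed

text \<open>Since \<open>pp x\<close> tends to \<mu>, the limit has to balance \<mu> G + R0 = 0.
  Subtracting this constant reduces the claim to a right-hand side tending to 0.\<close>

lemma first_order_limit:
  assumes der: "\<And>x. x \<in> Om 0 \<Longrightarrow> (G has_field_derivative pp x * G x + R x) (at x)"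
    and growth: "\<forall>\<^sub>F x in Ginf. cmod (G x) \<le> B * cmod x ^ N"
    and R: "(R \<longlongrightarrow> R0) Ginf"
  shows "(G \<longlongrightarrow> - R0 / of_real \<mu>) Ginf"
proof -
  define a where "a = R0 / of_real \<mu>"
  have "((\<lambda>x. G x + a) \<longlongrightarrow> 0) Ginf"
  proof (rule first_order_limit_0)
    show "((\<lambda>x. G x + a) has_field_derivative pp x * (G x + a) + (R x - pp x * a)) (at x)" if "x \<in> Om 0" for x
      using that by (auto intro!: derivative_eq_intros der simp: algebra_simps)
    have "\<forall>\<^sub>F x in Ginf. cmod x \<ge> 1" unfolding eventually_Ginf by blast
    with growth show "\<forall>\<^sub>F x in Ginf. cmod (G x + a) \<le> (B + cmod a) * cmod x ^ N"
    proof eventually_elim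
      case (elim x)
      have "cmod a * 1 \<le> cmod a * cmod x ^ N" using elim(2) by (intro mult_left_mono) auto
      then show ?case using elim(1) norm_triangle_ineq[of "G x" a] by (simp add: algebra_simps)
    qed
    have "((\<lambda>x. R x - (of_real \<mu> + of_real \<mu> * (1 / x)\<^sup>2 + of_real k * (1 / x)) * a) \<longlongrightarrow>
       R0 - (of_real \<mu> + of_real \<mu> * 0\<^sup>2 + of_real k * 0) * a) Ginf"
      by (intro tendsto_intros R inverse_tendsto_Ginf_0)
    then show "((\<lambda>x. R x - pp x * a) \<longlongrightarrow> 0) Ginf"
      using mu_pos by (simp add: pp_def a_def power_divide)
  qed
  then have "((\<lambda>x. (G x + a) - a) \<longlongrightarrow> 0 - a) Ginf" by (intro tendsto_intros)
  then show ?thesis by (simp add: a_def)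
qed

end

text \<open>\<open>M n\<close> is the n-th derivative of the second order operator applied to
  \<open>F 0\<close>. At n = 0 the truncated index \<open>n - 1\<close> is harmless, because its
  coefficient is 0.\<close>

lemma leibniz_deriv:
  fixes F :: "nat \<Rightarrow> complex \<Rightarrow> complex" and \<alpha> \<beta> \<gamma> \<delta> \<epsilon> :: complex
  assumes F: "\<And>n. (F n has_field_derivative F (Suc n) z) (at z)"
  defines "M \<equiv> \<lambda>n z. z\<^sup>2 * F (n + 2) z + ((\<alpha> + 2 * of_nat n) * z + \<beta> + \<gamma> * z\<^sup>2) * F (n + 1) z
     + (\<delta> + of_nat n * (of_nat n - 1) + of_nat n * \<alpha> + (\<epsilon> + 2 * of_nat n * \<gamma>) * z) * F n z
     + (of_nat n * (of_nat n - 1) * \<gamma> + of_nat n * \<epsilon>) * F (n - 1) z"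
  shows "(M n has_field_derivative M (Suc n) z) (at z)"
proof (cases n)
  case 0
  show ?thesis
    unfolding 0 M_def
    by (rule derivative_eq_intros F refl)+ (simp add: algebra_simps power2_eq_square)
next
  case (Suc m)
  show ?thesis
    unfolding Suc diff_Suc_1 M_def
    by (rule derivative_eq_intros F refl)+ (simp add: algebra_simps power2_eq_square)
qed

lemma leibniz_ode:
  fixes F :: "nat \<Rightarrow> complex \<Rightarrow> complex" and \<alpha> \<beta> \<gamma> \<delta> \<epsilon> :: complex
  assumes S: "open S"
    and F: "\<And>n z. z \<in> S \<Longrightarrow> (F n has_field_derivative F (Suc n) z) (at z)"
    and ode: "\<And>z. z \<in> S \<Longrightarrow> z\<^sup>2 * F 2 z + (\<alpha> * z + \<beta> + \<gamma> * z\<^sup>2) * F 1 z + (\<delta> + \<epsilon> * z) * F 0 z = 0"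
    and z: "z \<in> S"
  shows "z\<^sup>2 * F (n + 2) z + ((\<alpha> + 2 * of_nat n) * z + \<beta> + \<gamma> * z\<^sup>2) * F (n + 1) z
     + (\<delta> + of_nat n * (of_nat n - 1) + of_nat n * \<alpha> + (\<epsilon> + 2 * of_nat n * \<gamma>) * z) * F n z
     + (of_nat n * (of_nat n - 1) * \<gamma> + of_nat n * \<epsilon>) * F (n - 1) z = 0" (is "?E n z = 0")
  using z
proof (induction n arbitrary: z)
  case 0
  then show ?case using ode[of z] by (simp add: numeral_2_eq_2 add_ac)
next
  case (Suc n)
  have d: "(?E n has_field_derivative ?E (Suc n) z) (at z)"
    using leibniz_deriv[of F z] F[OF \<open>z \<in> S\<close>] by blast
  have "((\<lambda>z. 0) has_field_derivative ?E (Suc n) z) (at z)"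
    by (rule has_field_derivative_transform_within_open[OF d S \<open>z \<in> S\<close>]) (rule Suc.IH)
  then show ?case using DERIV_unique DERIV_const by blast
qed

text \<open>The image of \<open>Om 0\<close> under x -> 1 / x; \<open>Gz\<close> is in the same way
  the image of \<open>Gx\<close> with the vertex added.\<close>

definition Oz :: "complex set" where
  "Oz = {z. Im z > - \<bar>Re z\<bar>}"

definition Gz :: "complex set" where
  "Gz = {z. 3 * Im z \<ge> - \<bar>Re z\<bar>}"

lemma open_Oz: "open Oz"
  unfolding Oz_def by (intro open_Collect_less continuous_intros)

lemma closed_Gz: "closed Gz"
  unfolding Gz_def by (intro closed_Collect_le continuous_intros)

lemma zero_notin_Oz: "z \<in> Oz \<Longrightarrow> z \<noteq> 0"
  by (auto simp: Oz_def)

lemma Gz_minus_0: "z \<in> Gz \<Longrightarrow> z \<noteq> 0 \<Longrightarrow> z \<in> Oz"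
  by (auto simp: Oz_def Gz_def complex_eq_iff abs_if split: if_splits)

lemma inverse_Om: 
  assumes "z \<in> Oz" shows "1 / z \<in> Om 0"
proof -
  have pos: "(Re z)\<^sup>2 + (Im z)\<^sup>2 > 0"
    using zero_notin_Oz[OF assms] by (simp add: complex_neq_0)
  have "Re (1 / z) - Im (1 / z) = (Re z + Im z) / ((Re z)\<^sup>2 + (Im z)\<^sup>2)"
       "Re (1 / z) + Im (1 / z) = (Re z - Im z) / ((Re z)\<^sup>2 + (Im z)\<^sup>2)"
    by (simp_all add: Re_divide Im_divide add_divide_distrib diff_divide_distrib)
  moreover have "Re z + Im z > 0 \<or> Re z - Im z < 0"
    using assms unfolding Oz_def by auto
  ultimately have "Re (1 / z) - Im (1 / z) > 0 \<or> Re (1 / z) + Im (1 / z) < 0"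
    using pos by (simp only: zero_less_divide_iff divide_less_0_iff) auto
  then show ?thesis by (simp only: Om_def mem_Collect_eq minus_zero)
qed

lemma inverse_Oz:
  assumes "x \<in> Om 0" shows "1 / x \<in> Oz"
proof -
  have "x \<noteq> 0" using Om_0_not_0[OF assms] by simp
  then have pos: "(Re x)\<^sup>2 + (Im x)\<^sup>2 > 0" by (simp add: complex_neq_0)
  have 1: "Re (1 / x) = Re x / ((Re x)\<^sup>2 + (Im x)\<^sup>2)" "Im (1 / x) = - Im x / ((Re x)\<^sup>2 + (Im x)\<^sup>2)"
    by (simp_all add: Re_divide Im_divide)
  have "- \<bar>Re x\<bar> < - Im x" using assms unfolding Om_def by auto
  then have "- \<bar>Re x\<bar> / ((Re x)\<^sup>2 + (Im x)\<^sup>2) < - Im x / ((Re x)\<^sup>2 + (Im x)\<^sup>2)"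
    using pos by (rule divide_strict_right_mono)
  then show ?thesis unfolding Oz_def mem_Collect_eq 1 using pos by (simp add: abs_divide)
qed

lemma inverse_Gx:
  assumes "z \<in> Gz" "z \<noteq> 0" shows "1 / z \<in> Gx"
proof -
  have pos: "(Re z)\<^sup>2 + (Im z)\<^sup>2 > 0" using assms(2) by (simp add: complex_neq_0)
  have 1: "Re (1 / z) = Re z / ((Re z)\<^sup>2 + (Im z)\<^sup>2)" "Im (1 / z) = - Im z / ((Re z)\<^sup>2 + (Im z)\<^sup>2)"
    by (simp_all add: Re_divide Im_divide)
  have "- (3 * Im z) \<le> \<bar>Re z\<bar>" using assms(1) unfolding Gz_def by auto
  then have "- (3 * Im z) / ((Re z)\<^sup>2 + (Im z)\<^sup>2) \<le> \<bar>Re z\<bar> / ((Re z)\<^sup>2 + (Im z)\<^sup>2)"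
    using pos by (intro divide_right_mono) auto
  then show ?thesis unfolding Gx_def mem_Collect_eq 1 using pos assms(2) by (simp add: abs_divide)
qed

lemma filterlim_inverse_Ginf: "filterlim (\<lambda>z. 1 / z) Ginf (at 0 within Gz)"
proof -
  have "inverse = (\<lambda>z::complex. 1 / z)" by (simp add: fun_eq_iff inverse_eq_divide)
  then have "filterlim (\<lambda>z::complex. 1 / z) at_infinity (at 0)"
    using filterlim_inverse_at_infinity by metis
  then have "filterlim (\<lambda>z::complex. 1 / z) at_infinity (at 0 within Gz)"
    by (rule filterlim_mono[OF _ order.refl at_le]) auto
  moreover have "filterlim (\<lambda>z. 1 / z) (principal Gx) (at 0 within Gz)"
    unfolding filterlim_principal eventually_at_filter using inverse_Gx by (simp add: eventually_sequentially)
  ultimately show ?thesis unfolding Ginf_def filterlim_inf by blast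
qed

lemma tendsto_imp_eventually_bounded:
  fixes f :: "'a \<Rightarrow> complex"
  assumes "(f \<longlongrightarrow> L) F"
  shows "\<forall>\<^sub>F x in F. cmod (f x) \<le> cmod L + 1"
  using order_tendstoD(2)[OF tendsto_norm[OF assms], of "cmod L + 1"]
  by (auto elim!: eventually_mono)

text \<open>All derivatives have limits at 0 by strong induction: in the variable x = 1 / z the
  derivative of order n + 1 solves a first order equation whose right-hand side contains only lower
  derivatives, so \<open>first_order_limit\<close> applies once polynomial growth is known.\<close>

theorem smooth_solution:
  fixes \<kappa> \<mu> c :: real
  assumes mu: "\<mu> > 0"
  obtains F :: "nat \<Rightarrow> complex \<Rightarrow> complex" where
    "\<And>n. continuous_on Gz (F n)"
    "\<And>n z. z \<in> Oz \<Longrightarrow> (F n has_field_derivative F (Suc n) z) (at z)"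
    "F 0 0 = 1"
    "\<And>z. z \<in> Oz \<Longrightarrow> z\<^sup>2 * F 2 z + (of_real \<kappa> * z + of_real \<mu> + of_real \<mu> * z\<^sup>2) * F 1 z + of_real c * F 0 z = 0"
proof -
  \<comment> \<open>With x = 1 / z one has d/dz = - x^2 d/dx, whose square contributes 2 x^3 d/dx;
    this shifts \<kappa> by - 2.\<close>
  interpret volterra "\<kappa> - 2" \<mu> c by unfold_locales (rule mu)
  obtain h g where
    h: "\<And>x. x \<in> Om 0 \<Longrightarrow> (h has_field_derivative g x) (at x)" and
    g: "\<And>x. x \<in> Om 0 \<Longrightarrow> (g has_field_derivative pp x * g x - of_real c / x\<^sup>2 * h x) (at x)" and
    g_bound: "\<And>r. r > 0 \<Longrightarrow> \<exists>B. \<forall>x\<in>Om r. cmod (g x) \<le> B / (cmod x)\<^sup>2" and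
    h_tail: "\<And>x. x \<in> Om 0 \<Longrightarrow> ((\<lambda>t. h (ray x t)) \<longlongrightarrow> 1) at_top"
    using solution_at_infinity by blast
  define f where "f z = h (1 / z)" for z
  define F where "F n = (deriv ^^ n) f" for n
  have f: "(f has_field_derivative - g (1 / z) / z\<^sup>2) (at z)" if "z \<in> Oz" for z
  proof -
    have "((\<lambda>z. 1 / z) has_field_derivative - (1 / z\<^sup>2)) (at z)"
      using zero_notin_Oz[OF that] by (auto intro!: derivative_eq_intros simp: power2_eq_square field_simps)
    from DERIV_chain2[OF h[OF inverse_Om[OF that]] this] show ?thesis by (simp add: f_def[abs_def])
  qed
  have "f holomorphic_on Oz"
    using f open_Oz by (auto simp: holomorphic_on_open)
  then have F: "(F n has_field_derivative F (Suc n) z) (at z)" if "z \<in> Oz" for n z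
    unfolding F_def funpow.simps o_apply
    by (intro holomorphic_derivI[OF _ open_Oz that] holomorphic_higher_deriv open_Oz)
  have F1: "F 1 z = - g (1 / z) / z\<^sup>2" if "z \<in> Oz" for z
    using DERIV_imp_deriv[OF f[OF that]] by (simp add: F_def)
  have ode: "z\<^sup>2 * F 2 z + (of_real \<kappa> * z + of_real \<mu> + of_real \<mu> * z\<^sup>2) * F 1 z + (of_real c + 0 * z) * F 0 z = 0"
    if z: "z \<in> Oz" for z
  proof -
    have z0: "z \<noteq> 0" using zero_notin_Oz z by blast
    define x where "x = 1 / z"
    have "((\<lambda>z. - g (1 / z) / z\<^sup>2) has_field_derivative
        (pp x * g x - of_real c / x\<^sup>2 * h x) / z ^ 4 + 2 * g x / z ^ 3) (at z)"
    proof -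
      have "((\<lambda>z. 1 / z) has_field_derivative - (1 / z\<^sup>2)) (at z)"
        using z0 by (auto intro!: derivative_eq_intros simp: power2_eq_square field_simps)
      from DERIV_chain2[OF g[OF inverse_Om[OF z]] this]
      have "((\<lambda>z. g (1 / z)) has_field_derivative (pp x * g x - of_real c / x\<^sup>2 * h x) * - (1 / z\<^sup>2)) (at z)"
        by (simp add: x_def)
      moreover have "((\<lambda>z. z\<^sup>2) has_field_derivative 2 * z) (at z)"
        by (auto intro!: derivative_eq_intros)
      moreover have "z\<^sup>2 \<noteq> 0" using z0 by simp
      ultimately have "((\<lambda>z. - g (1 / z) / z\<^sup>2) has_field_derivative
          (- ((pp x * g x - of_real c / x\<^sup>2 * h x) * - (1 / z\<^sup>2)) * z\<^sup>2 - (- g (1 / z)) * (2 * z)) / (z\<^sup>2 * z\<^sup>2)) (at z)"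
        by (intro DERIV_divide DERIV_minus)
      moreover have "(- (A * - (1 / z\<^sup>2)) * z\<^sup>2 - (- C) * (2 * z)) / (z\<^sup>2 * z\<^sup>2) = A / z ^ 4 + 2 * C / z ^ 3" for A C
        using z0 by (simp add: field_simps power_numeral_reduce)
      ultimately show ?thesis by (simp only: x_def)
    qed
    moreover have "((\<lambda>z. - g (1 / z) / z\<^sup>2) has_field_derivative F (Suc 1) z) (at z)"
      by (rule has_field_derivative_transform_within_open[OF F[OF z] open_Oz z]) (rule F1)
    ultimately have "F 2 z = (pp x * g x - of_real c / x\<^sup>2 * h x) / z ^ 4 + 2 * g x / z ^ 3"
      using DERIV_unique by (simp add: numeral_2_eq_2) blast
    moreover have "pp x = of_real \<mu> + of_real \<mu> * z\<^sup>2 + (of_real \<kappa> - 2) * z"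
      by (simp add: pp_def x_def power_divide)
    moreover have "F 0 z = h x" by (simp add: F_def f_def x_def)
    moreover have "(A / z ^ 4 + 2 * C / z ^ 3) * z ^ 4 = A + 2 * C * z" "B / x\<^sup>2 = B * z\<^sup>2" for A B C
      using z0 by (simp_all add: field_simps power_numeral_reduce x_def)
    ultimately have e2: "F 2 z * z ^ 4 = (of_real \<mu> + of_real \<mu> * z\<^sup>2 + (of_real \<kappa> - 2) * z) * g x - of_real c * z\<^sup>2 * F 0 z + 2 * g x * z"
      by simp
    have e1: "F 1 z * z\<^sup>2 = - g x" using F1[OF z] z0 by (simp add: x_def)
    have "z\<^sup>2 * (z\<^sup>2 * F 2 z + (of_real \<kappa> * z + of_real \<mu> + of_real \<mu> * z\<^sup>2) * F 1 z + (of_real c + 0 * z) * F 0 z) =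
        F 2 z * z ^ 4 + (of_real \<kappa> * z + of_real \<mu> + of_real \<mu> * z\<^sup>2) * (F 1 z * z\<^sup>2) + of_real c * z\<^sup>2 * F 0 z"
      by (simp add: algebra_simps power_numeral_reduce)
    also have "\<dots> = 0" unfolding e1 e2 by (simp add: algebra_simps)
    finally show ?thesis using z0 by simp
  qed
  define X where "X n x = F n (1 / x)" for n x
  have X_ode: "(1 / x)\<^sup>2 * X (n + 2) x + ((of_real \<kappa> + 2 * of_nat n) * (1 / x) + of_real \<mu> + of_real \<mu> * (1 / x)\<^sup>2) * X (n + 1) x
     + (of_real c + of_nat n * (of_nat n - 1) + of_nat n * of_real \<kappa> + (0 + 2 * of_nat n * of_real \<mu>) * (1 / x)) * X n x
     + (of_nat n * (of_nat n - 1) * of_real \<mu> + of_nat n * 0) * X (n - 1) x = 0" if "x \<in> Om 0" for n x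
    unfolding X_def by (rule leibniz_ode[OF open_Oz F ode inverse_Oz[OF that]])
  have ev_Om: "\<forall>\<^sub>F x in Ginf. x \<in> Om 0" "\<forall>\<^sub>F x in Ginf. x \<in> Om (1 / 3)" "\<forall>\<^sub>F x in Ginf. x \<noteq> 0"
    unfolding eventually_Ginf
  proof -
    show "\<exists>b. \<forall>x\<in>Gx. b \<le> cmod x \<longrightarrow> x \<in> Om 0" using Gx_subset_Om by blast
    show "\<exists>b. \<forall>x\<in>Gx. b \<le> cmod x \<longrightarrow> x \<noteq> 0" by (auto simp: Gx_def)
    have "x \<in> Om (1 / 3)" if "x \<in> Gx" "1 \<le> cmod x" for x
      using Gx_subset_Om(1)[OF that(1)] Om_antimono[of "1 / 3" "cmod x / 3"] that(2) by auto
    then show "\<exists>b. \<forall>x\<in>Gx. b \<le> cmod x \<longrightarrow> x \<in> Om (1 / 3)" by blast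
  qed
  obtain B where B: "\<And>x. x \<in> Om (1 / 3) \<Longrightarrow> cmod (g x) \<le> B / (cmod x)\<^sup>2"
    using g_bound[of "1 / 3"] by auto
  have X0: "(X 0 \<longlongrightarrow> 1) Ginf"
  proof -
    \<comment> \<open>98 = 2 * 7^2: the speed bound of the ray and the squared constant of
      \<open>Gx_ray\<close>.\<close>
    have est: "cmod (h x - 1) \<le> 98 * \<bar>B\<bar> * cmod (1 / x)" if x: "x \<in> Gx" "7 \<le> cmod x" for x
    proof -
      have "cmod (h x - 1) \<le> 0 - (- (98 * \<bar>B\<bar>) / (cmod x + 0))"
      proof (rule tail_bound[OF h _ h_tail])
        show "((\<lambda>u. - (98 * \<bar>B\<bar>) / (cmod x + u)) has_real_derivative 98 * \<bar>B\<bar> / (cmod x + u)\<^sup>2) (at u)" if "u \<ge> 0" for u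
        proof -
          have "cmod x + u \<noteq> 0" using that x(2) by linarith
          then show ?thesis
            by (auto intro!: derivative_eq_intros simp: power2_eq_square)
        qed
        show "((\<lambda>u. - (98 * \<bar>B\<bar>) / (cmod x + u)) \<longlongrightarrow> 0) at_top"
          by real_asymp
        fix u :: real assume u: "u \<ge> 0"
        note y = Gx_ray[OF x(1) u]
        have "ray x u \<in> Om (1 / 3)"
          using Gx_subset_Om(1)[OF y(1)] Om_antimono[of "1 / 3" "cmod (ray x u) / 3"] y(2) x(2) u by auto
        then have "cmod (g (ray x u)) \<le> B / (cmod (ray x u))\<^sup>2" by (rule B)
        also have "\<dots> \<le> \<bar>B\<bar> / ((cmod x + u) / 7)\<^sup>2"
          using y(2) x(2) u by (intro frac_le power_mono) auto
        finally show "2 * cmod (g (ray x u)) \<le> 98 * \<bar>B\<bar> / (cmod x + u)\<^sup>2"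
          by (simp add: power_divide)
      qed (assumption | rule Gx_subset_Om(2)[OF x(1)])+
      then show ?thesis by (simp add: norm_divide)
    qed
    have "((\<lambda>x. 98 * \<bar>B\<bar> * cmod (1 / x)) \<longlongrightarrow> 98 * \<bar>B\<bar> * cmod 0) Ginf"
      by (intro tendsto_intros inverse_tendsto_Ginf_0)
    then have lim: "((\<lambda>x. 98 * \<bar>B\<bar> * cmod (1 / x)) \<longlongrightarrow> 0) Ginf" by simp
    have "((\<lambda>x. h x - 1) \<longlongrightarrow> 0) Ginf"
      by (rule Lim_null_comparison[OF _ lim]) (use est in \<open>auto simp: eventually_Ginf\<close>)
    then have "(h \<longlongrightarrow> 1) Ginf" by (rule iffD2[OF Lim_null])
    then show ?thesis by (simp add: X_def[abs_def] F_def f_def)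
  qed
  \<comment> \<open>Differentiating the equation once raises \<kappa> by 2, so each order belongs to
    its own instance of the locale.\<close>
  have X_deriv: "(X (Suc n) has_field_derivative volterra.pp (\<kappa> + 2 * real n) \<mu> x * X (Suc n) x +
      ((of_real c + of_nat n * (of_nat n - 1) + of_nat n * of_real \<kappa> + 2 * of_nat n * of_real \<mu> * (1 / x)) * X n x
       + of_nat n * (of_nat n - 1) * of_real \<mu> * X (n - 1) x)) (at x)" if x: "x \<in> Om 0" for n x
  proof -
    have x0: "x \<noteq> 0" using Om_0_not_0[OF x] by simp
    have "((\<lambda>x. 1 / x) has_field_derivative - (1 / x\<^sup>2)) (at x)"
      using x0 by (auto intro!: derivative_eq_intros simp: power2_eq_square field_simps)
    from DERIV_chain2[OF F[OF inverse_Oz[OF x], of "Suc n"] this]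
    have 1: "(X (Suc n) has_field_derivative - ((1 / x)\<^sup>2 * X (n + 2) x)) (at x)"
      by (simp add: X_def[abs_def] power_divide)
    show ?thesis
      by (rule DERIV_cong[OF 1]) (use X_ode[OF x, of n] in \<open>simp add: volterra.pp_def[OF volterra.intro[OF mu]] algebra_simps power_divide; Groebner_Basis.algebra\<close>)
  qed
  have X_lim: "\<exists>L. (X n \<longlongrightarrow> L) Ginf" for n
  proof (induction n rule: less_induct)
    case (less n)
    show ?case
    proof (cases n)
      case 0
      then show ?thesis using X0 by blast
    next
      case (Suc m)
      interpret V: volterra "\<kappa> + 2 * real m" \<mu> c by unfold_locales (rule mu)
      obtain L1 where L1: "(X m \<longlongrightarrow> L1) Ginf" using less.IH[of m] Suc by auto
      have "m - 1 < n" using Suc by simp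
      then obtain L2 where L2: "(X (m - 1) \<longlongrightarrow> L2) Ginf" using less.IH[of "m - 1"] by blast
      \<comment> \<open>The a priori growth comes from the bound on \<open>g\<close> for the first
        derivative. For later ones the equation one order lower is solved for its highest
        derivative, at the cost of a factor x^2.\<close>
      have growth: "\<exists>B N. \<forall>\<^sub>F x in Ginf. cmod (X (Suc m) x) \<le> B * cmod x ^ N"
      proof (cases m)
        case 0
        have "\<forall>\<^sub>F x in Ginf. cmod (X (Suc m) x) \<le> B * cmod x ^ 0"
          using ev_Om(2,3,1)
        proof eventually_elim
          case (elim x)
          have "cmod (X (Suc m) x) = cmod (g x) * (cmod x)\<^sup>2"
            using F1[OF inverse_Oz[OF elim(3)]] by (simp add: X_def 0 norm_mult norm_divide norm_power power_divide)
          also have "\<dots> \<le> B / (cmod x)\<^sup>2 * (cmod x)\<^sup>2"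
            by (intro mult_right_mono B elim) auto
          finally show ?case using elim by simp
        qed
        then show ?thesis by blast
      next
        case (Suc j)
        have "j - 1 < n" using Suc \<open>n = Suc m\<close> by simp
        then obtain L3 where L3: "(X (j - 1) \<longlongrightarrow> L3) Ginf" using less.IH[of "j - 1"] by blast
        have L12: "(X (j + 1) \<longlongrightarrow> L1) Ginf" "(X j \<longlongrightarrow> L2) Ginf" using L1 L2 Suc by auto
        define Y where "Y x = - (((of_real \<kappa> + 2 * of_nat j) * (1 / x) + of_real \<mu> + of_real \<mu> * (1 / x)\<^sup>2) * X (j + 1) x
          + (of_real c + of_nat j * (of_nat j - 1) + of_nat j * of_real \<kappa> + (0 + 2 * of_nat j * of_real \<mu>) * (1 / x)) * X j x
          + (of_nat j * (of_nat j - 1) * of_real \<mu> + of_nat j * 0) * X (j - 1) x)" for x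
        have "\<exists>L. (Y \<longlongrightarrow> L) Ginf"
          unfolding Y_def by (rule exI, (rule L12 L3 inverse_tendsto_Ginf_0 tendsto_intros)+)
        then obtain L where "(Y \<longlongrightarrow> L) Ginf" by blast
        from tendsto_imp_eventually_bounded[OF this] ev_Om(1,3)
        have "\<forall>\<^sub>F x in Ginf. cmod (X (Suc m) x) \<le> (cmod L + 1) * cmod x ^ 2"
        proof eventually_elim
          case (elim x)
          have "(1 / x)\<^sup>2 * X (j + 2) x = Y x"
            using X_ode[OF elim(2), of j] unfolding Y_def by (simp only: eq_neg_iff_add_eq_0 add.assoc)
          then have "X (Suc m) x = Y x * x\<^sup>2" using elim(3) by (simp add: Suc field_simps power_divide)
          then show ?case using elim(1) by (simp add: norm_mult norm_power mult_right_mono)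
        qed
        then show ?thesis by blast
      qed
      then obtain B N where gr: "\<forall>\<^sub>F x in Ginf. cmod (X (Suc m) x) \<le> B * cmod x ^ N" by blast
      have "((\<lambda>x. (of_real c + of_nat m * (of_nat m - 1) + of_nat m * of_real \<kappa> + 2 * of_nat m * of_real \<mu> * (1 / x)) * X m x
       + of_nat m * (of_nat m - 1) * of_real \<mu> * X (m - 1) x) \<longlongrightarrow>
        (of_real c + of_nat m * (of_nat m - 1) + of_nat m * of_real \<kappa> + 2 * of_nat m * of_real \<mu> * 0) * L1
       + of_nat m * (of_nat m - 1) * of_real \<mu> * L2) Ginf"
        by (intro tendsto_intros inverse_tendsto_Ginf_0 L1 L2)
      from V.first_order_limit[OF X_deriv gr this] show ?thesis unfolding Suc by blast
    qed
  qed
  then obtain L where L: "\<And>n. (X n \<longlongrightarrow> L n) Ginf" by metis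
  have "L 0 = 1"
  proof -
    have "Ginf \<noteq> bot"
    proof
      assume "Ginf = bot"
      then have "\<forall>\<^sub>F x in Ginf. False" by simp
      then obtain b where b: "\<And>x. x \<in> Gx \<Longrightarrow> cmod x \<ge> b \<Longrightarrow> False" unfolding eventually_Ginf by blast
      show False by (rule b[of "of_real (max 1 b)"]) (auto simp: Gx_def)
    qed
    then show ?thesis using tendsto_unique[OF _ L[of 0] X0] by blast
  qed
  \<comment> \<open>\<open>F n\<close> comes from h (1 / z) and says nothing at the vertex; the
    limit found there is inserted.\<close>
  define Fb where "Fb n z = (if z = 0 then L n else F n z)" for n z
  show ?thesis
  proof
    fix n
    have "isCont (F n) z" if "z \<in> Oz" for z using F[OF that] DERIV_isCont by blast
    have "(F n \<longlongrightarrow> L n) (at 0 within Gz)"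
      using filterlim_compose[OF L[of n] filterlim_inverse_Ginf] by (simp add: X_def)
    then have 0: "(Fb n \<longlongrightarrow> L n) (at 0 within Gz)"
      by (rule Lim_transform_eventually) (auto simp: eventually_at_filter Fb_def)
    show "continuous_on Gz (Fb n)"
      unfolding continuous_on_def
    proof
      fix z assume z: "z \<in> Gz"
      show "(Fb n \<longlongrightarrow> Fb n z) (at z within Gz)"
      proof (cases "z = 0")
        case True
        then show ?thesis using 0 by (simp add: Fb_def)
      next
        case False
        then have "isCont (F n) z" using F[OF Gz_minus_0[OF z]] DERIV_isCont by blast
        then have "(F n \<longlongrightarrow> F n z) (at z within Gz)"
          by (simp add: isCont_def tendsto_within_subset[where S = UNIV])
        moreover have "\<forall>\<^sub>F w in at z within Gz. F n w = Fb n w"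
          using eventually_neq_at_within[of 0 z Gz] by eventually_elim (simp add: Fb_def)
        ultimately show ?thesis
          using False by (auto simp: Fb_def intro: Lim_transform_eventually)
      qed
    qed
  next
    fix n z assume z: "z \<in> Oz"
    have "(Fb n has_field_derivative F (Suc n) z) (at z)"
      by (rule has_field_derivative_transform_within_open[OF F[OF z] open_Oz z])
        (use zero_notin_Oz in \<open>auto simp: Fb_def\<close>)
    then show "(Fb n has_field_derivative Fb (Suc n) z) (at z)"
      using zero_notin_Oz[OF z] by (simp add: Fb_def)
  next
    show "Fb 0 0 = 1" using \<open>L 0 = 1\<close> by (simp add: Fb_def)
  next
    fix z assume z: "z \<in> Oz"
    then show "z\<^sup>2 * Fb 2 z + (of_real \<kappa> * z + of_real \<mu> + of_real \<mu> * z\<^sup>2) * Fb 1 z + of_real c * Fb 0 z = 0"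
      using ode[OF z] zero_notin_Oz[OF z] by (simp add: Fb_def)
  qed
qed

section \<open>Normalizing transformations and Stokes multipliers\<close>

lemma open_sector: "open (sector lo hi)"
  unfolding open_dist
proof
  fix z0 assume "z0 \<in> sector lo hi"
  then obtain \<theta>0 where z0: "z0 \<noteq> 0" "lo < \<theta>0" "\<theta>0 < hi" "z0 = of_real (cmod z0) * cis \<theta>0"
    by (auto simp: sector_def)
  \<comment> \<open>A continuous branch of the argument near \<open>z0\<close>, normalised to the
    value \<open>\<theta>0\<close> at \<open>z0\<close>.\<close>
  define f where "f z = \<theta>0 + Im (Ln (z / z0))" for z
  have c: "isCont f z0"
    unfolding f_def using z0(1) by (intro continuous_intros isCont_Im) auto
  have "f z0 = \<theta>0" using z0(1) by (simp add: f_def)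
  then have "\<forall>\<^sub>F z in nhds z0. lo < f z \<and> f z < hi \<and> z \<noteq> 0"
    using c z0 unfolding isCont_def tendsto_at_iff_tendsto_nhds
    by (auto intro!: eventually_conj order_tendstoD[of f "f z0" "nhds z0"] t1_space_nhds)
  then obtain e where e: "e > 0" "\<And>z. dist z z0 < e \<Longrightarrow> lo < f z \<and> f z < hi \<and> z \<noteq> 0"
    unfolding eventually_nhds_metric by blast
  have "z \<in> sector lo hi" if "dist z z0 < e" for z
  proof -
    note fz = e(2)[OF that]
    have "z = z0 * (z / z0)" using z0 by simp
    also have "z / z0 = of_real (cmod (z / z0)) * cis (Im (Ln (z / z0)))"
      using fz z0(1) by (simp add: Arg_eq_Im_Ln[symmetric] cis_Arg sgn_eq)
    also have "z0 * (of_real (cmod (z / z0)) * cis (Im (Ln (z / z0)))) =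
        of_real (cmod z0 * cmod (z / z0)) * cis (f z)"
      by (subst z0(4)) (simp add: f_def cis_mult[symmetric] mult_ac norm_mult)
    also have "cmod z0 * cmod (z / z0) = cmod z" using z0(1) by (simp add: norm_divide)
    finally show ?thesis using fz by (auto simp: sector_def)
  qed
  then show "\<exists>e>0. \<forall>y. dist y z0 < e \<longrightarrow> y \<in> sector lo hi" using e(1) by blast
qed

lemma sector_polar: "sector lo hi = (\<lambda>(r, \<theta>). of_real r * cis \<theta>) ` ({0<..} \<times> {lo<..<hi})"
proof (intro equalityI subsetI)
  fix z assume "z \<in> sector lo hi"
  then obtain \<theta> where "z \<noteq> 0" "lo < \<theta>" "\<theta> < hi" "z = of_real (cmod z) * cis \<theta>"
    by (auto simp: sector_def)
  then show "z \<in> (\<lambda>(r, \<theta>). of_real r * cis \<theta>) ` ({0<..} \<times> {lo<..<hi})"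
    by (intro image_eqI[of _ _ "(cmod z, \<theta>)"]) auto
next
  fix z assume "z \<in> (\<lambda>(r, \<theta>). of_real r * cis \<theta>) ` ({0<..} \<times> {lo<..<hi})"
  then show "z \<in> sector lo hi" by (auto simp: sector_def norm_mult)
qed

lemma polar_in_sector: "r > 0 \<Longrightarrow> lo < \<theta> \<Longrightarrow> \<theta> < hi \<Longrightarrow> of_real r * cis \<theta> \<in> sector lo hi"
  by (auto simp: sector_polar)

lemma connected_sector: "connected (sector lo hi)"
  unfolding sector_polar case_prod_unfold
  by (intro connected_continuous_image continuous_intros connected_Times) auto

lemma zero_notin_sector: "0 \<notin> sector lo hi"
  by (simp add: sector_def)

lemma sector_mono: "lo' \<le> lo \<Longrightarrow> hi \<le> hi' \<Longrightarrow> sector lo hi \<subseteq> sector lo' hi'"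
  unfolding sector_polar by (intro image_mono Sigma_mono) auto

lemma sector_shift: "sector (lo + 2 * pi) (hi + 2 * pi) = sector lo hi"
proof -
  have *: "sector (lo + 2 * pi * s) (hi + 2 * pi * s) \<subseteq> sector lo hi" if "s = 1 \<or> s = - 1" for lo hi s
  proof
    fix z assume "z \<in> sector (lo + 2 * pi * s) (hi + 2 * pi * s)"
    then obtain r \<theta> where "r > 0" "lo + 2 * pi * s < \<theta>" "\<theta> < hi + 2 * pi * s" "z = of_real r * cis \<theta>"
      unfolding sector_polar by auto
    moreover have "cis \<theta> = cis (\<theta> - 2 * pi * s)"
      using that by (auto simp: complex_eq_iff cos_diff sin_diff)
    ultimately show "z \<in> sector lo hi"
      unfolding sector_polar by (intro image_eqI[of _ _ "(r, \<theta> - 2 * pi * s)"]) auto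
  qed
  show ?thesis using *[of 1 lo hi] *[of "-1" "lo + 2 * pi" "hi + 2 * pi"] by auto
qed

lemma positive_reals_in_sector: "lo < 0 \<Longrightarrow> 0 < hi \<Longrightarrow> t > 0 \<Longrightarrow> of_real t \<in> sector lo hi"
  using polar_in_sector[of t lo 0 hi] by simp

lemma negative_reals_in_sector: "lo < pi \<Longrightarrow> pi < hi \<Longrightarrow> t > 0 \<Longrightarrow> - of_real t \<in> sector lo hi"
  using polar_in_sector[of t lo pi hi] by simp

lemma zero_in_closure_if_positive_reals:
  fixes w :: complex
  assumes "\<And>t. t > 0 \<Longrightarrow> of_real t * w \<in> S"
  shows "0 \<in> closure S"
  unfolding closure_approachable
proof (intro allI impI)
  fix e :: real assume e: "e > 0"
  define t where "t = e / (2 * (1 + cmod w))"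
  have t: "t > 0" using e by (simp add: t_def add_pos_nonneg)
  have "0 < 2 + cmod w" by (rule add_pos_nonneg) auto
  then have "cmod w < 2 * (1 + cmod w)" by (simp add: algebra_simps)
  with e have "e * cmod w < e * (2 * (1 + cmod w))" by (rule mult_strict_left_mono[rotated])
  moreover have "2 * (1 + cmod w) > 0" by (intro mult_pos_pos add_pos_nonneg) auto
  ultimately have "t * cmod w < e" by (simp add: t_def pos_divide_less_eq)
  then show "\<exists>y\<in>S. dist y 0 < e" using assms[OF t] t by (auto simp: norm_mult intro!: bexI)
qed

section \<open>Uniqueness of normalizing transformations\<close>

definition dd :: "real \<Rightarrow> real \<Rightarrow> complex \<Rightarrow> complex" where
  "dd l \<mu> z = - of_real l / z - of_real \<mu> / z\<^sup>2 - of_real \<mu>"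

text \<open>On the positive reals the solutions are multiples of t^(-l) exp (\<mu> (1 / t - t)),
  which blows up at 0+. A solution tending to 0 there vanishes on the half-line, hence on S by the
  identity theorem.\<close>

lemma dominant_solution_zero:
  assumes S: "open S" "connected S" "\<And>t. t > 0 \<Longrightarrow> of_real t \<in> S" and mu: "\<mu> > 0"
    and f: "\<And>z. z \<in> S \<Longrightarrow> (f has_field_derivative dd l \<mu> z * f z) (at z)"
    and lim: "((\<lambda>t. f (of_real t)) \<longlongrightarrow> 0) (at_right 0)"
    and z: "z \<in> S"
  shows "f z = 0"
proof -
  define \<phi> where "\<phi> t = exp (l * ln t - \<mu> * (1 / t - t))" for t :: real
  define u where "u t = f (of_real t) * of_real (\<phi> t)" for t
  have \<phi>: "(\<phi> has_real_derivative (l / t + \<mu> / t\<^sup>2 + \<mu>) * \<phi> t) (at t)" if "t > 0" for t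
    unfolding \<phi>_def[abs_def] using that
    by (auto intro!: derivative_eq_intros simp: power2_eq_square) (simp add: algebra_simps)
  have u: "(u has_vector_derivative 0) (at t)" if t: "t > 0" for t
  proof -
    have 1: "((\<lambda>t. f (of_real t)) has_vector_derivative dd l \<mu> (of_real t) * f (of_real t)) (at t)"
      using has_vector_derivative_real_field[OF f[OF S(3)[OF t]]] .
    have 2: "((\<lambda>t. complex_of_real (\<phi> t)) has_vector_derivative of_real ((l / t + \<mu> / t\<^sup>2 + \<mu>) * \<phi> t)) (at t)"
      by (rule has_vector_derivative_of_real[OF \<phi>[OF t]])
    have "of_real ((l / t + \<mu> / t\<^sup>2 + \<mu>) * \<phi> t) = - dd l \<mu> (of_real t) * complex_of_real (\<phi> t)"
      by (simp add: dd_def algebra_simps)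
    then have "f (of_real t) * of_real ((l / t + \<mu> / t\<^sup>2 + \<mu>) * \<phi> t) + dd l \<mu> (of_real t) * f (of_real t) * complex_of_real (\<phi> t) = 0"
      by (simp only:) (simp add: algebra_simps)
    with has_vector_derivative_mult[OF 1 2] show ?thesis
      unfolding u_def[abs_def] by (simp only:)
  qed
  have der: "(u has_vector_derivative 0) (at t within {0<..})" if "t \<in> {0<..}" for t
    by (rule has_vector_derivative_at_within[OF u]) (use that in simp)
  have cv: "convex {0::real<..}" by simp
  have "\<exists>C. \<forall>t\<in>{0<..}. u t = C"
    by (rule has_derivative_zero_constant[OF cv])
      (rule der[unfolded has_vector_derivative_def scaleR_zero_right])
  then obtain C where "\<forall>t\<in>{0<..}. u t = C" ..
  then have C: "u t = C" if "t > 0" for t using that by (metis greaterThan_iff)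
  have "((\<lambda>t. of_real (\<phi> t) :: complex) \<longlongrightarrow> of_real 0) (at_right 0)"
  proof (rule tendsto_of_real)
    show "(\<phi> \<longlongrightarrow> 0) (at_right 0)"
      unfolding \<phi>_def[abs_def] using mu by real_asymp
  qed
  from tendsto_mult[OF lim this] have "(u \<longlongrightarrow> 0) (at_right 0)" by (simp add: u_def[abs_def])
  moreover have "(u \<longlongrightarrow> C) (at_right 0)"
  proof (rule tendsto_eventually)
    show "\<forall>\<^sub>F t in at_right 0. u t = C"
      using eventually_at_right_less[of 0] by eventually_elim (rule C)
  qed
  ultimately have "C = 0" using tendsto_unique trivial_limit_at_right_real by blast
  then have zero: "f (of_real t) = 0" if "t > 0" for t
    using C[OF that] that by (simp add: u_def \<phi>_def)
  have hol: "f holomorphic_on S" using f S(1) by (auto simp: holomorphic_on_open)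
  have islim: "1 islimpt (complex_of_real ` {0<..})"
    unfolding islimpt_approachable
  proof (intro allI impI)
    fix e :: real assume e: "e > 0"
    have d: "dist (complex_of_real (1 + e / 2)) 1 = e / 2"
      using dist_of_real[of "1 + e / 2" 1, where 'a = complex] e by (simp add: dist_real_def del: of_real_add)
    show "\<exists>x'\<in>complex_of_real ` {0<..}. x' \<noteq> 1 \<and> dist x' 1 < e"
    proof (rule bexI)
      have "dist (complex_of_real (1 + e / 2)) 1 \<noteq> 0" unfolding d using e by simp
      then show "complex_of_real (1 + e / 2) \<noteq> 1 \<and> dist (complex_of_real (1 + e / 2)) 1 < e"
        unfolding d dist_eq_0_iff using e by simp
      show "complex_of_real (1 + e / 2) \<in> complex_of_real ` {0<..}"
        using e by (intro imageI) simp
    qed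
  qed
  show ?thesis
  proof -
    have sub: "complex_of_real ` {0<..} \<subseteq> S" by (rule image_subsetI) (simp only: S(3) greaterThan_iff)
    have one: "1 \<in> S" using S(3)[of 1] by (simp only: of_real_1 zero_less_one)
    have "f w = 0" if "w \<in> complex_of_real ` {0<..}" for w
    proof -
      from that obtain t where "w = of_real t" "t \<in> {0<..}" by (rule imageE)
      then show ?thesis by (simp only: zero greaterThan_iff)
    qed
    from analytic_continuation[OF hol S(1,2) sub one islim this z] show ?thesis .
  qed
qed

text \<open>The functions \<open>p, q, r, s\<close> are the entries \<open>H\<^sub>1\<^sub>1, H\<^sub>1\<^sub>2, H\<^sub>2\<^sub>1, H\<^sub>2\<^sub>2\<close>.\<close>

definition nrm :: "real \<Rightarrow> real \<Rightarrow> real \<Rightarrow> complex set \<Rightarrow> (complex \<Rightarrow> complex) \<Rightarrow> (complex \<Rightarrow> complex) \<Rightarrow>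
    (complex \<Rightarrow> complex) \<Rightarrow> (complex \<Rightarrow> complex) \<Rightarrow> bool" where
  "nrm \<omega> l \<mu> S p q r s \<longleftrightarrow>
    (\<forall>z\<in>S. (p has_field_derivative 1 / (2 * \<i> * of_real \<omega> * z) * r z) (at z)) \<and>
    (\<forall>z\<in>S. (q has_field_derivative dd l \<mu> z * q z + 1 / (2 * \<i> * of_real \<omega> * z) * s z) (at z)) \<and>
    (\<forall>z\<in>S. (r has_field_derivative 1 / (2 * \<i> * of_real \<omega> * z) * p z - dd l \<mu> z * r z) (at z)) \<and>
    (\<forall>z\<in>S. (s has_field_derivative 1 / (2 * \<i> * of_real \<omega> * z) * q z) (at z)) \<and>
    continuous_on (closure S) p \<and> continuous_on (closure S) q \<and>
    continuous_on (closure S) r \<and> continuous_on (closure S) s \<and>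
    p 0 = 1 \<and> q 0 = 0 \<and> r 0 = 0 \<and> s 0 = 1"

lemma nrmD:
  assumes "nrm \<omega> l \<mu> S p q r s"
  shows "\<And>z. z \<in> S \<Longrightarrow> (p has_field_derivative 1 / (2 * \<i> * of_real \<omega> * z) * r z) (at z)"
    "\<And>z. z \<in> S \<Longrightarrow> (q has_field_derivative dd l \<mu> z * q z + 1 / (2 * \<i> * of_real \<omega> * z) * s z) (at z)"
    "\<And>z. z \<in> S \<Longrightarrow> (r has_field_derivative 1 / (2 * \<i> * of_real \<omega> * z) * p z - dd l \<mu> z * r z) (at z)"
    "\<And>z. z \<in> S \<Longrightarrow> (s has_field_derivative 1 / (2 * \<i> * of_real \<omega> * z) * q z) (at z)"
    "continuous_on (closure S) p" "continuous_on (closure S) q"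
    "continuous_on (closure S) r" "continuous_on (closure S) s"
    "p 0 = 1" "q 0 = 0" "r 0 = 0" "s 0 = 1"
  using assms unfolding nrm_def by blast+

lemma nrm_subset:
  assumes "nrm \<omega> l \<mu> S p q r s" "T \<subseteq> S"
  shows "nrm \<omega> l \<mu> T p q r s"
proof -
  note cl = continuous_on_subset[OF _ closure_mono[OF assms(2)]]
  show ?thesis
    unfolding nrm_def using assms(2) nrmD[OF assms(1)] by (intro conjI ballI cl) (erule (1) subsetD | blast)+
qed

lemma constant_by_derivative:
  assumes S: "open S" "connected S" "0 \<in> closure S"
    and f: "\<And>z. z \<in> S \<Longrightarrow> (f has_field_derivative 0) (at z)"
    and cont: "continuous_on (closure S) f" and z: "z \<in> closure S"
  shows "f z = f 0"
proof -
  obtain w where w: "w \<in> S" using S(3) closure_empty by fastforce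
  define C where "C = f w"
  have C: "f z = C" if "z \<in> S" for z
    unfolding C_def
    by (rule has_derivative_zero_unique_connected[OF S(1,2) _ that w])
      (use f in \<open>simp add: has_field_derivative_def lambda_zero\<close>)
  have "f z = C" if "z \<in> closure S" for z
    by (rule continuous_constant_on_closure[OF cont C that])
  from this[OF z] this[OF S(3)] show ?thesis by simp
qed

text \<open>The entries of \<open>H\<inverse> H'\<close> for two normalizing transformations.\<close>

lemma nrm_transition:
  assumes S: "open S" "connected S" "0 \<in> closure S"
    and H: "nrm \<omega> l \<mu> S p q r s" and H': "nrm \<omega> l \<mu> S p' q' r' s'"
  shows "\<And>z. z \<in> closure S \<Longrightarrow> s z * p' z - q z * r' z = 1"
    "\<And>z. z \<in> closure S \<Longrightarrow> p z * s' z - r z * q' z = 1"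
    "\<And>z. z \<in> S \<Longrightarrow> ((\<lambda>z. s z * q' z - q z * s' z) has_field_derivative dd l \<mu> z * (s z * q' z - q z * s' z)) (at z)"
    "\<And>z. z \<in> S \<Longrightarrow> ((\<lambda>z. p z * r' z - r z * p' z) has_field_derivative - dd l \<mu> z * (p z * r' z - r z * p' z)) (at z)"
    "continuous_on (closure S) (\<lambda>z. s z * q' z - q z * s' z)"
    "continuous_on (closure S) (\<lambda>z. p z * r' z - r z * p' z)"
proof -
  note D = nrmD(1-4)[OF H] nrmD(1-4)[OF H']
  note C = nrmD(5-8)[OF H] nrmD(5-8)[OF H']
  note I = nrmD(9-12)[OF H] nrmD(9-12)[OF H']
  \<comment> \<open>The transition matrix K satisfies K' = D K - K D, so its diagonal is constant
    and equals 1 by continuity at the vertex. Applied to twice the same transformation, the identity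
    says that the determinant is 1.\<close>
  show "s z * p' z - q z * r' z = 1" if "z \<in> closure S" for z
  proof -
    have "s z * p' z - q z * r' z = s 0 * p' 0 - q 0 * r' 0"
    proof (rule constant_by_derivative[OF S _ _ that])
      show "((\<lambda>z. s z * p' z - q z * r' z) has_field_derivative 0) (at z)" if "z \<in> S" for z
        by (rule derivative_eq_intros D that refl)+ (simp add: algebra_simps)
    qed (intro continuous_intros C)
    then show ?thesis using I by simp
  qed
  show "p z * s' z - r z * q' z = 1" if "z \<in> closure S" for z
  proof -
    have "p z * s' z - r z * q' z = p 0 * s' 0 - r 0 * q' 0"
    proof (rule constant_by_derivative[OF S _ _ that])
      show "((\<lambda>z. p z * s' z - r z * q' z) has_field_derivative 0) (at z)" if "z \<in> S" for z
        by (rule derivative_eq_intros D that refl)+ (simp add: algebra_simps)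
    qed (intro continuous_intros C)
    then show ?thesis using I by simp
  qed
  show "((\<lambda>z. s z * q' z - q z * s' z) has_field_derivative dd l \<mu> z * (s z * q' z - q z * s' z)) (at z)" if "z \<in> S" for z
    by (rule derivative_eq_intros D that refl)+ (simp add: algebra_simps)
  show "((\<lambda>z. p z * r' z - r z * p' z) has_field_derivative - dd l \<mu> z * (p z * r' z - r z * p' z)) (at z)" if "z \<in> S" for z
    by (rule derivative_eq_intros D that refl)+ (simp add: algebra_simps)
  show "continuous_on (closure S) (\<lambda>z. s z * q' z - q z * s' z)" by (intro continuous_intros C)
  show "continuous_on (closure S) (\<lambda>z. p z * r' z - r z * p' z)" by (intro continuous_intros C)
qed

lemma tendsto_along_ray:
  fixes f :: "complex \<Rightarrow> complex"
  assumes cont: "continuous_on (closure S) f" and ray: "\<And>t. t > 0 \<Longrightarrow> of_real t * w \<in> S"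
  shows "((\<lambda>t. f (of_real t * w)) \<longlongrightarrow> f 0) (at_right 0)"
proof -
  have "(f \<longlongrightarrow> f 0) (at 0 within closure S)"
    using cont zero_in_closure_if_positive_reals[OF ray] unfolding continuous_on_def by blast
  show ?thesis
  proof (rule continuous_on_tendsto_compose[OF cont])
    show "((\<lambda>t. of_real t * w) \<longlongrightarrow> 0) (at_right 0)"
      by (auto intro!: tendsto_eq_intros)
    show "0 \<in> closure S" by (rule zero_in_closure_if_positive_reals[OF ray])
    show "\<forall>\<^sub>F t in at_right 0. of_real t * w \<in> closure S"
      using eventually_at_right_less[of 0] by eventually_elim (use ray closure_subset in blast)
  qed
qed

text \<open>The upper right entry of the transition matrix solves the equation that is dominant at
  0+, and it vanishes at the vertex.\<close>

lemma nrm_transition_right: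
  assumes S: "open S" "connected S" and pos: "\<And>t. t > 0 \<Longrightarrow> of_real t \<in> S" and mu: "\<mu> > 0"
    and H: "nrm \<omega> l \<mu> S p q r s" and H': "nrm \<omega> l \<mu> S p' q' r' s'" and z: "z \<in> S"
  shows "s z * q' z - q z * s' z = 0"
proof -
  have cl: "0 \<in> closure S" using zero_in_closure_if_positive_reals[of 1 S] pos by simp
  note T = nrm_transition[OF S cl H H']
  show ?thesis
  proof (rule dominant_solution_zero[OF S pos mu T(3) _ z])
    show "((\<lambda>t. s (of_real t) * q' (of_real t) - q (of_real t) * s' (of_real t)) \<longlongrightarrow> 0) (at_right 0)"
      using tendsto_along_ray[OF T(5), of 1] pos nrmD(9-12)[OF H] nrmD(9-12)[OF H'] by simp
  qed
qed

text \<open>Under z -> - z the lower left entry satisfies the dominant equation with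
  \<open>- l\<close> in place of \<open>l\<close>, and the negative half-line becomes the positive
  one.\<close>

lemma nrm_transition_left:
  assumes S: "open S" "connected S" and neg: "\<And>t. t > 0 \<Longrightarrow> - of_real t \<in> S" and mu: "\<mu> > 0"
    and H: "nrm \<omega> l \<mu> S p q r s" and H': "nrm \<omega> l \<mu> S p' q' r' s'" and z: "z \<in> S"
  shows "p z * r' z - r z * p' z = 0"
proof -
  have cl: "0 \<in> closure S" using zero_in_closure_if_positive_reals[of "-1" S] neg by simp
  note T = nrm_transition[OF S cl H H']
  define f where "f w = p (- w) * r' (- w) - r (- w) * p' (- w)" for w
  have "f (- z) = 0"
  proof (rule dominant_solution_zero[of "uminus ` S" \<mu> f "- l"])
    show "open (uminus ` S)" using S(1) by (rule open_negations)
    show "connected (uminus ` S)" using S(2) by (intro connected_continuous_image continuous_intros)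
    show "of_real t \<in> uminus ` S" if "t > 0" for t
      using neg[OF that] by (intro image_eqI[of _ _ "- of_real t"]) auto
    show "(f has_field_derivative dd (- l) \<mu> w * f w) (at w)" if "w \<in> uminus ` S" for w
    proof -
      have "- w \<in> S" using that by auto
      have "(uminus has_field_derivative (-1 :: complex)) (at w)"
        by (auto intro!: derivative_eq_intros)
      from DERIV_chain2[where g = uminus, OF T(4)[OF \<open>- w \<in> S\<close>] this]
      have "(f has_field_derivative - dd l \<mu> (- w) * f w * - 1) (at w)"
        unfolding f_def[abs_def] .
      then show ?thesis by (simp add: dd_def algebra_simps)
    qed
    show "((\<lambda>t. f (of_real t)) \<longlongrightarrow> 0) (at_right 0)"
      using tendsto_along_ray[OF T(6), of "-1"] neg nrmD(9-12)[OF H] nrmD(9-12)[OF H'] by (simp add: f_def)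
  qed (use mu z in auto)
  then show ?thesis by (simp add: f_def)
qed

lemma matrix_eq_of_transition:
  fixes p q r s p' q' r' s' :: complex
  assumes "s * p' - q * r' = 1" "p * s' - r * q' = 1" "p * s - r * q = 1"
  shows "s * q' - q * s' = 0 \<Longrightarrow> q' = q \<and> s' = s" "p * r' - r * p' = 0 \<Longrightarrow> p' = p \<and> r' = r"
proof -
  show "q' = q \<and> s' = s" if 0: "s * q' - q * s' = 0"
  proof
    have "q' = (p * s - r * q) * q' - p * (s * q' - q * s')" using assms(3) 0 by simp
    also have "\<dots> = q * (p * s' - r * q')" by (simp add: algebra_simps)
    finally show "q' = q" using assms(2) by simp
    have "s' = (p * s - r * q) * s' - r * (s * q' - q * s')" using assms(3) 0 by simp
    also have "\<dots> = s * (p * s' - r * q')" by (simp add: algebra_simps)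
    finally show "s' = s" using assms(2) by simp
  qed
  show "p' = p \<and> r' = r" if 0: "p * r' - r * p' = 0"
  proof
    have "p' = (p * s - r * q) * p' - q * (p * r' - r * p')" using assms(3) 0 by simp
    also have "\<dots> = p * (s * p' - q * r')" by (simp add: algebra_simps)
    finally show "p' = p" using assms(1) by simp
    have "r' = (p * s - r * q) * r' - s * (p * r' - r * p')" using assms(3) 0 by simp
    also have "\<dots> = r * (s * p' - q * r')" by (simp add: algebra_simps)
    finally show "r' = r" using assms(1) by simp
  qed
qed

text \<open>A region with both real half-lines kills both off-diagonal entries of the transition
  matrix. An overlap of the two sectors contains only one half-line, and the entry that survives
  there carries the Stokes multiplier.\<close>

lemma nrm_unique:
  assumes S: "open S" "connected S" "\<And>t. t > 0 \<Longrightarrow> of_real t \<in> S" "\<And>t. t > 0 \<Longrightarrow> - of_real t \<in> S" and mu: "\<mu> > 0"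
    and H: "nrm \<omega> l \<mu> S p q r s" and H': "nrm \<omega> l \<mu> S p' q' r' s'" and z: "z \<in> S"
  shows "p' z = p z \<and> q' z = q z \<and> r' z = r z \<and> s' z = s z"
proof -
  have cl: "0 \<in> closure S" using zero_in_closure_if_positive_reals[of 1 S] S(3) by simp
  have zc: "z \<in> closure S" using z closure_subset by blast
  note m = matrix_eq_of_transition[OF nrm_transition(1,2)[OF S(1,2) cl H H' zc] nrm_transition(2)[OF S(1,2) cl H H zc]]
  show ?thesis
    using m(1)[OF nrm_transition_right[OF S(1,2,3) mu H H' z]] m(2)[OF nrm_transition_left[OF S(1,2,4) mu H H' z]]
    by blast
qed

section \<open>Construction of normalizing transformations from scalar solutions\<close>

definition sfam :: "complex set \<Rightarrow> complex set \<Rightarrow> (nat \<Rightarrow> complex \<Rightarrow> complex) \<Rightarrow> bool" where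
  "sfam \<Omega> \<Gamma> F \<longleftrightarrow> (\<forall>n. continuous_on \<Gamma> (F n)) \<and>
     (\<forall>n. \<forall>z\<in>\<Omega>. (F n has_field_derivative F (Suc n) z) (at z))"

text \<open>Derivatives are carried along as an explicit family, which passes easily through
  conjugation and reflection. Here they are identified with the iterated \<open>deriv\<close>
  demanded by \<open>normalizing\<close>.\<close>

lemma higher_deriv_sfam:
  assumes "open \<Omega>" "sfam \<Omega> \<Gamma> F" "z \<in> \<Omega>"
  shows "(deriv ^^ k) (F 0) z = F k z"
  using assms(3)
proof (induction k arbitrary: z)
  case (Suc k)
  have "(F k has_field_derivative F (Suc k) z) (at z)"
    using assms(2) Suc.prems unfolding sfam_def by blast
  then have "((deriv ^^ k) (F 0) has_field_derivative F (Suc k) z) (at z)"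
    by (rule has_field_derivative_transform_within_open[OF _ assms(1) Suc.prems]) (simp add: Suc.IH)
  then show ?case by (simp add: DERIV_imp_deriv)
qed simp

lemma sfam_cnj:
  assumes "sfam \<Omega> \<Gamma> F"
  shows "sfam {z. cnj z \<in> \<Omega>} {z. cnj z \<in> \<Gamma>} (\<lambda>n z. cnj (F n (cnj z)))"
  unfolding sfam_def
proof (intro conjI allI ballI)
  fix n
  have "continuous_on \<Gamma> (F n)" using assms by (simp add: sfam_def)
  then have "continuous_on {z. cnj z \<in> \<Gamma>} (\<lambda>z. F n (cnj z))"
    by (rule continuous_on_compose2) (auto intro: continuous_on_cnj continuous_on_id)
  then show "continuous_on {z. cnj z \<in> \<Gamma>} (\<lambda>z. cnj (F n (cnj z)))"
    by (rule continuous_on_cnj)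
  fix z assume "z \<in> {z. cnj z \<in> \<Omega>}"
  then have "(F n has_field_derivative F (Suc n) (cnj z)) (at (cnj z))"
    using assms by (simp add: sfam_def)
  then show "((\<lambda>z. cnj (F n (cnj z))) has_field_derivative cnj (F (Suc n) (cnj z))) (at z)"
    using has_field_derivative_cnj_cnj[of "F n" "F (Suc n) (cnj z)" z] by (simp add: o_def)
qed

lemma sfam_uminus:
  assumes "sfam \<Omega> \<Gamma> F"
  shows "sfam {z. - z \<in> \<Omega>} {z. - z \<in> \<Gamma>} (\<lambda>n z. (- 1) ^ n * F n (- z))"
  unfolding sfam_def
proof (intro conjI allI ballI)
  fix n
  have "continuous_on \<Gamma> (F n)" using assms by (simp add: sfam_def)
  then have "continuous_on {z. - z \<in> \<Gamma>} (\<lambda>z. F n (- z))"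
    by (rule continuous_on_compose2) (auto intro: continuous_on_minus continuous_on_id)
  then show "continuous_on {z. - z \<in> \<Gamma>} (\<lambda>z. (- 1) ^ n * F n (- z))"
    by (rule continuous_on_mult_left)
  fix z assume "z \<in> {z. - z \<in> \<Omega>}"
  then have "(F n has_field_derivative F (Suc n) (- z)) (at (- z))"
    using assms by (simp add: sfam_def)
  moreover have "(uminus has_field_derivative (- 1 :: complex)) (at z)"
    by (auto intro!: derivative_eq_intros)
  ultimately have "((\<lambda>z. F n (- z)) has_field_derivative F (Suc n) (- z) * - 1) (at z)"
    by (rule DERIV_chain2)
  from DERIV_cmult[OF this, of "(- 1) ^ n"]
  show "((\<lambda>z. (- 1) ^ n * F n (- z)) has_field_derivative (- 1) ^ Suc n * F (Suc n) (- z)) (at z)"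
    by simp
qed

text \<open>By Leibniz these are the successive derivatives of a z F'(z), the shape of the
  off-diagonal entries of H.\<close>

lemma sfam_times_deriv:
  assumes "sfam \<Omega> \<Gamma> F"
  shows "sfam \<Omega> \<Gamma> (\<lambda>n z. a * (z * F (Suc n) z + of_nat n * F n z))"
  unfolding sfam_def
proof (intro conjI allI ballI)
  fix n
  have c: "continuous_on \<Gamma> (F n)" "continuous_on \<Gamma> (F (Suc n))" using assms by (simp_all add: sfam_def)
  then show "continuous_on \<Gamma> (\<lambda>z. a * (z * F (Suc n) z + of_nat n * F n z))"
    by (intro continuous_intros)
  fix z assume "z \<in> \<Omega>"
  then have d: "(F n has_field_derivative F (Suc n) z) (at z)"
    "(F (Suc n) has_field_derivative F (Suc (Suc n)) z) (at z)"
    using assms by (simp_all add: sfam_def)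
  show "((\<lambda>z. a * (z * F (Suc n) z + of_nat n * F n z)) has_field_derivative
      a * (z * F (Suc (Suc n)) z + of_nat (Suc n) * F (Suc n) z)) (at z)"
    by (rule derivative_eq_intros d refl)+ (simp add: algebra_simps)
qed

lemma mat2_nth [simp]:
  "mat2 a b c d $ 1 $ 1 = a" "mat2 a b c d $ 1 $ 2 = b" "mat2 a b c d $ 2 $ 1 = c" "mat2 a b c d $ 2 $ 2 = d"
  by (simp_all add: mat2_def)

lemma mat2_mult_nth:
  fixes X Y :: "complex^2^2"
  shows "(X ** Y) $ i $ j = X $ i $ 1 * Y $ 1 $ j + X $ i $ 2 * Y $ 2 $ j"
  by (simp add: matrix_matrix_mult_def UNIV_2)

lemma sysL_nth:
  assumes "z \<noteq> 0"
  shows "sysL \<omega> l \<mu> z $ 1 $ 1 = dd l \<mu> z" "sysL \<omega> l \<mu> z $ 1 $ 2 = 1 / (2 * \<i> * of_real \<omega> * z)"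
    "sysL \<omega> l \<mu> z $ 2 $ 1 = 1 / (2 * \<i> * of_real \<omega> * z)" "sysL \<omega> l \<mu> z $ 2 $ 2 = 0"
    "sysD l \<mu> z $ 1 $ 1 = dd l \<mu> z" "sysD l \<mu> z $ 1 $ 2 = 0" "sysD l \<mu> z $ 2 $ 1 = 0" "sysD l \<mu> z $ 2 $ 2 = 0"
  using assms by (simp_all add: sysL_def sysD_def dd_def field_simps power2_eq_square)

lemma gauge_nth:
  fixes H :: "complex^2^2"
  assumes "z \<noteq> 0"
  shows "(sysL \<omega> l \<mu> z ** H - H ** sysD l \<mu> z) $ 1 $ 1 = 1 / (2 * \<i> * of_real \<omega> * z) * H $ 2 $ 1"
    "(sysL \<omega> l \<mu> z ** H - H ** sysD l \<mu> z) $ 1 $ 2 = dd l \<mu> z * H $ 1 $ 2 + 1 / (2 * \<i> * of_real \<omega> * z) * H $ 2 $ 2"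
    "(sysL \<omega> l \<mu> z ** H - H ** sysD l \<mu> z) $ 2 $ 1 = 1 / (2 * \<i> * of_real \<omega> * z) * H $ 1 $ 1 - dd l \<mu> z * H $ 2 $ 1"
    "(sysL \<omega> l \<mu> z ** H - H ** sysD l \<mu> z) $ 2 $ 2 = 1 / (2 * \<i> * of_real \<omega> * z) * H $ 1 $ 2"
  by (simp_all add: mat2_mult_nth sysL_nth[OF assms])

lemma normalizing_imp_nrm:
  fixes H :: "complex \<Rightarrow> complex^2^2"
  assumes H: "normalizing \<omega> l \<mu> S H" and S: "0 \<notin> S"
  shows "nrm \<omega> l \<mu> S (\<lambda>z. H z $ 1 $ 1) (\<lambda>z. H z $ 1 $ 2) (\<lambda>z. H z $ 2 $ 1) (\<lambda>z. H z $ 2 $ 2)"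
proof -
  have nz: "z \<noteq> 0" if "z \<in> S" for z using that S by auto
  have D: "((\<lambda>w. H w $ i $ j) has_field_derivative
          ((sysL \<omega> l \<mu> z ** H z - H z ** sysD l \<mu> z) $ i $ j)) (at z)" if "z \<in> S" for z i j
    using H that unfolding normalizing_def by blast
  note D' = D[of _ 1 1] D[of _ 1 2] D[of _ 2 1] D[of _ 2 2]
  have "continuous_on (closure S) H" using H unfolding normalizing_def by blast
  then have C: "continuous_on (closure S) (\<lambda>z. H z $ i $ j)" for i j
    by (intro bounded_linear.continuous_on[OF bounded_linear_vec_nth])
  have "H 0 = Finite_Cartesian_Product.mat 1" using H unfolding normalizing_def by blast
  then have H0: "H 0 $ 1 $ 1 = 1" "H 0 $ 1 $ 2 = 0" "H 0 $ 2 $ 1 = 0" "H 0 $ 2 $ 2 = 1"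
    by (simp_all add: Finite_Cartesian_Product.mat_def)
  have "((\<lambda>z. H z $ 1 $ 1) has_field_derivative 1 / (2 * \<i> * of_real \<omega> * z) * H z $ 2 $ 1) (at z)"
    "((\<lambda>z. H z $ 1 $ 2) has_field_derivative dd l \<mu> z * H z $ 1 $ 2 + 1 / (2 * \<i> * of_real \<omega> * z) * H z $ 2 $ 2) (at z)"
    "((\<lambda>z. H z $ 2 $ 1) has_field_derivative 1 / (2 * \<i> * of_real \<omega> * z) * H z $ 1 $ 1 - dd l \<mu> z * H z $ 2 $ 1) (at z)"
    "((\<lambda>z. H z $ 2 $ 2) has_field_derivative 1 / (2 * \<i> * of_real \<omega> * z) * H z $ 1 $ 2) (at z)" if "z \<in> S" for z
    using D'[OF that] unfolding gauge_nth[OF nz[OF that]] by this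
  then show ?thesis unfolding nrm_def using H0 C by blast
qed

text \<open>The diagonal determines the matrix: the equations for p' and s' express r and q as 2 i
  \<omega> z p' and 2 i \<omega> z s', and the other two equations become the second order ones for
  \<open>Y\<close> = p and \<open>V\<close> = s. Invertibility follows from determinant 1.\<close>

lemma normalizing_of_solutions:
  fixes V Y :: "nat \<Rightarrow> complex \<Rightarrow> complex"
  assumes \<omega>: "\<omega> > 0" and \<Omega>: "open \<Omega>" "0 \<notin> \<Omega>" and S: "S \<subseteq> \<Omega>" "open S" "connected S" "closure S \<subseteq> \<Gamma>" "0 \<in> closure S"
    and V: "sfam \<Omega> \<Gamma> V" "V 0 0 = 1"
      "\<And>z. z \<in> \<Omega> \<Longrightarrow> z\<^sup>2 * V 2 z + (of_real (1 + l) * z + of_real \<mu> + of_real \<mu> * z\<^sup>2) * V 1 z + of_real (1 / (4 * \<omega>\<^sup>2)) * V 0 z = 0"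
    and Y: "sfam \<Omega> \<Gamma> Y" "Y 0 0 = 1"
      "\<And>z. z \<in> \<Omega> \<Longrightarrow> z\<^sup>2 * Y 2 z + (of_real (1 - l) * z - of_real \<mu> - of_real \<mu> * z\<^sup>2) * Y 1 z + of_real (1 / (4 * \<omega>\<^sup>2)) * Y 0 z = 0"
  shows "\<exists>H. normalizing \<omega> l \<mu> S H"
proof -
  define E where "E i j = (if i = (1::2) then (if j = (1::2) then Y else (\<lambda>n z. 2 * \<i> * of_real \<omega> * (z * V (Suc n) z + of_nat n * V n z)))
      else (if j = 1 then (\<lambda>n z. 2 * \<i> * of_real \<omega> * (z * Y (Suc n) z + of_nat n * Y n z)) else V))" for i j
  have E: "sfam \<Omega> \<Gamma> (E i j)" for i j
    unfolding E_def using V(1) Y(1) sfam_times_deriv by auto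
  define H :: "complex \<Rightarrow> complex^2^2" where "H z = (\<chi> i j. E i j 0 z)" for z
  have H: "H z $ i $ j = E i j 0 z" for z i j by (simp add: H_def)
  have fn: "(\<lambda>z. H z $ i $ j) = E i j 0" for i j by (simp add: H fun_eq_iff)
  have Ev: "E 1 1 0 = Y 0" "E 2 2 0 = V 0" "E 1 2 0 z = 2 * \<i> * of_real \<omega> * z * V 1 z" "E 2 1 0 z = 2 * \<i> * of_real \<omega> * z * Y 1 z" for z
    by (simp_all add: E_def)
  have ED: "(E i j n has_field_derivative E i j (Suc n) z) (at z)" if "z \<in> \<Omega>" for i j n z
    using E that unfolding sfam_def by blast
  have EC: "continuous_on (closure S) (E i j n)" for i j n
    using E S(4) unfolding sfam_def by (blast intro: continuous_on_subset)
  have c: "2 * \<i> * complex_of_real \<omega> * of_real (1 / (4 * \<omega>\<^sup>2)) = - 1 / (2 * \<i> * of_real \<omega>)"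
    using \<omega> by (simp add: field_simps power2_eq_square)
  have ode: "E i j (Suc 0) z = (sysL \<omega> l \<mu> z ** H z - H z ** sysD l \<mu> z) $ i $ j" if z: "z \<in> \<Omega>" for z i j
  proof -
    have z0: "z \<noteq> 0" using z \<Omega>(2) by auto
    have w0: "2 * \<i> * complex_of_real \<omega> \<noteq> 0" using \<omega> by simp
    define a where "a = 2 * \<i> * complex_of_real \<omega>"
    have a0: "a \<noteq> 0" using w0 by (simp add: a_def)
    have ca: "a * of_real (1 / (4 * \<omega>\<^sup>2)) = - 1 / a" using c by (simp add: a_def)
    have ddz: "dd l \<mu> z * z\<^sup>2 = - of_real l * z - of_real \<mu> - of_real \<mu> * z\<^sup>2"
      using z0 by (simp add: dd_def field_simps power2_eq_square)
    have q: "a * (z * V (Suc (Suc 0)) z + V 1 z) = dd l \<mu> z * (a * z * V 1 z) + 1 / (a * z) * V 0 z"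
    proof -
      have "z * (a * (z * V (Suc (Suc 0)) z + V 1 z)) = a * (z\<^sup>2 * V 2 z + z * V 1 z)"
        by (simp add: power2_eq_square numeral_2_eq_2 algebra_simps)
      also have "\<dots> = a * (- ((of_real l * z + of_real \<mu> + of_real \<mu> * z\<^sup>2) * V 1 z)) - (a * of_real (1 / (4 * \<omega>\<^sup>2))) * V 0 z"
        using V(3)[OF z] by (simp add: algebra_simps eq_neg_iff_add_eq_0) Groebner_Basis.algebra
      also have "\<dots> = a * (dd l \<mu> z * z\<^sup>2) * V 1 z + 1 / a * V 0 z"
        unfolding ca ddz by (simp add: algebra_simps)
      also have "\<dots> = z * (dd l \<mu> z * (a * z * V 1 z) + 1 / (a * z) * V 0 z)"
        using z0 a0 by (simp add: field_simps power2_eq_square)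
      finally show ?thesis using z0 by simp
    qed
    have r: "a * (z * Y (Suc (Suc 0)) z + Y 1 z) = 1 / (a * z) * Y 0 z - dd l \<mu> z * (a * z * Y 1 z)"
    proof -
      have "z * (a * (z * Y (Suc (Suc 0)) z + Y 1 z)) = a * (z\<^sup>2 * Y 2 z + z * Y 1 z)"
        by (simp add: power2_eq_square numeral_2_eq_2 algebra_simps)
      also have "\<dots> = a * ((of_real l * z + of_real \<mu> + of_real \<mu> * z\<^sup>2) * Y 1 z) - (a * of_real (1 / (4 * \<omega>\<^sup>2))) * Y 0 z"
        using Y(3)[OF z] by (simp add: algebra_simps eq_neg_iff_add_eq_0) Groebner_Basis.algebra
      also have "\<dots> = 1 / a * Y 0 z - a * (dd l \<mu> z * z\<^sup>2) * Y 1 z"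
        unfolding ca ddz by (simp add: algebra_simps)
      also have "\<dots> = z * (1 / (a * z) * Y 0 z - dd l \<mu> z * (a * z * Y 1 z))"
        using z0 a0 by (simp add: field_simps power2_eq_square)
      finally show ?thesis using z0 by simp
    qed
    have "\<forall>i j. E i j (Suc 0) z = (sysL \<omega> l \<mu> z ** H z - H z ** sysD l \<mu> z) $ i $ j"
      unfolding forall_2 gauge_nth[OF z0] H Ev a_def[symmetric] using q r z0 a0
      by (simp add: E_def a_def[symmetric])
    then show ?thesis by blast
  qed
  have DH: "((\<lambda>w. H w $ i $ j) has_field_derivative ((sysL \<omega> l \<mu> z ** H z - H z ** sysD l \<mu> z) $ i $ j)) (at z)"
    if "z \<in> \<Omega>" for z i j
    unfolding fn ode[OF that, symmetric] by (rule ED[OF that])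
  have Hcont: "continuous_on (closure S) H"
    unfolding H_def[abs_def] by (intro continuous_on_vec_lambda EC[where n = 0])
  have "H 0 = Finite_Cartesian_Product.mat 1"
    by (simp add: vec_eq_iff forall_2 H Ev V(2) Y(2) Finite_Cartesian_Product.mat_def)
  moreover have "Determinants.det (H z) = 1" if "z \<in> closure S" for z
  proof -
    have nrm: "nrm \<omega> l \<mu> S (E 1 1 0) (E 1 2 0) (E 2 1 0) (E 2 2 0)"
    proof -
      have "(E 1 1 0 has_field_derivative 1 / (2 * \<i> * of_real \<omega> * z) * E 2 1 0 z) (at z)"
        "(E 1 2 0 has_field_derivative dd l \<mu> z * E 1 2 0 z + 1 / (2 * \<i> * of_real \<omega> * z) * E 2 2 0 z) (at z)"
        "(E 2 1 0 has_field_derivative 1 / (2 * \<i> * of_real \<omega> * z) * E 1 1 0 z - dd l \<mu> z * E 2 1 0 z) (at z)"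
        "(E 2 2 0 has_field_derivative 1 / (2 * \<i> * of_real \<omega> * z) * E 1 2 0 z) (at z)" if "z \<in> S" for z
      proof -
        have z: "z \<in> \<Omega>" "z \<noteq> 0" using that S(1) \<Omega>(2) by auto
        note DH[OF z(1), unfolded fn]
        note d = this[of 1 1] this[of 1 2] this[of 2 1] this[of 2 2]
        show "(E 1 1 0 has_field_derivative 1 / (2 * \<i> * of_real \<omega> * z) * E 2 1 0 z) (at z)"
          using d(1) unfolding gauge_nth[OF z(2)] H .
        show "(E 1 2 0 has_field_derivative dd l \<mu> z * E 1 2 0 z + 1 / (2 * \<i> * of_real \<omega> * z) * E 2 2 0 z) (at z)"
          using d(2) unfolding gauge_nth[OF z(2)] H .
        show "(E 2 1 0 has_field_derivative 1 / (2 * \<i> * of_real \<omega> * z) * E 1 1 0 z - dd l \<mu> z * E 2 1 0 z) (at z)"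
          using d(3) unfolding gauge_nth[OF z(2)] H .
        show "(E 2 2 0 has_field_derivative 1 / (2 * \<i> * of_real \<omega> * z) * E 1 2 0 z) (at z)"
          using d(4) unfolding gauge_nth[OF z(2)] H .
      qed
      moreover have "E 1 1 0 0 = 1" "E 1 2 0 0 = 0" "E 2 1 0 0 = 0" "E 2 2 0 0 = 1"
        by (simp_all add: Ev V(2) Y(2))
      ultimately show ?thesis unfolding nrm_def using EC by blast
    qed
    from nrm_transition(2)[OF S(2,3,5) this this that] show ?thesis
      by (simp add: Determinants.det_2 H algebra_simps)
  qed
  moreover have "\<exists>g. continuous_on (closure S) g \<and> (\<forall>z\<in>S. g z = (deriv ^^ k) (\<lambda>w. H w $ i $ j) z)" for k i j
  proof (intro exI[of _ "E i j k"] conjI ballI EC)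
    fix z assume "z \<in> S"
    then show "E i j k z = (deriv ^^ k) (\<lambda>w. H w $ i $ j) z"
      unfolding fn using higher_deriv_sfam[OF \<Omega>(1) E, of z k i j] S(1) by auto
  qed
  moreover have "(\<lambda>z. H z $ i $ j) holomorphic_on S" for i j
    unfolding fn holomorphic_on_open[OF S(2)] using ED S(1) by blast
  moreover have "invertible (H z)" if "z \<in> closure S" for z
    unfolding Determinants.invertible_det_nz using \<open>\<And>z. z \<in> closure S \<Longrightarrow> Determinants.det (H z) = 1\<close>[OF that] by simp
  ultimately have "normalizing \<omega> l \<mu> S H"
    unfolding normalizing_def using DH S(1) Hcont by blast
  then show ?thesis by blast
qed

text \<open>An excess of 1 / 4 beyond the half-plane is small enough: there |sin| is at most 1 / 4
  and hence |cos| at least 3 / 4.\<close>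

lemma sector_upper_subset: "sector (- 1 / 4) (pi + 1 / 4) \<subseteq> Gz"
proof
  fix z assume "z \<in> sector (- 1 / 4) (pi + 1 / 4)"
  then obtain r \<theta> where r: "r > 0" and \<theta>: "- 1 / 4 < \<theta>" "\<theta> < pi + 1 / 4" and z: "z = of_real r * cis \<theta>"
    unfolding sector_polar by auto
  have key: "- \<bar>cos \<theta>\<bar> \<le> 3 * sin \<theta>"
  proof (cases "sin \<theta> \<ge> 0")
    case False
    then have "\<theta> < 0 \<or> \<theta> > pi" using sin_ge_zero[of \<theta>] by linarith
    then have "\<bar>sin \<theta>\<bar> \<le> 1 / 4"
    proof
      assume "\<theta> < 0"
      then show ?thesis using abs_sin_x_le_abs_x[of \<theta>] \<theta> by linarith
    next
      assume "\<theta> > pi"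
      then have "\<bar>sin (\<theta> - pi)\<bar> \<le> 1 / 4" using abs_sin_x_le_abs_x[of "\<theta> - pi"] \<theta> by linarith
      then show ?thesis by (simp add: sin_diff)
    qed
    then have "\<bar>sin \<theta>\<bar>\<^sup>2 \<le> (1 / 4)\<^sup>2" by (intro power_mono) auto
    then have "(sin \<theta>)\<^sup>2 \<le> 1 / 16" by (simp add: power2_eq_square)
    then have "(3 / 4)\<^sup>2 \<le> \<bar>cos \<theta>\<bar>\<^sup>2"
      using sin_cos_squared_add[of \<theta>] by (simp add: power2_eq_square)
    then have "3 / 4 \<le> \<bar>cos \<theta>\<bar>" by (rule power2_le_imp_le) simp
    then show ?thesis using \<open>\<bar>sin \<theta>\<bar> \<le> 1 / 4\<close> by linarith
  qed linarith
  have "r * - \<bar>cos \<theta>\<bar> \<le> r * (3 * sin \<theta>)" using r by (intro mult_left_mono key) simp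
  then show "z \<in> Gz" using r by (simp add: Gz_def z abs_mult)
qed

lemma sector_lower_cnj:
  assumes "z \<in> sector (- pi - 1 / 4) (1 / 4)"
  shows "cnj z \<in> sector (- 1 / 4) (pi + 1 / 4)"
proof -
  obtain r \<theta> where "r > 0" "- pi - 1 / 4 < \<theta>" "\<theta> < 1 / 4" "z = of_real r * cis \<theta>"
    using assms unfolding sector_polar by auto
  then show ?thesis
    using polar_in_sector[of r "- 1 / 4" "- \<theta>" "pi + 1 / 4"] by (simp add: cis_cnj)
qed

text \<open>Two solutions on the upper domain suffice, \<open>F\<close> for l and \<open>G\<close>
  for - l. Conjugation carries them to the lower domain. Reflection exchanges the domains and flips
  the sign of \<mu>, as the first column requires; on the upper sector that column therefore uses
  both symmetries at once.\<close>

theorem normalizing_exists: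
  assumes \<omega>: "\<omega> > 0" and \<mu>: "\<mu> > 0"
  shows "\<exists>H. normalizing \<omega> l \<mu> (sector (- 1 / 4) (pi + 1 / 4)) H"
    and "\<exists>H. normalizing \<omega> l \<mu> (sector (- pi - 1 / 4) (1 / 4)) H"
proof -
  define c where "c = 1 / (4 * \<omega>\<^sup>2)"
  obtain F where F: "\<And>n. continuous_on Gz (F n)"
    "\<And>n z. z \<in> Oz \<Longrightarrow> (F n has_field_derivative F (Suc n) z) (at z)" "F 0 0 = 1"
    "\<And>z. z \<in> Oz \<Longrightarrow> z\<^sup>2 * F 2 z + (of_real (1 + l) * z + of_real \<mu> + of_real \<mu> * z\<^sup>2) * F 1 z + of_real c * F 0 z = 0"
    using smooth_solution[OF \<mu>, of "1 + l" c] by blast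
  obtain G where G: "\<And>n. continuous_on Gz (G n)"
    "\<And>n z. z \<in> Oz \<Longrightarrow> (G n has_field_derivative G (Suc n) z) (at z)" "G 0 0 = 1"
    "\<And>z. z \<in> Oz \<Longrightarrow> z\<^sup>2 * G 2 z + (of_real (1 - l) * z + of_real \<mu> + of_real \<mu> * z\<^sup>2) * G 1 z + of_real c * G 0 z = 0"
    using smooth_solution[OF \<mu>, of "1 - l" c] by blast
  have sF: "sfam Oz Gz F" and sG: "sfam Oz Gz G" using F G by (auto simp: sfam_def)
  define Fc where "Fc n z = cnj (F n (cnj z))" for n z
  define Gc where "Gc n z = cnj (G n (cnj z))" for n z
  have sFc: "sfam {z. cnj z \<in> Oz} {z. cnj z \<in> Gz} Fc" unfolding Fc_def by (rule sfam_cnj[OF sF])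
  have sGc: "sfam {z. cnj z \<in> Oz} {z. cnj z \<in> Gz} Gc" unfolding Gc_def by (rule sfam_cnj[OF sG])
  have sets: "{z. cnj (- z) \<in> Oz} = Oz" "{z. cnj (- z) \<in> Gz} = Gz" "{z. - z \<in> Oz} = {z. cnj z \<in> Oz}" "{z. - z \<in> Gz} = {z. cnj z \<in> Gz}"
    by (auto simp: Oz_def Gz_def)
  have Fc4: "z\<^sup>2 * Fc 2 z + (of_real (1 + l) * z + of_real \<mu> + of_real \<mu> * z\<^sup>2) * Fc 1 z + of_real c * Fc 0 z = 0" if "cnj z \<in> Oz" for z
    using arg_cong[OF F(4)[OF that], of cnj] by (simp add: Fc_def)
  have Gc4: "z\<^sup>2 * Gc 2 z + (of_real (1 - l) * z + of_real \<mu> + of_real \<mu> * z\<^sup>2) * Gc 1 z + of_real c * Gc 0 z = 0" if "cnj z \<in> Oz" for z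
    using arg_cong[OF G(4)[OF that], of cnj] by (simp add: Gc_def)
  have refl: "z\<^sup>2 * ((- 1)\<^sup>2 * K 2 (- z)) + (of_real (1 - l) * z - of_real \<mu> - of_real \<mu> * z\<^sup>2) * ((- 1) ^ 1 * K 1 (- z)) + of_real c * ((- 1) ^ 0 * K 0 (- z)) = 0"
    if "(- z)\<^sup>2 * K 2 (- z) + (of_real (1 - l) * (- z) + of_real \<mu> + of_real \<mu> * (- z)\<^sup>2) * K 1 (- z) + of_real c * K 0 (- z) = 0"
    for K :: "nat \<Rightarrow> complex \<Rightarrow> complex" and z
    using that by (simp add: algebra_simps)
  have oc: "open {z. cnj z \<in> Oz}"
    using continuous_open_preimage[OF _ open_UNIV open_Oz, of cnj] by (simp add: vimage_def continuous_on_cnj)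
  have cc: "closed {z. cnj z \<in> Gz}"
    using continuous_closed_preimage[OF _ closed_UNIV closed_Gz, of cnj] by (simp add: vimage_def continuous_on_cnj)
  have pos: "of_real t \<in> sector (- 1 / 4) (pi + 1 / 4)" "of_real t \<in> sector (- pi - 1 / 4) (1 / 4)" if "t > 0" for t
    by (rule positive_reals_in_sector[OF _ _ that]; use pi_gt_zero in linarith)+
  have cl0: "0 \<in> closure (sector (- 1 / 4) (pi + 1 / 4))" "0 \<in> closure (sector (- pi - 1 / 4) (1 / 4))"
    by (rule zero_in_closure_if_positive_reals[of 1]; simp only: mult_1_right pos)+
  have upper: "sector (- 1 / 4) (pi + 1 / 4) \<subseteq> Oz"
  proof
    fix z assume z: "z \<in> sector (- 1 / 4) (pi + 1 / 4)"
    then have "z \<noteq> 0" using zero_notin_sector by metis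
    with subsetD[OF sector_upper_subset z] show "z \<in> Oz" by (rule Gz_minus_0)
  qed
  have lower: "sector (- pi - 1 / 4) (1 / 4) \<subseteq> {z. cnj z \<in> Oz}"
    by (rule subsetI, rule CollectI, rule subsetD[OF upper], rule sector_lower_cnj)
  have lowerG: "sector (- pi - 1 / 4) (1 / 4) \<subseteq> {z. cnj z \<in> Gz}"
    by (rule subsetI, rule CollectI, rule subsetD[OF sector_upper_subset], rule sector_lower_cnj)
  show "\<exists>H. normalizing \<omega> l \<mu> (sector (- 1 / 4) (pi + 1 / 4)) H"
  proof (rule normalizing_of_solutions[OF \<omega> open_Oz _ upper open_sector connected_sector _ cl0(1) sF])
    show "closure (sector (- 1 / 4) (pi + 1 / 4)) \<subseteq> Gz"
      by (rule closure_minimal[OF sector_upper_subset closed_Gz])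
    show "sfam Oz Gz (\<lambda>n z. (- 1) ^ n * Gc n (- z))"
      using sfam_uminus[OF sGc] by (simp only: mem_Collect_eq sets)
    show "z\<^sup>2 * ((- 1)\<^sup>2 * Gc 2 (- z)) + (of_real (1 - l) * z - of_real \<mu> - of_real \<mu> * z\<^sup>2) * ((- 1) ^ 1 * Gc 1 (- z))
       + of_real (1 / (4 * \<omega>\<^sup>2)) * ((- 1) ^ 0 * Gc 0 (- z)) = 0" if "z \<in> Oz" for z
      unfolding c_def[symmetric] by (rule refl, rule Gc4) (use that sets(1) in \<open>simp add: set_eq_iff\<close>)
    show "0 \<notin> Oz" using zero_notin_Oz by blast
    show "F 0 0 = 1" by (rule F(3))
    show "(- 1) ^ 0 * Gc 0 (- 0) = 1" by (simp add: Gc_def G(3))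
    show "z\<^sup>2 * F 2 z + (of_real (1 + l) * z + of_real \<mu> + of_real \<mu> * z\<^sup>2) * F 1 z + of_real (1 / (4 * \<omega>\<^sup>2)) * F 0 z = 0"
      if "z \<in> Oz" for z
      unfolding c_def[symmetric] by (rule F(4)[OF that])
  qed
  show "\<exists>H. normalizing \<omega> l \<mu> (sector (- pi - 1 / 4) (1 / 4)) H"
  proof (rule normalizing_of_solutions[OF \<omega> oc _ lower open_sector connected_sector _ cl0(2) sFc])
    show "closure (sector (- pi - 1 / 4) (1 / 4)) \<subseteq> {z. cnj z \<in> Gz}"
      by (rule closure_minimal[OF lowerG cc])
    show "sfam {z. cnj z \<in> Oz} {z. cnj z \<in> Gz} (\<lambda>n z. (- 1) ^ n * G n (- z))"
      using sfam_uminus[OF sG] by (simp only: mem_Collect_eq sets)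
    show "z\<^sup>2 * ((- 1)\<^sup>2 * G 2 (- z)) + (of_real (1 - l) * z - of_real \<mu> - of_real \<mu> * z\<^sup>2) * ((- 1) ^ 1 * G 1 (- z))
       + of_real (1 / (4 * \<omega>\<^sup>2)) * ((- 1) ^ 0 * G 0 (- z)) = 0" if "z \<in> {z. cnj z \<in> Oz}" for z
      unfolding c_def[symmetric] by (rule refl, rule G(4)) (use that sets(3) in \<open>simp add: set_eq_iff\<close>)
    show "0 \<notin> {z. cnj z \<in> Oz}" using zero_notin_Oz by auto
    show "z\<^sup>2 * Fc 2 z + (of_real (1 + l) * z + of_real \<mu> + of_real \<mu> * z\<^sup>2) * Fc 1 z + of_real (1 / (4 * \<omega>\<^sup>2)) * Fc 0 z = 0"
      if "z \<in> {z. cnj z \<in> Oz}" for z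
      unfolding c_def[symmetric] by (rule Fc4) (use that in simp)
    show "Fc 0 0 = 1" by (simp add: Fc_def F(3))
    show "(- 1) ^ 0 * G 0 (- 0) = 1" by (simp add: G(3))
  qed
qed

lemma sectorE:
  assumes "z \<in> sector lo hi"
  obtains r \<theta> where "r > 0" "lo < \<theta>" "\<theta> < hi" "z = of_real r * cis \<theta>"
proof -
  from assms obtain \<theta> where "z \<noteq> 0" "lo < \<theta>" "\<theta> < hi" "z = of_real (cmod z) * cis \<theta>"
    unfolding sector_def by blast
  moreover from this(1) have "cmod z > 0" by simp
  ultimately show thesis by (intro that)
qed

lemma cis_minus_pi: "cis (- pi) = - 1"
  by (simp add: complex_eq_iff)

section \<open>Branches of F; existence and uniqueness of the Stokes multipliers\<close>

definition phib :: "real \<Rightarrow> real \<Rightarrow> real \<Rightarrow> real \<Rightarrow> complex" where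
  "phib l \<mu> r \<theta> = of_real (r powr (- l)) * exp (- \<i> * of_real (l * \<theta>)) *
     exp (of_real \<mu> * (1 / (of_real r * cis \<theta>) - of_real r * cis \<theta>))"

lemma Fbr_eq: "Fbr l \<mu> r \<theta> = mat2 (phib l \<mu> r \<theta>) 0 0 1"
  by (simp add: Fbr_def phib_def Let_def)

lemma phib_nonzero: "r > 0 \<Longrightarrow> phib l \<mu> r \<theta> \<noteq> 0"
  by (simp add: phib_def)

text \<open>Cutting opposite to the central direction \<open>\<theta>c\<close> and adding back its
  argument gives the branch with the prescribed arguments, also when these exceed pi as in the
  counterclockwise continuations.\<close>

lemma sector_branch:
  assumes b: "b < pi"
  shows "\<exists>\<Phi>. (\<forall>z\<in>sector (\<theta>c - b) (\<theta>c + b). (\<Phi> has_field_derivative dd l \<mu> z * \<Phi> z) (at z)) \<and>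
    (\<forall>z. \<Phi> z \<noteq> 0) \<and>
    (\<forall>r \<theta>. r > 0 \<longrightarrow> \<theta>c - b < \<theta> \<longrightarrow> \<theta> < \<theta>c + b \<longrightarrow> \<Phi> (of_real r * cis \<theta>) = phib l \<mu> r \<theta>)"
proof -
  define \<Phi> where "\<Phi> z = exp (- of_real l * (Ln (z / cis \<theta>c) + \<i> * of_real \<theta>c) + of_real \<mu> * (1 / z - z))" for z
  have Ln: "Ln (of_real r * cis \<theta> / cis \<theta>c) = of_real (ln r) + \<i> * of_real (\<theta> - \<theta>c)"
    if "r > 0" "\<theta>c - b < \<theta>" "\<theta> < \<theta>c + b" for r \<theta>
  proof -
    have "exp (complex_of_real (ln r)) = of_real r"
      using that(1) by (simp add: exp_of_real)
    then have e: "of_real r * cis \<theta> / cis \<theta>c = exp (of_real (ln r) + \<i> * of_real (\<theta> - \<theta>c))"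
      by (simp only: exp_add cis_conv_exp[symmetric] cis_divide[symmetric] times_divide_eq_right)
    show ?thesis unfolding e by (rule Ln_exp) (use that b in auto)
  qed
  show ?thesis
  proof (intro exI[of _ \<Phi>] conjI ballI allI impI)
    fix z assume z: "z \<in> sector (\<theta>c - b) (\<theta>c + b)"
    then obtain r \<theta> where r: "r > 0" "\<theta>c - b < \<theta>" "\<theta> < \<theta>c + b" and zr: "z = of_real r * cis \<theta>"
      unfolding sector_polar by auto
    have z0: "z \<noteq> 0" using zero_notin_sector z by metis
    have cut: "z / cis \<theta>c \<notin> \<real>\<^sub>\<le>\<^sub>0"
    proof
      assume neg: "z / cis \<theta>c \<in> \<real>\<^sub>\<le>\<^sub>0"
      have "z / cis \<theta>c = of_real r * cis (\<theta> - \<theta>c)"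
        unfolding zr by (simp add: cis_divide[symmetric])
      with neg have "r * cos (\<theta> - \<theta>c) \<le> 0" "r * sin (\<theta> - \<theta>c) = 0"
        by (simp_all only: complex_nonpos_Reals_iff) simp_all
      moreover have "sin (\<theta> - \<theta>c) = 0 \<Longrightarrow> \<theta> - \<theta>c = 0"
        by (rule sin_eq_0_pi) (use r b in linarith)+
      ultimately show False using r(1) by auto
    qed
    have "((\<lambda>z. z / cis \<theta>c) has_field_derivative 1 / cis \<theta>c) (at z)"
      by (auto intro!: derivative_eq_intros)
    from DERIV_chain2[OF has_field_derivative_Ln[OF cut] this]
    have "((\<lambda>z. Ln (z / cis \<theta>c)) has_field_derivative 1 / z) (at z)"
      using z0 by (simp add: field_simps)
    moreover have "((\<lambda>z. 1 / z - z) has_field_derivative - (1 / z\<^sup>2) - 1) (at z)"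
      using z0 by (auto intro!: derivative_eq_intros simp: power2_eq_square)
    ultimately have "((\<lambda>z. - of_real l * (Ln (z / cis \<theta>c) + \<i> * of_real \<theta>c) + of_real \<mu> * (1 / z - z)) has_field_derivative
        - of_real l * (1 / z + 0) + of_real \<mu> * (- (1 / z\<^sup>2) - 1)) (at z)"
      by (intro DERIV_add DERIV_cmult DERIV_const)
    then have "((\<lambda>z. - of_real l * (Ln (z / cis \<theta>c) + \<i> * of_real \<theta>c) + of_real \<mu> * (1 / z - z)) has_field_derivative dd l \<mu> z) (at z)"
      by (rule DERIV_cong) (simp add: dd_def algebra_simps)
    from DERIV_chain2[OF DERIV_exp this]
    show "(\<Phi> has_field_derivative dd l \<mu> z * \<Phi> z) (at z)"
      by (simp only: \<Phi>_def[abs_def] mult.commute)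
  next
    fix r \<theta> assume r: "r > (0::real)" "\<theta>c - b < \<theta>" "\<theta> < \<theta>c + b"
    have "Ln (of_real r * cis \<theta> / cis \<theta>c) + \<i> * of_real \<theta>c = of_real (ln r) + \<i> * of_real \<theta>"
      unfolding Ln[OF r] by (simp add: algebra_simps)
    moreover have "exp (- of_real l * (of_real (ln r) + \<i> * of_real \<theta>)) = of_real (r powr (- l)) * exp (- \<i> * of_real (l * \<theta>))"
      using r(1) by (simp add: powr_def exp_of_real[symmetric] exp_add[symmetric] algebra_simps)
    ultimately show "\<Phi> (of_real r * cis \<theta>) = phib l \<mu> r \<theta>"
      unfolding \<Phi>_def phib_def exp_add by simp
  qed (simp add: \<Phi>_def)
qed

lemma constant_on_open_connected:
  fixes f :: "complex \<Rightarrow> complex"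
  assumes "open S" "connected S" "\<And>z. z \<in> S \<Longrightarrow> (f has_field_derivative 0) (at z)"
  shows "\<exists>C. \<forall>z\<in>S. f z = C"
proof (cases "S = {}")
  case False
  then obtain w where w: "w \<in> S" by blast
  have "f z = f w" if "z \<in> S" for z
    by (rule has_derivative_zero_unique_connected[OF assms(1,2) _ that w])
      (use assms(3) in \<open>simp add: has_field_derivative_def lambda_zero\<close>)
  then show ?thesis by blast
qed simp

lemma sector_solution_dominant:
  assumes b: "b < pi"
    and f: "\<And>z. z \<in> sector (\<theta>c - b) (\<theta>c + b) \<Longrightarrow> (f has_field_derivative dd l \<mu> z * f z) (at z)"
  shows "\<exists>C. \<forall>r \<theta>. r > 0 \<and> \<theta>c - b < \<theta> \<and> \<theta> < \<theta>c + b \<longrightarrow> f (of_real r * cis \<theta>) = phib l \<mu> r \<theta> * C"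
proof -
  obtain \<Phi> where \<Phi>': "(\<forall>z\<in>sector (\<theta>c - b) (\<theta>c + b). (\<Phi> has_field_derivative dd l \<mu> z * \<Phi> z) (at z)) \<and>
    (\<forall>z. \<Phi> z \<noteq> 0) \<and>
    (\<forall>r \<theta>. r > 0 \<longrightarrow> \<theta>c - b < \<theta> \<longrightarrow> \<theta> < \<theta>c + b \<longrightarrow> \<Phi> (of_real r * cis \<theta>) = phib l \<mu> r \<theta>)"
    using sector_branch[OF b] ..
  note \<Phi> = \<Phi>'[THEN conjunct1, rule_format] \<Phi>'[THEN conjunct2, THEN conjunct1, rule_format]
    \<Phi>'[THEN conjunct2, THEN conjunct2, rule_format]
  have "\<exists>C. \<forall>z\<in>sector (\<theta>c - b) (\<theta>c + b). f z / \<Phi> z = C"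
  proof (rule constant_on_open_connected[OF open_sector connected_sector])
    show "((\<lambda>z. f z / \<Phi> z) has_field_derivative 0) (at z)" if "z \<in> sector (\<theta>c - b) (\<theta>c + b)" for z
      by (rule derivative_eq_intros f[OF that] \<Phi>(1)[OF that] \<Phi>(2) refl)+ (simp add: algebra_simps)
  qed
  then obtain C where C: "\<forall>z\<in>sector (\<theta>c - b) (\<theta>c + b). f z / \<Phi> z = C" ..
  show ?thesis
  proof (intro exI[of _ C] allI impI, elim conjE)
    fix r \<theta> assume r: "r > (0::real)" "\<theta>c - b < \<theta>" "\<theta> < \<theta>c + b"
    show "f (of_real r * cis \<theta>) = phib l \<mu> r \<theta> * C"
      using bspec[OF C polar_in_sector[OF r]] \<Phi>(2)[of "of_real r * cis \<theta>"] unfolding \<Phi>(3)[OF r] by (simp add: field_simps)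
  qed
qed

lemma sector_solution_recessive:
  assumes b: "b < pi"
    and f: "\<And>z. z \<in> sector (\<theta>c - b) (\<theta>c + b) \<Longrightarrow> (f has_field_derivative - dd l \<mu> z * f z) (at z)"
  shows "\<exists>C. \<forall>r \<theta>. r > 0 \<and> \<theta>c - b < \<theta> \<and> \<theta> < \<theta>c + b \<longrightarrow> phib l \<mu> r \<theta> * f (of_real r * cis \<theta>) = C"
proof -
  obtain \<Phi> where \<Phi>': "(\<forall>z\<in>sector (\<theta>c - b) (\<theta>c + b). (\<Phi> has_field_derivative dd l \<mu> z * \<Phi> z) (at z)) \<and>
    (\<forall>z. \<Phi> z \<noteq> 0) \<and>
    (\<forall>r \<theta>. r > 0 \<longrightarrow> \<theta>c - b < \<theta> \<longrightarrow> \<theta> < \<theta>c + b \<longrightarrow> \<Phi> (of_real r * cis \<theta>) = phib l \<mu> r \<theta>)"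
    using sector_branch[OF b] ..
  note \<Phi> = \<Phi>'[THEN conjunct1, rule_format] \<Phi>'[THEN conjunct2, THEN conjunct1, rule_format]
    \<Phi>'[THEN conjunct2, THEN conjunct2, rule_format]
  have "\<exists>C. \<forall>z\<in>sector (\<theta>c - b) (\<theta>c + b). \<Phi> z * f z = C"
  proof (rule constant_on_open_connected[OF open_sector connected_sector])
    show "((\<lambda>z. \<Phi> z * f z) has_field_derivative 0) (at z)" if "z \<in> sector (\<theta>c - b) (\<theta>c + b)" for z
      by (rule derivative_eq_intros f[OF that] \<Phi>(1)[OF that] \<Phi>(2) refl)+ (simp add: algebra_simps)
  qed
  then obtain C where C: "\<forall>z\<in>sector (\<theta>c - b) (\<theta>c + b). \<Phi> z * f z = C" ..
  show ?thesis
  proof (intro exI[of _ C] allI impI, elim conjE)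
    fix r \<theta> assume r: "r > (0::real)" "\<theta>c - b < \<theta>" "\<theta> < \<theta>c + b"
    show "phib l \<mu> r \<theta> * f (of_real r * cis \<theta>) = C"
      using bspec[OF C polar_in_sector[OF r]] \<Phi>(2)[of "of_real r * cis \<theta>"] unfolding \<Phi>(3)[OF r] by simp
  qed
qed

text \<open>A unipotent Stokes matrix preserves one column of the normalizing matrix and adds a
  multiple of it to the other. This entrywise form makes c0 = 0 mean agreement of second
  columns.\<close>

lemma stokes0_iff:
  fixes X Y :: "complex^2^2"
  assumes "\<phi> \<noteq> 0"
  shows "X ** mat2 \<phi> 0 0 1 = Y ** mat2 \<phi> 0 0 1 ** mat2 1 c 0 1 \<longleftrightarrow>
    X $ 1 $ 1 = Y $ 1 $ 1 \<and> X $ 2 $ 1 = Y $ 2 $ 1 \<and>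
    X $ 1 $ 2 = Y $ 1 $ 2 + Y $ 1 $ 1 * (\<phi> * c) \<and> X $ 2 $ 2 = Y $ 2 $ 2 + Y $ 2 $ 1 * (\<phi> * c)"
proof -
  have "(X ** mat2 \<phi> 0 0 1) $ i $ 1 = \<phi> * X $ i $ 1" "(X ** mat2 \<phi> 0 0 1) $ i $ 2 = X $ i $ 2"
    "(Y ** mat2 \<phi> 0 0 1 ** mat2 1 c 0 1) $ i $ 1 = \<phi> * Y $ i $ 1"
    "(Y ** mat2 \<phi> 0 0 1 ** mat2 1 c 0 1) $ i $ 2 = Y $ i $ 2 + Y $ i $ 1 * (\<phi> * c)" for i
    by (simp_all add: mat2_mult_nth)
  then show ?thesis
    unfolding vec_eq_iff forall_2 by (simp only: mult_cancel_left assms simp_thms) blast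
qed

lemma stokes1_iff:
  fixes X Y :: "complex^2^2"
  assumes "\<phi> \<noteq> 0"
  shows "Y ** mat2 \<phi> 0 0 1 = X ** mat2 \<phi> 0 0 1 ** mat2 1 0 c 1 \<longleftrightarrow>
    Y $ 1 $ 2 = X $ 1 $ 2 \<and> Y $ 2 $ 2 = X $ 2 $ 2 \<and>
    \<phi> * Y $ 1 $ 1 = \<phi> * X $ 1 $ 1 + X $ 1 $ 2 * c \<and> \<phi> * Y $ 2 $ 1 = \<phi> * X $ 2 $ 1 + X $ 2 $ 2 * c"
proof -
  have "(Y ** mat2 \<phi> 0 0 1) $ i $ 1 = \<phi> * Y $ i $ 1" "(Y ** mat2 \<phi> 0 0 1) $ i $ 2 = Y $ i $ 2"
    "(X ** mat2 \<phi> 0 0 1 ** mat2 1 0 c 1) $ i $ 1 = \<phi> * X $ i $ 1 + X $ i $ 2 * c"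
    "(X ** mat2 \<phi> 0 0 1 ** mat2 1 0 c 1) $ i $ 2 = X $ i $ 2" for i
    by (simp_all add: mat2_mult_nth)
  then show ?thesis
    unfolding vec_eq_iff forall_2 by (simp only:) blast
qed

lemma matrix_from_transition:
  fixes p q r s p' q' r' s' :: complex
  assumes "s * p' - q * r' = 1" "p * s' - r * q' = 1" "p * s - r * q = 1"
  shows "q' = q + p * (s * q' - q * s')" "s' = s + r * (s * q' - q * s')"
    "p' = p + q * (p * r' - r * p')" "r' = r + s * (p * r' - r * p')"
proof -
  have "q' = q' * (p * s - r * q)" "s' = s' * (p * s - r * q)" "p' = p' * (p * s - r * q)" "r' = r' * (p * s - r * q)"
    using assms(3) by simp_all
  moreover have "q' * (p * s - r * q) = q * (p * s' - r * q') + p * (s * q' - q * s')"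
    "s' * (p * s - r * q) = s * (p * s' - r * q') + r * (s * q' - q * s')"
    "p' * (p * s - r * q) = p * (s * p' - q * r') + q * (p * r' - r * p')"
    "r' * (p * s - r * q) = r * (s * p' - q * r') + s * (p * r' - r * p')"
    by (simp_all add: algebra_simps)
  ultimately show "q' = q + p * (s * q' - q * s')" "s' = s + r * (s * q' - q * s')"
    "p' = p + q * (p * r' - r * p')" "r' = r + s * (p * r' - r * p')"
    using assms(1,2) by simp_all
qed

lemma sigma0_subset:
  assumes "0 < a" "0 < b" "b < pi / 2"
  shows "sector (pi - b) (pi + b) \<subseteq> sector (- a) (pi + b)" "sector (pi - b) (pi + b) \<subseteq> sector (- pi - b) a"
proof -
  show "sector (pi - b) (pi + b) \<subseteq> sector (- a) (pi + b)"
    by (rule sector_mono) (use assms pi_gt_zero in linarith)+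
  have "sector (pi - b) (pi + b) = sector (- pi - b) (- pi + b)"
    using sector_shift[of "- pi - b" "- pi + b"] by (simp add: algebra_simps)
  also have "\<dots> \<subseteq> sector (- pi - b) a"
    by (rule sector_mono) (use assms pi_gt_zero in linarith)+
  finally show "sector (pi - b) (pi + b) \<subseteq> sector (- pi - b) a" .
qed

lemma sigma1_subset:
  assumes "0 < a" "a < pi / 2" "0 < b"
  shows "sector (- a) a \<subseteq> sector (- a) (pi + b)" "sector (- a) a \<subseteq> sector (- pi - b) a"
  by (rule sector_mono; use assms pi_gt_zero in linarith)+

text \<open>On the left overlap the lower left entry of the transition matrix from \<open>Hp\<close>
  to \<open>Hm\<close> vanishes and the upper right one is a constant times the branch of F; the
  constant is c0. On the right overlap \<open>Hp\<close> and \<open>Hm\<close> change roles and the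
  lower left entry gives c1.\<close>

lemma stokes_exists:
  assumes \<mu>: "\<mu> > 0" and a: "0 < a" "a < pi / 2" and b: "0 < b" "b < pi / 2"
    and Hp: "normalizing \<omega> l \<mu> (sector (- a) (pi + b)) Hp"
    and Hm: "normalizing \<omega> l \<mu> (sector (- pi - b) a) Hm"
  shows "\<exists>c0 c1. stokes_data \<omega> l \<mu> a b c0 c1"
proof -
  note np = normalizing_imp_nrm[OF Hp zero_notin_sector]
  note nm = normalizing_imp_nrm[OF Hm zero_notin_sector]
  define S0 where "S0 = sector (pi - b) (pi + b)"
  define S1 where "S1 = sector (- a) a"
  have S0: "open S0" "connected S0" and neg: "\<And>t. t > 0 \<Longrightarrow> - of_real t \<in> S0"
    using b by (auto simp: S0_def open_sector connected_sector intro!: negative_reals_in_sector)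
  have S1: "open S1" "connected S1" and pos: "\<And>t. t > 0 \<Longrightarrow> of_real t \<in> S1"
    using a by (auto simp: S1_def open_sector connected_sector intro!: positive_reals_in_sector)
  have cl0: "0 \<in> closure S0" using zero_in_closure_if_positive_reals[of "- 1" S0] neg by simp
  have cl1: "0 \<in> closure S1" using zero_in_closure_if_positive_reals[of 1 S1] pos by simp
  note np0 = nrm_subset[OF np sigma0_subset(1)[OF a(1) b, folded S0_def]]
  note nm0 = nrm_subset[OF nm sigma0_subset(2)[OF a(1) b, folded S0_def]]
  note np1 = nrm_subset[OF np sigma1_subset(1)[OF a b(1), folded S1_def]]
  note nm1 = nrm_subset[OF nm sigma1_subset(2)[OF a b(1), folded S1_def]]
  note T0 = nrm_transition[OF S0 cl0 np0 nm0]
  note T1 = nrm_transition[OF S1 cl1 nm1 np1]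
  have b': "b < pi" and a': "a < pi" using a b pi_gt_zero by linarith+
  obtain c0 where c0': "\<forall>r \<theta>. r > 0 \<and> pi - b < \<theta> \<and> \<theta> < pi + b \<longrightarrow>
      Hp (of_real r * cis \<theta>) $ 2 $ 2 * Hm (of_real r * cis \<theta>) $ 1 $ 2 - Hp (of_real r * cis \<theta>) $ 1 $ 2 * Hm (of_real r * cis \<theta>) $ 2 $ 2
       = phib l \<mu> r \<theta> * c0"
    using sector_solution_dominant[OF b' T0(3)[unfolded S0_def]] ..
  \<comment> \<open>The defining relation for c1 uses the branch of F with arguments near 2 pi, so
    the right overlap is written as a sector around that direction.\<close>
  have sh: "sector (2 * pi - a) (2 * pi + a) = S1"
    using sector_shift[of "- a" a] by (simp add: S1_def algebra_simps)
  obtain c1 where c1': "\<forall>r \<theta>. r > 0 \<and> 2 * pi - a < \<theta> \<and> \<theta> < 2 * pi + a \<longrightarrow>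
      phib l \<mu> r \<theta> * (Hm (of_real r * cis \<theta>) $ 1 $ 1 * Hp (of_real r * cis \<theta>) $ 2 $ 1 - Hm (of_real r * cis \<theta>) $ 2 $ 1 * Hp (of_real r * cis \<theta>) $ 1 $ 1)
       = c1"
    using sector_solution_recessive[OF a' T1(4)[folded sh]] ..
  have "Hm (of_real r * cis \<theta>) ** Fbr l \<mu> r \<theta> = Hp (of_real r * cis \<theta>) ** Fbr l \<mu> r \<theta> ** mat2 1 c0 0 1"
    if r: "r > 0" "pi - b < \<theta>" "\<theta> < pi + b" for r \<theta>
  proof -
    define z where "z = of_real r * cis \<theta>"
    have z: "z \<in> S0" unfolding S0_def z_def by (rule polar_in_sector[OF r])
    then have zc: "z \<in> closure S0" using closure_subset by blast
    note det = nrm_transition(2)[OF S0 cl0 np0 np0 zc]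
    note m = matrix_from_transition[OF T0(1,2)[OF zc] det]
    have K21: "Hp z $ 1 $ 1 * Hm z $ 2 $ 1 - Hp z $ 2 $ 1 * Hm z $ 1 $ 1 = 0"
      by (rule nrm_transition_left[OF S0 neg \<mu> np0 nm0 z])
    have K12: "Hp z $ 2 $ 2 * Hm z $ 1 $ 2 - Hp z $ 1 $ 2 * Hm z $ 2 $ 2 = phib l \<mu> r \<theta> * c0"
      using c0'[rule_format, of r \<theta>, folded z_def] r by simp
    have "Hm z $ 1 $ 1 = Hp z $ 1 $ 1" "Hm z $ 2 $ 1 = Hp z $ 2 $ 1"
      using m(3,4)[unfolded K21] by simp_all
    then show ?thesis
      unfolding Fbr_eq stokes0_iff[OF phib_nonzero[OF r(1)]] z_def[symmetric]
      using m(1,2) unfolding K12 by blast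
  qed
  moreover have "Hp (of_real r * cis \<theta>) ** Fbr l \<mu> r (\<theta> + 2 * pi) = Hm (of_real r * cis \<theta>) ** Fbr l \<mu> r (\<theta> + 2 * pi) ** mat2 1 0 c1 1"
    if r: "r > 0" "- a < \<theta>" "\<theta> < a" for r \<theta>
  proof -
    define z where "z = of_real r * cis \<theta>"
    have z: "z \<in> S1" unfolding S1_def z_def by (rule polar_in_sector[OF r])
    then have zc: "z \<in> closure S1" using closure_subset by blast
    have per: "of_real r * cis (\<theta> + 2 * pi) = z" by (simp add: z_def complex_eq_iff)
    note det = nrm_transition(2)[OF S1 cl1 nm1 nm1 zc]
    note m = matrix_from_transition[OF T1(1,2)[OF zc] det]
    have K: "phib l \<mu> r (\<theta> + 2 * pi) * (Hm z $ 1 $ 1 * Hp z $ 2 $ 1 - Hm z $ 2 $ 1 * Hp z $ 1 $ 1) = c1"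
      using c1'[rule_format, of r "\<theta> + 2 * pi"] r unfolding per by simp
    have K12: "Hm z $ 2 $ 2 * Hp z $ 1 $ 2 - Hm z $ 1 $ 2 * Hp z $ 2 $ 2 = 0"
      by (rule nrm_transition_right[OF S1 pos \<mu> nm1 np1 z])
    have "phib l \<mu> r (\<theta> + 2 * pi) * Hp z $ 1 $ 1 = phib l \<mu> r (\<theta> + 2 * pi) * Hm z $ 1 $ 1 + Hm z $ 1 $ 2 * c1"
      "phib l \<mu> r (\<theta> + 2 * pi) * Hp z $ 2 $ 1 = phib l \<mu> r (\<theta> + 2 * pi) * Hm z $ 2 $ 1 + Hm z $ 2 $ 2 * c1"
      unfolding K[symmetric] by (subst m(3), simp only: algebra_simps) (subst m(4), simp only: algebra_simps)
    moreover have "Hp z $ 1 $ 2 = Hm z $ 1 $ 2" "Hp z $ 2 $ 2 = Hm z $ 2 $ 2"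
      using m(1,2)[unfolded K12] by simp_all
    ultimately show ?thesis
      unfolding Fbr_eq stokes1_iff[OF phib_nonzero[OF r(1)]] z_def[symmetric] by blast
  qed
  ultimately have "stokes_data \<omega> l \<mu> a b c0 c1"
    unfolding stokes_data_def using Hp Hm by blast
  then show ?thesis by blast
qed

text \<open>Two choices of sectors are compared on their common part, where the normalizing
  transformations coincide. One point of each overlap then suffices, since a column of a matrix with
  determinant 1 is nonzero.\<close>

lemma stokes_unique:
  assumes \<mu>: "\<mu> > 0" and a: "0 < a" "a < pi / 2" "0 < a'" "a' < pi / 2" and b: "0 < b" "b < pi / 2" "0 < b'" "b' < pi / 2"
    and d: "stokes_data \<omega> l \<mu> a b c0 c1" and d': "stokes_data \<omega> l \<mu> a' b' c0' c1'"
  shows "c0 = c0' \<and> c1 = c1'"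
proof -
  obtain Hp Hm where Hp: "normalizing \<omega> l \<mu> (sector (- a) (pi + b)) Hp" and Hm: "normalizing \<omega> l \<mu> (sector (- pi - b) a) Hm"
    and r0: "\<And>r \<theta>. r > 0 \<Longrightarrow> pi - b < \<theta> \<Longrightarrow> \<theta> < pi + b \<Longrightarrow>
       Hm (of_real r * cis \<theta>) ** Fbr l \<mu> r \<theta> = Hp (of_real r * cis \<theta>) ** Fbr l \<mu> r \<theta> ** mat2 1 c0 0 1"
    and r1: "\<And>r \<theta>. r > 0 \<Longrightarrow> - a < \<theta> \<Longrightarrow> \<theta> < a \<Longrightarrow>
       Hp (of_real r * cis \<theta>) ** Fbr l \<mu> r (\<theta> + 2 * pi) = Hm (of_real r * cis \<theta>) ** Fbr l \<mu> r (\<theta> + 2 * pi) ** mat2 1 0 c1 1"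
    using d unfolding stokes_data_def by blast
  obtain Hp' Hm' where Hp': "normalizing \<omega> l \<mu> (sector (- a') (pi + b')) Hp'" and Hm': "normalizing \<omega> l \<mu> (sector (- pi - b') a') Hm'"
    and r0': "\<And>r \<theta>. r > 0 \<Longrightarrow> pi - b' < \<theta> \<Longrightarrow> \<theta> < pi + b' \<Longrightarrow>
       Hm' (of_real r * cis \<theta>) ** Fbr l \<mu> r \<theta> = Hp' (of_real r * cis \<theta>) ** Fbr l \<mu> r \<theta> ** mat2 1 c0' 0 1"
    and r1': "\<And>r \<theta>. r > 0 \<Longrightarrow> - a' < \<theta> \<Longrightarrow> \<theta> < a' \<Longrightarrow>
       Hp' (of_real r * cis \<theta>) ** Fbr l \<mu> r (\<theta> + 2 * pi) = Hm' (of_real r * cis \<theta>) ** Fbr l \<mu> r (\<theta> + 2 * pi) ** mat2 1 0 c1' 1"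
    using d' unfolding stokes_data_def by blast
  define A where "A = min a a'"
  define B where "B = min b b'"
  have AB: "0 < A" "0 < B" "A \<le> a" "A \<le> a'" "B \<le> b" "B \<le> b'" using a b by (auto simp: A_def B_def)
  define Sp where "Sp = sector (- A) (pi + B)"
  define Sm where "Sm = sector (- pi - B) A"
  have np: "nrm \<omega> l \<mu> Sp (\<lambda>z. Hp z $ 1 $ 1) (\<lambda>z. Hp z $ 1 $ 2) (\<lambda>z. Hp z $ 2 $ 1) (\<lambda>z. Hp z $ 2 $ 2)"
    "nrm \<omega> l \<mu> Sp (\<lambda>z. Hp' z $ 1 $ 1) (\<lambda>z. Hp' z $ 1 $ 2) (\<lambda>z. Hp' z $ 2 $ 1) (\<lambda>z. Hp' z $ 2 $ 2)"
    "nrm \<omega> l \<mu> Sm (\<lambda>z. Hm z $ 1 $ 1) (\<lambda>z. Hm z $ 1 $ 2) (\<lambda>z. Hm z $ 2 $ 1) (\<lambda>z. Hm z $ 2 $ 2)"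
    "nrm \<omega> l \<mu> Sm (\<lambda>z. Hm' z $ 1 $ 1) (\<lambda>z. Hm' z $ 1 $ 2) (\<lambda>z. Hm' z $ 2 $ 1) (\<lambda>z. Hm' z $ 2 $ 2)"
    unfolding Sp_def Sm_def
    by (rule nrm_subset[OF normalizing_imp_nrm[OF Hp zero_notin_sector]] nrm_subset[OF normalizing_imp_nrm[OF Hp' zero_notin_sector]]
        nrm_subset[OF normalizing_imp_nrm[OF Hm zero_notin_sector]] nrm_subset[OF normalizing_imp_nrm[OF Hm' zero_notin_sector]];
        rule sector_mono; use AB in linarith)+
  have posp: "of_real t \<in> Sp" "- of_real t \<in> Sp" if "t > 0" for t
    unfolding Sp_def by (rule positive_reals_in_sector[OF _ _ that] negative_reals_in_sector[OF _ _ that]; use AB pi_gt_zero in linarith)+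
  have posm: "of_real t \<in> Sm" "- of_real t \<in> Sm" if "t > 0" for t
  proof -
    show "of_real t \<in> Sm"
      unfolding Sm_def by (rule positive_reals_in_sector[OF _ _ that]; use AB pi_gt_zero in linarith)
    show "- of_real t \<in> Sm"
      using polar_in_sector[OF that, of "- pi - B" "- pi" A] AB pi_gt_zero
      by (simp add: Sm_def cis_minus_pi)
  qed
  have eqp: "Hp' z $ i $ j = Hp z $ i $ j" if "z \<in> Sp" for z i j
    using nrm_unique[OF open_sector[of "- A" "pi + B", folded Sp_def] connected_sector[of "- A" "pi + B", folded Sp_def] posp \<mu> np(1,2) that]
      exhaust_2[of i] exhaust_2[of j] by auto
  have eqm: "Hm' z $ i $ j = Hm z $ i $ j" if "z \<in> Sm" for z i j
    using nrm_unique[OF open_sector[of "- pi - B" A, folded Sm_def] connected_sector[of "- pi - B" A, folded Sm_def] posm \<mu> np(3,4) that]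
      exhaust_2[of i] exhaust_2[of j] by auto
  have clp: "0 \<in> closure Sp" using zero_in_closure_if_positive_reals[of 1 Sp] posp by simp
  have clm: "0 \<in> closure Sm" using zero_in_closure_if_positive_reals[of 1 Sm] posm by simp
  have detp: "Hp z $ 1 $ 1 * Hp z $ 2 $ 2 - Hp z $ 2 $ 1 * Hp z $ 1 $ 2 = 1" if "z \<in> Sp" for z
    using nrm_transition(2)[OF open_sector[of "- A" "pi + B", folded Sp_def] connected_sector[of "- A" "pi + B", folded Sp_def] clp np(1,1), of z]
      that closure_subset by blast
  have detm: "Hm z $ 1 $ 1 * Hm z $ 2 $ 2 - Hm z $ 2 $ 1 * Hm z $ 1 $ 2 = 1" if "z \<in> Sm" for z
    using nrm_transition(2)[OF open_sector[of "- pi - B" A, folded Sm_def] connected_sector[of "- pi - B" A, folded Sm_def] clm np(3,3), of z]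
      that closure_subset by blast
  have m1: "(-1::complex) \<in> Sp" "(-1::complex) \<in> Sm" "(1::complex) \<in> Sp" "(1::complex) \<in> Sm"
    using posp[of 1] posm[of 1] by simp_all
  have "c0 = c0'"
  proof -
    have z: "complex_of_real 1 * cis pi = - 1" by simp
    define f where "f = phib l \<mu> 1 pi"
    have f: "f \<noteq> 0" by (simp add: f_def phib_nonzero)
    note e = r0[of 1 pi, unfolded z Fbr_eq f_def[symmetric] stokes0_iff[OF f]] r0'[of 1 pi, unfolded z Fbr_eq f_def[symmetric] stokes0_iff[OF f]]
    have "Hp (- 1) $ 1 $ 1 * (f * c0) = Hp (- 1) $ 1 $ 1 * (f * c0')" "Hp (- 1) $ 2 $ 1 * (f * c0) = Hp (- 1) $ 2 $ 1 * (f * c0')"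
      using e b unfolding eqp[OF m1(1)] eqm[OF m1(2)] by auto
    moreover have "Hp (- 1) $ 1 $ 1 \<noteq> 0 \<or> Hp (- 1) $ 2 $ 1 \<noteq> 0" using detp[OF m1(1)] by auto
    ultimately show ?thesis using f by auto
  qed
  moreover have "c1 = c1'"
  proof -
    have z: "complex_of_real 1 * cis 0 = 1" by simp
    define f where "f = phib l \<mu> 1 (0 + 2 * pi)"
    have f: "f \<noteq> 0" by (simp add: f_def phib_nonzero)
    note e = r1[of 1 0, unfolded z Fbr_eq f_def[symmetric] stokes1_iff[OF f]] r1'[of 1 0, unfolded z Fbr_eq f_def[symmetric] stokes1_iff[OF f]]
    have "Hm 1 $ 1 $ 2 * c1 = Hm 1 $ 1 $ 2 * c1'" "Hm 1 $ 2 $ 2 * c1 = Hm 1 $ 2 $ 2 * c1'"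
      using e a unfolding eqp[OF m1(3)] eqm[OF m1(4)] by auto
    moreover have "Hm 1 $ 1 $ 2 \<noteq> 0 \<or> Hm 1 $ 2 $ 2 \<noteq> 0" using detm[OF m1(4)] by auto
    ultimately show ?thesis by auto
  qed
  ultimately show ?thesis ..
qed

text \<open>Uniqueness evaluates the definite description at the apertures 1 / 4. The vanishing of a
  multiplier is thereby turned into agreement of columns on one overlap, the only form in which it
  is used later.\<close>

theorem stokes_structure:
  assumes \<omega>: "\<omega> > 0" and \<mu>: "\<mu> > 0"
  obtains p q r s p' q' r' s' where
    "nrm \<omega> l \<mu> (sector (- 1 / 4) (pi + 1 / 4)) p q r s"
    "nrm \<omega> l \<mu> (sector (- pi - 1 / 4) (1 / 4)) p' q' r' s'"
    "\<forall>z\<in>sector (pi - 1 / 4) (pi + 1 / 4). p' z = p z \<and> r' z = r z"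
    "\<forall>z\<in>sector (- 1 / 4) (1 / 4). q' z = q z \<and> s' z = s z"
    "stokes_c0 \<omega> l \<mu> = 0 \<longleftrightarrow> (\<forall>z\<in>sector (pi - 1 / 4) (pi + 1 / 4). q' z = q z \<and> s' z = s z)"
    "stokes_c1 \<omega> l \<mu> = 0 \<longleftrightarrow> (\<forall>z\<in>sector (- 1 / 4) (1 / 4). p' z = p z \<and> r' z = r z)"
proof -
  have quarter: "0 < (1 / 4 :: real)" "1 / 4 < pi / 2" using pi_gt3 by auto
  have neg: "- (1 / 4) = (- 1 / 4 :: real)" by simp
  obtain Hp0 where Hp0: "normalizing \<omega> l \<mu> (sector (- (1 / 4)) (pi + 1 / 4)) Hp0" using normalizing_exists(1)[OF \<omega> \<mu>] unfolding neg by blast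
  obtain Hm0 where Hm0: "normalizing \<omega> l \<mu> (sector (- pi - 1 / 4) (1 / 4)) Hm0" using normalizing_exists(2)[OF \<omega> \<mu>] by blast
  obtain c0 c1 where d: "stokes_data \<omega> l \<mu> (1 / 4) (1 / 4) c0 c1"
    using stokes_exists[OF \<mu> quarter quarter Hp0 Hm0] by blast
  have "stokes_multipliers \<omega> l \<mu> = (c0, c1)"
    unfolding stokes_multipliers_def
  proof (rule the_equality)
    show "\<exists>a b. 0 < a \<and> a < pi / 2 \<and> 0 < b \<and> b < pi / 2 \<and> stokes_data \<omega> l \<mu> a b (fst (c0, c1)) (snd (c0, c1))"
      using d quarter by (intro exI[of _ "1 / 4"]) simp
    fix c assume "\<exists>a b. 0 < a \<and> a < pi / 2 \<and> 0 < b \<and> b < pi / 2 \<and> stokes_data \<omega> l \<mu> a b (fst c) (snd c)"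
    then obtain a b where ab: "0 < a" "a < pi / 2" "0 < b" "b < pi / 2" "stokes_data \<omega> l \<mu> a b (fst c) (snd c)" by blast
    have "fst c = c0 \<and> snd c = c1"
      by (rule stokes_unique[OF \<mu> ab(1,2) quarter ab(3,4) quarter ab(5) d])
    then show "c = (c0, c1)" by (simp add: prod_eq_iff)
  qed
  then have c: "stokes_c0 \<omega> l \<mu> = c0" "stokes_c1 \<omega> l \<mu> = c1" by (simp_all add: stokes_c0_def stokes_c1_def)
  obtain Hp Hm where Hp: "normalizing \<omega> l \<mu> (sector (- (1 / 4)) (pi + 1 / 4)) Hp" and Hm: "normalizing \<omega> l \<mu> (sector (- pi - 1 / 4) (1 / 4)) Hm"
    and r0: "\<And>r \<theta>. r > 0 \<Longrightarrow> pi - 1 / 4 < \<theta> \<Longrightarrow> \<theta> < pi + 1 / 4 \<Longrightarrow>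
       Hm (of_real r * cis \<theta>) ** Fbr l \<mu> r \<theta> = Hp (of_real r * cis \<theta>) ** Fbr l \<mu> r \<theta> ** mat2 1 c0 0 1"
    and r1: "\<And>r \<theta>. r > 0 \<Longrightarrow> - (1 / 4) < \<theta> \<Longrightarrow> \<theta> < 1 / 4 \<Longrightarrow>
       Hp (of_real r * cis \<theta>) ** Fbr l \<mu> r (\<theta> + 2 * pi) = Hm (of_real r * cis \<theta>) ** Fbr l \<mu> r (\<theta> + 2 * pi) ** mat2 1 0 c1 1"
    using d unfolding stokes_data_def by blast
  note np = normalizing_imp_nrm[OF Hp zero_notin_sector]
  note nm = normalizing_imp_nrm[OF Hm zero_notin_sector]
  have e0: "\<exists>f. f \<noteq> 0 \<and> Hm z $ 1 $ 1 = Hp z $ 1 $ 1 \<and> Hm z $ 2 $ 1 = Hp z $ 2 $ 1 \<and>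
    Hm z $ 1 $ 2 = Hp z $ 1 $ 2 + Hp z $ 1 $ 1 * (f * c0) \<and> Hm z $ 2 $ 2 = Hp z $ 2 $ 2 + Hp z $ 2 $ 1 * (f * c0)"
    if "z \<in> sector (pi - 1 / 4) (pi + 1 / 4)" for z
  proof -
    obtain r \<theta> where r: "r > 0" "pi - 1 / 4 < \<theta>" "\<theta> < pi + 1 / 4" "z = of_real r * cis \<theta>"
      using \<open>z \<in> sector _ _\<close> by (rule sectorE)
    show ?thesis
      using r0[OF r(1,2,3), folded r(4), unfolded Fbr_eq stokes0_iff[OF phib_nonzero[OF r(1)]]] phib_nonzero[OF r(1), of l \<mu> \<theta>] by blast
  qed
  have e1: "\<exists>f. f \<noteq> 0 \<and> Hp z $ 1 $ 2 = Hm z $ 1 $ 2 \<and> Hp z $ 2 $ 2 = Hm z $ 2 $ 2 \<and>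
    f * Hp z $ 1 $ 1 = f * Hm z $ 1 $ 1 + Hm z $ 1 $ 2 * c1 \<and> f * Hp z $ 2 $ 1 = f * Hm z $ 2 $ 1 + Hm z $ 2 $ 2 * c1"
    if "z \<in> sector (- (1 / 4)) (1 / 4)" for z
  proof -
    obtain r \<theta> where r: "r > 0" "- (1 / 4) < \<theta>" "\<theta> < 1 / 4" "z = of_real r * cis \<theta>"
      using \<open>z \<in> sector _ _\<close> by (rule sectorE)
    show ?thesis
      using r1[OF r(1,2,3), folded r(4), unfolded Fbr_eq stokes1_iff[OF phib_nonzero[OF r(1)]]] phib_nonzero[OF r(1), of l \<mu> "\<theta> + 2 * pi"] by blast
  qed
  have z0: "- 1 \<in> sector (pi - 1 / 4) (pi + 1 / 4)" using negative_reals_in_sector[of "pi - 1 / 4" "pi + 1 / 4" 1] by simp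
  have z1: "1 \<in> sector (- (1 / 4)) (1 / 4)" using positive_reals_in_sector[of "- (1 / 4)" "1 / 4" 1] by simp
  have detp: "Hp (-1) $ 1 $ 1 * Hp (-1) $ 2 $ 2 - Hp (-1) $ 2 $ 1 * Hp (-1) $ 1 $ 2 = 1"
  proof (rule nrm_transition(2)[OF open_sector connected_sector _ np np])
    show "0 \<in> closure (sector (- (1 / 4)) (pi + 1 / 4))"
      by (rule zero_in_closure_if_positive_reals[of 1]) (simp add: positive_reals_in_sector add_pos_pos)
    show "- 1 \<in> closure (sector (- (1 / 4)) (pi + 1 / 4))"
      using z0 sigma0_subset(1)[OF quarter(1) quarter] closure_subset by blast
  qed
  have detm: "Hm 1 $ 1 $ 1 * Hm 1 $ 2 $ 2 - Hm 1 $ 2 $ 1 * Hm 1 $ 1 $ 2 = 1"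
  proof (rule nrm_transition(2)[OF open_sector connected_sector _ nm nm])
    show "1 \<in> closure (sector (- pi - 1 / 4) (1 / 4))"
      using z1 sigma1_subset(2)[OF quarter quarter(1)] closure_subset by blast
    have "- pi - 1 / 4 < 0" using pi_gt_zero by linarith
    then show "0 \<in> closure (sector (- pi - 1 / 4) (1 / 4))"
      by (intro zero_in_closure_if_positive_reals[of 1]) (simp add: positive_reals_in_sector)
  qed
  show ?thesis
  proof (rule that[OF np[unfolded neg] nm], goal_cases)
    case 1
    show ?case using e0 by blast
  next
    case 2
    show ?case using e1[unfolded neg] by metis
  next
    case 3
    show ?case
    proof
      assume "stokes_c0 \<omega> l \<mu> = 0"
      then have "c0 = 0" using c by simp
      then show "\<forall>z\<in>sector (pi - 1 / 4) (pi + 1 / 4). Hm z $ 1 $ 2 = Hp z $ 1 $ 2 \<and> Hm z $ 2 $ 2 = Hp z $ 2 $ 2"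
        using e0 by fastforce
    next
      assume *: "\<forall>z\<in>sector (pi - 1 / 4) (pi + 1 / 4). Hm z $ 1 $ 2 = Hp z $ 1 $ 2 \<and> Hm z $ 2 $ 2 = Hp z $ 2 $ 2"
      have "Hp (-1) $ 1 $ 1 \<noteq> 0 \<or> Hp (-1) $ 2 $ 1 \<noteq> 0" using detp by auto
      then have "c0 = 0" using bspec[OF * z0] e0[OF z0] by auto
      then show "stokes_c0 \<omega> l \<mu> = 0" using c by simp
    qed
  next
    case 4
    show ?case
    proof
      assume "stokes_c1 \<omega> l \<mu> = 0"
      then have "c1 = 0" using c by simp
      then show "\<forall>z\<in>sector (- 1 / 4) (1 / 4). Hm z $ 1 $ 1 = Hp z $ 1 $ 1 \<and> Hm z $ 2 $ 1 = Hp z $ 2 $ 1"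
        using e1[unfolded neg] by fastforce
    next
      assume *: "\<forall>z\<in>sector (- 1 / 4) (1 / 4). Hm z $ 1 $ 1 = Hp z $ 1 $ 1 \<and> Hm z $ 2 $ 1 = Hp z $ 2 $ 1"
      have "Hm 1 $ 1 $ 2 \<noteq> 0 \<or> Hm 1 $ 2 $ 2 \<noteq> 0" using detm by auto
      then have "c1 = 0" using bspec[OF * z1[unfolded neg]] e1[OF z1] by auto
      then show "stokes_c1 \<omega> l \<mu> = 0" using c by simp
    qed
  qed
qed

section \<open>Vanishing Stokes multipliers and entire solutions\<close>

abbreviation S_up :: "complex set" where "S_up \<equiv> sector (- 1 / 4) (pi + 1 / 4)"
abbreviation S_lo :: "complex set" where "S_lo \<equiv> sector (- pi - 1 / 4) (1 / 4)"
abbreviation Sig0 :: "complex set" where "Sig0 \<equiv> sector (pi - 1 / 4) (pi + 1 / 4)"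
abbreviation Sig1 :: "complex set" where "Sig1 \<equiv> sector (- 1 / 4) (1 / 4)"

lemma half_planes_in_sectors:
  assumes "z \<noteq> 0"
  shows "Im z \<ge> 0 \<Longrightarrow> z \<in> S_up" "Im z < 0 \<Longrightarrow> z \<in> S_lo"
proof -
  have z: "z = of_real (cmod z) * cis (Arg z)" using rcis_cmod_Arg[of z] by (simp add: rcis_def)
  have nz: "cmod z > 0" using assms by simp
  show "z \<in> S_up" if "Im z \<ge> 0"
  proof -
    have "0 \<le> Arg z" using that Arg_less_0 by blast
    then have "- 1 / 4 < Arg z" "Arg z < pi + 1 / 4" using Arg_le_pi[of z] by linarith+
    from polar_in_sector[OF nz this] z show ?thesis by metis
  qed
  show "z \<in> S_lo" if "Im z < 0"
  proof -
    have "Arg z < 0" using that Arg_neg_iff by blast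
    then have "- pi - 1 / 4 < Arg z" "Arg z < 1 / 4" using mpi_less_Arg[of z] by linarith+
    from polar_in_sector[OF nz this] z show ?thesis by metis
  qed
qed

lemma reals_in_overlaps:
  assumes "z \<noteq> 0" "Im z = 0"
  shows "z \<in> Sig0 \<or> z \<in> Sig1"
proof (cases "Re z > 0")
  case True
  then have "z = of_real (Re z)" using assms(2) by (simp add: complex_eq_iff)
  then show ?thesis using positive_reals_in_sector[of "- 1 / 4" "1 / 4" "Re z"] True by auto
next
  case False
  then have "- Re z > 0" "z = - of_real (- Re z)" using assms by (auto simp: complex_eq_iff)
  then show ?thesis using negative_reals_in_sector[of "pi - 1 / 4" "pi + 1 / 4" "- Re z"] by auto
qed

lemma overlap_subset: "Sig0 \<subseteq> S_up" "Sig0 \<subseteq> S_lo" "Sig1 \<subseteq> S_up" "Sig1 \<subseteq> S_lo"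
proof -
  have q: "0 < (1 / 4 :: real)" "1 / 4 < pi / 2" using pi_gt3 by auto
  have neg: "- (1 / 4) = (- 1 / 4 :: real)" by simp
  show "Sig0 \<subseteq> S_up" "Sig0 \<subseteq> S_lo" "Sig1 \<subseteq> S_up" "Sig1 \<subseteq> S_lo"
    using sigma0_subset[OF q(1) q] sigma1_subset[OF q q(1)] unfolding neg by blast+
qed

definition glue :: "(complex \<Rightarrow> complex) \<Rightarrow> (complex \<Rightarrow> complex) \<Rightarrow> complex \<Rightarrow> complex" where
  "glue f g z = (if Im z \<ge> 0 then f z else g z)"

lemma glue_eq:
  assumes "\<And>z. z \<in> Sig0 \<Longrightarrow> f z = g z" "\<And>z. z \<in> Sig1 \<Longrightarrow> f z = g z" "z \<in> Sig0 \<or> z \<in> Sig1"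
  shows "glue f g z = f z" "glue f g z = g z"
  using assms by (auto simp: glue_def)

lemma glue_derivative:
  assumes f: "\<And>z. z \<in> S_up \<Longrightarrow> (f has_field_derivative f1 z) (at z)"
    and g: "\<And>z. z \<in> S_lo \<Longrightarrow> (g has_field_derivative g1 z) (at z)"
    and eq: "\<And>z. z \<in> Sig0 \<Longrightarrow> f z = g z" "\<And>z. z \<in> Sig1 \<Longrightarrow> f z = g z"
    and z: "z \<noteq> 0"
  shows "(glue f g has_field_derivative glue f1 g1 z) (at z)"
proof -
  consider "Im z > 0" | "Im z < 0" | "Im z = 0" by linarith
  then show ?thesis
  proof cases
    case 1
    have "(f has_field_derivative f1 z) (at z)" by (rule f) (use half_planes_in_sectors[OF z] 1 in auto)
    then have "(glue f g has_field_derivative f1 z) (at z)"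
      by (rule has_field_derivative_transform_within_open[OF _ open_halfspace_Im_gt[of 0]])
        (use 1 in \<open>auto simp: glue_def\<close>)
    then show ?thesis using 1 by (simp add: glue_def)
  next
    case 2
    have "(g has_field_derivative g1 z) (at z)" by (rule g) (use half_planes_in_sectors[OF z] 2 in auto)
    then have "(glue f g has_field_derivative g1 z) (at z)"
      by (rule has_field_derivative_transform_within_open[OF _ open_halfspace_Im_lt[of 0]])
        (use 2 in \<open>auto simp: glue_def\<close>)
    then show ?thesis using 2 by (simp add: glue_def)
  next
    case 3
    have "z \<in> Sig0 \<union> Sig1" using reals_in_overlaps[OF z 3] by blast
    moreover have "(f has_field_derivative f1 z) (at z)" by (rule f) (use half_planes_in_sectors[OF z] 3 in auto)
    moreover have "open (Sig0 \<union> Sig1)" by (intro open_Un open_sector)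
    moreover have "f w = glue f g w" if "w \<in> Sig0 \<union> Sig1" for w
      using glue_eq(1)[of f g w, OF eq] that by simp
    ultimately have "(glue f g has_field_derivative f1 z) (at z)"
      using has_field_derivative_transform_within_open by blast
    then show ?thesis using 3 by (simp add: glue_def)
  qed
qed

lemma glue_tendsto_0:
  assumes f: "continuous_on (closure S_up) f" and g: "continuous_on (closure S_lo) g" and eq: "f 0 = g 0"
  shows "(glue f g \<longlongrightarrow> f 0) (at 0)"
proof -
  have sub: "w \<in> closure S_up" if "Im w \<ge> 0" "w \<noteq> 0" for w
    using half_planes_in_sectors(1)[OF that(2,1)] closure_subset by blast
  have sub': "w \<in> closure S_lo" if "Im w < 0" "w \<noteq> 0" for w
    using half_planes_in_sectors(2)[OF that(2,1)] closure_subset by blast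
  have pu: "of_real t * \<i> \<in> S_up" and pl: "of_real t * - \<i> \<in> S_lo" if "t > 0" for t
    using half_planes_in_sectors[of "of_real t * \<i>"] half_planes_in_sectors[of "of_real t * - \<i>"] that by auto
  have 0: "0 \<in> closure S_up" "0 \<in> closure S_lo"
    by (rule zero_in_closure_if_positive_reals[OF pu] zero_in_closure_if_positive_reals[OF pl]; assumption)+
  show ?thesis
  proof (rule tendstoI)
    fix e :: real assume e: "e > 0"
    obtain d1 where d1: "d1 > 0" "\<And>w. w \<in> closure S_up \<Longrightarrow> dist w 0 < d1 \<Longrightarrow> dist (f w) (f 0) < e"
      using f[unfolded continuous_on_iff] 0(1) e by blast
    obtain d2 where d2: "d2 > 0" "\<And>w. w \<in> closure S_lo \<Longrightarrow> dist w 0 < d2 \<Longrightarrow> dist (g w) (g 0) < e"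
      using g[unfolded continuous_on_iff] 0(2) e by blast
    have "dist (glue f g w) (f 0) < e" if w: "w \<noteq> 0" "dist w 0 < min d1 d2" for w
    proof (cases "Im w \<ge> 0")
      case True
      then show ?thesis using d1(2)[OF sub[OF True w(1)]] w(2) by (simp add: glue_def)
    next
      case False
      then have "Im w < 0" by simp
      then show ?thesis using d2(2)[OF sub'[OF \<open>Im w < 0\<close> w(1)]] w(2) eq by (simp add: glue_def)
    qed
    then show "\<forall>\<^sub>F w in at 0. dist (glue f g w) (f 0) < e"
      unfolding eventually_at using d1(1) d2(1) by (intro exI[of _ "min d1 d2"]) auto
  qed
qed

lemma entire_if_derivative_off_0:
  assumes d: "\<And>z. z \<noteq> 0 \<Longrightarrow> (G has_field_derivative G1 z) (at z)" and c: "(G \<longlongrightarrow> G 0) (at 0)"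
  shows "G holomorphic_on UNIV"
proof -
  have "continuous_on UNIV G"
  proof (intro continuous_at_imp_continuous_on ballI)
    fix z show "isCont G z"
      using c DERIV_isCont[OF d[of z]] by (cases "z = 0") (auto simp: isCont_def)
  qed
  moreover have "G holomorphic_on UNIV - {0}"
    using d by (subst holomorphic_on_open) auto
  ultimately show ?thesis
    by (intro no_isolated_singularity[of UNIV G "{0}"]) auto
qed

text \<open>Multiply by z / (2 i \<omega>): since (2 i \<omega>)^2 = - 4 \<omega>^2, the coupling of
  the two entries becomes the constant 1 / (4 \<omega>^2).\<close>

lemma second_order_iff:
  fixes z f0 f1 f2 :: complex
  assumes z: "z \<noteq> 0" and \<omega>: "\<omega> > 0"
  shows "2 * \<i> * of_real \<omega> * (f1 + z * f2) = dd l \<mu> z * (2 * \<i> * of_real \<omega> * z * f1) + 1 / (2 * \<i> * of_real \<omega> * z) * f0 \<longleftrightarrow>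
      z\<^sup>2 * f2 + (of_real (1 + l) * z + of_real \<mu> + of_real \<mu> * z\<^sup>2) * f1 + of_real (1 / (4 * \<omega>\<^sup>2)) * f0 = 0"
    "2 * \<i> * of_real \<omega> * (f1 + z * f2) = 1 / (2 * \<i> * of_real \<omega> * z) * f0 - dd l \<mu> z * (2 * \<i> * of_real \<omega> * z * f1) \<longleftrightarrow>
      z\<^sup>2 * f2 + (of_real (1 - l) * z - of_real \<mu> - of_real \<mu> * z\<^sup>2) * f1 + of_real (1 / (4 * \<omega>\<^sup>2)) * f0 = 0"
proof -
  define a where "a = 2 * \<i> * complex_of_real \<omega>"
  have a: "a \<noteq> 0" using \<omega> by (simp add: a_def)
  have "a\<^sup>2 = - of_real (4 * \<omega>\<^sup>2)" by (simp add: a_def power_mult_distrib)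
  then have c: "of_real (1 / (4 * \<omega>\<^sup>2)) = - 1 / a\<^sup>2" using \<omega> by (simp add: divide_simps)
  have D: "of_real l * z + of_real \<mu> + of_real \<mu> * z\<^sup>2 = - dd l \<mu> z * z\<^sup>2"
    using z by (simp add: dd_def field_simps power2_eq_square)
  have "z\<^sup>2 * f2 + (of_real (1 + l) * z + of_real \<mu> + of_real \<mu> * z\<^sup>2) * f1 + of_real (1 / (4 * \<omega>\<^sup>2)) * f0 =
      z\<^sup>2 * f2 + z * f1 + (of_real l * z + of_real \<mu> + of_real \<mu> * z\<^sup>2) * f1 - 1 / a\<^sup>2 * f0"
    unfolding c by (simp add: algebra_simps)
  also have "\<dots> = z / a * (a * (f1 + z * f2) - (dd l \<mu> z * (a * z * f1) + 1 / (a * z) * f0))"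
    unfolding D using a z by (simp add: field_simps power2_eq_square)
  finally show "2 * \<i> * of_real \<omega> * (f1 + z * f2) = dd l \<mu> z * (2 * \<i> * of_real \<omega> * z * f1) + 1 / (2 * \<i> * of_real \<omega> * z) * f0 \<longleftrightarrow>
      z\<^sup>2 * f2 + (of_real (1 + l) * z + of_real \<mu> + of_real \<mu> * z\<^sup>2) * f1 + of_real (1 / (4 * \<omega>\<^sup>2)) * f0 = 0"
    using a z by (simp add: a_def[symmetric])
  have "z\<^sup>2 * f2 + (of_real (1 - l) * z - of_real \<mu> - of_real \<mu> * z\<^sup>2) * f1 + of_real (1 / (4 * \<omega>\<^sup>2)) * f0 =
      z\<^sup>2 * f2 + z * f1 - (of_real l * z + of_real \<mu> + of_real \<mu> * z\<^sup>2) * f1 - 1 / a\<^sup>2 * f0"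
    unfolding c by (simp add: algebra_simps)
  also have "\<dots> = z / a * (a * (f1 + z * f2) - (1 / (a * z) * f0 - dd l \<mu> z * (a * z * f1)))"
    unfolding D using a z by (simp add: field_simps power2_eq_square)
  finally show "2 * \<i> * of_real \<omega> * (f1 + z * f2) = 1 / (2 * \<i> * of_real \<omega> * z) * f0 - dd l \<mu> z * (2 * \<i> * of_real \<omega> * z * f1) \<longleftrightarrow>
      z\<^sup>2 * f2 + (of_real (1 - l) * z - of_real \<mu> - of_real \<mu> * z\<^sup>2) * f1 + of_real (1 / (4 * \<omega>\<^sup>2)) * f0 = 0"
    using a z by (simp add: a_def[symmetric])
qed

definition entire_solution :: "complex \<Rightarrow> complex \<Rightarrow> complex \<Rightarrow> complex \<Rightarrow> complex \<Rightarrow> (complex \<Rightarrow> complex) \<Rightarrow> bool" where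
  "entire_solution \<alpha> \<beta> \<gamma> \<delta> \<epsilon> f \<longleftrightarrow> f holomorphic_on UNIV \<and>
    (\<forall>z. z\<^sup>2 * deriv (deriv f) z + (\<alpha> * z + \<beta> + \<gamma> * z\<^sup>2) * deriv f z + (\<delta> + \<epsilon> * z) * f z = 0)"

lemma entire_derivs:
  assumes "f holomorphic_on UNIV"
  shows "(f has_field_derivative deriv f z) (at z)" "(deriv f has_field_derivative deriv (deriv f) z) (at z)"
    "deriv f holomorphic_on UNIV" "deriv (deriv f) holomorphic_on UNIV"
  using assms by (auto intro!: holomorphic_derivI[of _ UNIV] holomorphic_deriv)

lemma entire_solutionI:
  assumes f: "f holomorphic_on UNIV"
    and ode: "\<And>z. z \<noteq> 0 \<Longrightarrow> z\<^sup>2 * deriv (deriv f) z + (\<alpha> * z + \<beta> + \<gamma> * z\<^sup>2) * deriv f z + (\<delta> + \<epsilon> * z) * f z = 0"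
  shows "entire_solution \<alpha> \<beta> \<gamma> \<delta> \<epsilon> f"
proof -
  define g where "g z = z\<^sup>2 * deriv (deriv f) z + (\<alpha> * z + \<beta> + \<gamma> * z\<^sup>2) * deriv f z + (\<delta> + \<epsilon> * z) * f z" for z
  have "g holomorphic_on UNIV"
    unfolding g_def by (intro holomorphic_intros entire_derivs f)
  then have "isCont g 0" using holomorphic_on_imp_continuous_on continuous_on_eq_continuous_at by blast
  then have "(g \<longlongrightarrow> g 0) (at 0)" by (simp add: isCont_def)
  moreover have "(g \<longlongrightarrow> 0) (at 0)"
    by (rule tendsto_eventually) (use ode in \<open>auto simp: g_def eventually_at_filter\<close>)
  ultimately have "g 0 = 0" using tendsto_unique at_neq_bot by blast
  then have "g z = 0" for z using ode by (cases "z = 0") (auto simp: g_def)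
  then show ?thesis using f by (simp add: entire_solution_def g_def)
qed

context
  fixes \<omega> l \<mu> :: real
  assumes \<omega>: "\<omega> > 0" and \<mu>: "\<mu> > 0"
begin

text \<open>Replacing a single column keeps \<open>nrm\<close>, so its uniqueness identifies the
  second columns on both sectors with the same entire function.\<close>

lemma nrm_column2:
  assumes n: "nrm \<omega> l \<mu> S p q r s" and S: "0 \<notin> S"
    and f: "entire_solution (of_real (1 + l)) (of_real \<mu>) (of_real \<mu>) (of_real (1 / (4 * \<omega>\<^sup>2))) 0 f" "f 0 = 1"
  shows "nrm \<omega> l \<mu> S p (\<lambda>z. 2 * \<i> * of_real \<omega> * z * deriv f z) r f"
proof -
  have h: "f holomorphic_on UNIV" using f(1) by (simp add: entire_solution_def)
  have c: "continuous_on (closure S) f" "continuous_on (closure S) (deriv f)"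
    using holomorphic_on_imp_continuous_on[OF h] holomorphic_on_imp_continuous_on[OF entire_derivs(3)[OF h]] continuous_on_subset by blast+
  have c': "continuous_on (closure S) (\<lambda>z. 2 * \<i> * of_real \<omega> * z * deriv f z)"
    by (intro continuous_intros c)
  have d1: "(f has_field_derivative 1 / (2 * \<i> * of_real \<omega> * z) * (2 * \<i> * of_real \<omega> * z * deriv f z)) (at z)" if "z \<in> S" for z
  proof -
    have "z \<noteq> 0" using that S by auto
    then show ?thesis using entire_derivs(1)[OF h, of z] \<omega> by simp
  qed
  have d2: "((\<lambda>z. 2 * \<i> * of_real \<omega> * z * deriv f z) has_field_derivative
      dd l \<mu> z * (2 * \<i> * of_real \<omega> * z * deriv f z) + 1 / (2 * \<i> * of_real \<omega> * z) * f z) (at z)" if "z \<in> S" for z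
  proof -
    have z: "z \<noteq> 0" using that S by auto
    have "((\<lambda>z. 2 * \<i> * of_real \<omega> * z * deriv f z) has_field_derivative 2 * \<i> * of_real \<omega> * (deriv f z + z * deriv (deriv f) z)) (at z)"
      by (rule derivative_eq_intros entire_derivs(2)[OF h] refl)+ (simp add: algebra_simps)
    moreover have "2 * \<i> * of_real \<omega> * (deriv f z + z * deriv (deriv f) z) =
        dd l \<mu> z * (2 * \<i> * of_real \<omega> * z * deriv f z) + 1 / (2 * \<i> * of_real \<omega> * z) * f z"
      unfolding second_order_iff(1)[OF z \<omega>] using f(1) by (simp add: entire_solution_def)
    ultimately show ?thesis by simp
  qed
  show ?thesis
    unfolding nrm_def by (intro conjI ballI nrmD[OF n] d1 d2 c c') (simp_all add: f(2))
qed

lemma nrm_column1: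
  assumes n: "nrm \<omega> l \<mu> S p q r s" and S: "0 \<notin> S"
    and f: "entire_solution (of_real (1 - l)) (- of_real \<mu>) (- of_real \<mu>) (of_real (1 / (4 * \<omega>\<^sup>2))) 0 f" "f 0 = 1"
  shows "nrm \<omega> l \<mu> S f q (\<lambda>z. 2 * \<i> * of_real \<omega> * z * deriv f z) s"
proof -
  have h: "f holomorphic_on UNIV" using f(1) by (simp add: entire_solution_def)
  have c: "continuous_on (closure S) f" "continuous_on (closure S) (deriv f)"
    using holomorphic_on_imp_continuous_on[OF h] holomorphic_on_imp_continuous_on[OF entire_derivs(3)[OF h]] continuous_on_subset by blast+
  have c': "continuous_on (closure S) (\<lambda>z. 2 * \<i> * of_real \<omega> * z * deriv f z)"
    by (intro continuous_intros c)
  have d1: "(f has_field_derivative 1 / (2 * \<i> * of_real \<omega> * z) * (2 * \<i> * of_real \<omega> * z * deriv f z)) (at z)" if "z \<in> S" for z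
  proof -
    have "z \<noteq> 0" using that S by auto
    then show ?thesis using entire_derivs(1)[OF h, of z] \<omega> by simp
  qed
  have d2: "((\<lambda>z. 2 * \<i> * of_real \<omega> * z * deriv f z) has_field_derivative
      1 / (2 * \<i> * of_real \<omega> * z) * f z - dd l \<mu> z * (2 * \<i> * of_real \<omega> * z * deriv f z)) (at z)" if "z \<in> S" for z
  proof -
    have z: "z \<noteq> 0" using that S by auto
    have "((\<lambda>z. 2 * \<i> * of_real \<omega> * z * deriv f z) has_field_derivative 2 * \<i> * of_real \<omega> * (deriv f z + z * deriv (deriv f) z)) (at z)"
      by (rule derivative_eq_intros entire_derivs(2)[OF h] refl)+ (simp add: algebra_simps)
    moreover have "2 * \<i> * of_real \<omega> * (deriv f z + z * deriv (deriv f) z) =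
        1 / (2 * \<i> * of_real \<omega> * z) * f z - dd l \<mu> z * (2 * \<i> * of_real \<omega> * z * deriv f z)"
      unfolding second_order_iff(2)[OF z \<omega>] using f(1) by (simp add: entire_solution_def)
    ultimately show ?thesis by simp
  qed
  show ?thesis
    unfolding nrm_def by (intro conjI ballI nrmD[OF n] d1 d2 c c') (simp_all add: f(2))
qed

text \<open>Serves both columns: f is the diagonal entry, and A is \<open>dd\<close> for the second
  column and \<open>- dd\<close> for the first. Agreement on both overlaps makes the function glued
  along the real axis holomorphic off 0, and continuity at the vertex removes the
  singularity.\<close>

lemma glued_entire:
  assumes f: "\<And>z. z \<in> S_up \<Longrightarrow> (f has_field_derivative 1 / (2 * \<i> * of_real \<omega> * z) * g z) (at z)"
      "\<And>z. z \<in> S_up \<Longrightarrow> (g has_field_derivative A z * g z + 1 / (2 * \<i> * of_real \<omega> * z) * f z) (at z)"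
    and f': "\<And>z. z \<in> S_lo \<Longrightarrow> (f' has_field_derivative 1 / (2 * \<i> * of_real \<omega> * z) * g' z) (at z)"
      "\<And>z. z \<in> S_lo \<Longrightarrow> (g' has_field_derivative A z * g' z + 1 / (2 * \<i> * of_real \<omega> * z) * f' z) (at z)"
    and cont: "continuous_on (closure S_up) f" "continuous_on (closure S_lo) f'" "f 0 = 1" "f' 0 = 1"
    and eq: "\<And>z. z \<in> Sig0 \<Longrightarrow> f z = f' z \<and> g z = g' z" "\<And>z. z \<in> Sig1 \<Longrightarrow> f z = f' z \<and> g z = g' z"
  obtains G where "G holomorphic_on UNIV" "G 0 = 1"
    "\<forall>z. z \<noteq> 0 \<longrightarrow> 2 * \<i> * of_real \<omega> * (deriv G z + z * deriv (deriv G) z) =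
       A z * (2 * \<i> * of_real \<omega> * z * deriv G z) + 1 / (2 * \<i> * of_real \<omega> * z) * G z"
proof -
  define G where "G = glue f f'"
  define Q where "Q = glue g g'"
  have G: "(G has_field_derivative 1 / (2 * \<i> * of_real \<omega> * z) * Q z) (at z)" if "z \<noteq> 0" for z
  proof -
    have "(G has_field_derivative glue (\<lambda>z. 1 / (2 * \<i> * of_real \<omega> * z) * g z) (\<lambda>z. 1 / (2 * \<i> * of_real \<omega> * z) * g' z) z) (at z)"
      unfolding G_def by (rule glue_derivative[OF f(1) f'(1) _ _ that]) (use eq in auto)
    then show ?thesis by (cases "Im z \<ge> 0") (simp_all add: Q_def glue_def)
  qed
  have Q: "(Q has_field_derivative A z * Q z + 1 / (2 * \<i> * of_real \<omega> * z) * G z) (at z)" if "z \<noteq> 0" for z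
  proof -
    have "(Q has_field_derivative glue (\<lambda>z. A z * g z + 1 / (2 * \<i> * of_real \<omega> * z) * f z) (\<lambda>z. A z * g' z + 1 / (2 * \<i> * of_real \<omega> * z) * f' z) z) (at z)"
      unfolding Q_def by (rule glue_derivative[OF f(2) f'(2) _ _ that]) (use eq in auto)
    then show ?thesis by (cases "Im z \<ge> 0") (simp_all add: G_def Q_def glue_def)
  qed
  have G0: "G 0 = 1" using cont by (simp add: G_def glue_def)
  have "(G \<longlongrightarrow> G 0) (at 0)"
    using glue_tendsto_0[OF cont(1,2)] cont(3,4) G0 by (simp add: G_def)
  then have h: "G holomorphic_on UNIV" by (rule entire_if_derivative_off_0[rotated]) (rule G)
  have Qe: "Q z = 2 * \<i> * of_real \<omega> * z * deriv G z" if "z \<noteq> 0" for z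
    using DERIV_imp_deriv[OF G[OF that]] that \<omega> by simp
  show ?thesis
  proof (rule that[OF h G0], intro allI impI)
    fix z :: complex assume z: "z \<noteq> 0"
    have "((\<lambda>z. 2 * \<i> * of_real \<omega> * z * deriv G z) has_field_derivative A z * Q z + 1 / (2 * \<i> * of_real \<omega> * z) * G z) (at z)"
      by (rule has_field_derivative_transform_within_open[OF Q[OF z], of "- {0}"]) (use z Qe in \<open>auto simp: open_Compl\<close>)
    moreover have "((\<lambda>z. 2 * \<i> * of_real \<omega> * z * deriv G z) has_field_derivative 2 * \<i> * of_real \<omega> * (deriv G z + z * deriv (deriv G) z)) (at z)"
      by (rule derivative_eq_intros entire_derivs(2)[OF h] refl)+ (simp add: algebra_simps)
    ultimately show "2 * \<i> * of_real \<omega> * (deriv G z + z * deriv (deriv G) z) =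
       A z * (2 * \<i> * of_real \<omega> * z * deriv G z) + 1 / (2 * \<i> * of_real \<omega> * z) * G z"
      unfolding Qe[OF z, symmetric] by (rule DERIV_unique[symmetric])
  qed
qed

lemma sectors_contain_reals:
  assumes "t > 0"
  shows "of_real t \<in> S_up" "- of_real t \<in> S_up" "of_real t \<in> S_lo" "- of_real t \<in> S_lo"
proof -
  have "of_real t \<in> Sig1" "- of_real t \<in> Sig0"
    using positive_reals_in_sector[of "- 1 / 4" "1 / 4" t] negative_reals_in_sector[of "pi - 1 / 4" "pi + 1 / 4" t] assms by simp_all
  then show "of_real t \<in> S_up" "- of_real t \<in> S_up" "of_real t \<in> S_lo" "- of_real t \<in> S_lo"
    using overlap_subset by blast+
qed

text \<open>The second columns always agree on the right overlap, and c0 = 0 adds the left one, so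
  they glue. Conversely, an entire solution is the second column on either sector by
  uniqueness.\<close>

theorem stokes_c0_zero_iff:
  "stokes_c0 \<omega> l \<mu> = 0 \<longleftrightarrow>
    (\<exists>f. entire_solution (of_real (1 + l)) (of_real \<mu>) (of_real \<mu>) (of_real (1 / (4 * \<omega>\<^sup>2))) 0 f \<and> f 0 = 1)"
proof -
  obtain p q r s p' q' r' s' where
    n: "nrm \<omega> l \<mu> S_up p q r s" and n': "nrm \<omega> l \<mu> S_lo p' q' r' s'"
    and "\<forall>z\<in>Sig0. p' z = p z \<and> r' z = r z"
    and e1: "\<forall>z\<in>Sig1. q' z = q z \<and> s' z = s z"
    and c0: "stokes_c0 \<omega> l \<mu> = 0 \<longleftrightarrow> (\<forall>z\<in>Sig0. q' z = q z \<and> s' z = s z)"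
    and "stokes_c1 \<omega> l \<mu> = 0 \<longleftrightarrow> (\<forall>z\<in>Sig1. p' z = p z \<and> r' z = r z)"
    by (rule stokes_structure[where l = l, OF \<omega> \<mu>])
  show ?thesis
  proof
    assume "stokes_c0 \<omega> l \<mu> = 0"
    then have e0: "\<And>z. z \<in> Sig0 \<Longrightarrow> q' z = q z \<and> s' z = s z" using c0 by blast
    obtain G where G: "G holomorphic_on UNIV" "G 0 = 1"
      "\<forall>z. z \<noteq> 0 \<longrightarrow> 2 * \<i> * of_real \<omega> * (deriv G z + z * deriv (deriv G) z) =
         dd l \<mu> z * (2 * \<i> * of_real \<omega> * z * deriv G z) + 1 / (2 * \<i> * of_real \<omega> * z) * G z"
    proof (rule glued_entire[OF nrmD(4,2)[OF n] nrmD(4,2)[OF n'] nrmD(8)[OF n] nrmD(8)[OF n'] nrmD(12)[OF n] nrmD(12)[OF n']])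
      show "s z = s' z \<and> q z = q' z" if "z \<in> Sig0" for z using e0 that by simp
      show "s z = s' z \<and> q z = q' z" if "z \<in> Sig1" for z using e1 that by simp
    qed
    have "entire_solution (of_real (1 + l)) (of_real \<mu>) (of_real \<mu>) (of_real (1 / (4 * \<omega>\<^sup>2))) 0 G"
    proof (rule entire_solutionI[OF G(1)])
      fix z :: complex assume z: "z \<noteq> 0"
      show "z\<^sup>2 * deriv (deriv G) z + (of_real (1 + l) * z + of_real \<mu> + of_real \<mu> * z\<^sup>2) * deriv G z + (of_real (1 / (4 * \<omega>\<^sup>2)) + 0 * z) * G z = 0"
        using G(3)[rule_format, OF z] unfolding second_order_iff(1)[OF z \<omega>] by simp
    qed
    then show "\<exists>f. entire_solution (of_real (1 + l)) (of_real \<mu>) (of_real \<mu>) (of_real (1 / (4 * \<omega>\<^sup>2))) 0 f \<and> f 0 = 1"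
      using G(2) by blast
  next
    assume "\<exists>f. entire_solution (of_real (1 + l)) (of_real \<mu>) (of_real \<mu>) (of_real (1 / (4 * \<omega>\<^sup>2))) 0 f \<and> f 0 = 1"
    then obtain f where f: "entire_solution (of_real (1 + l)) (of_real \<mu>) (of_real \<mu>) (of_real (1 / (4 * \<omega>\<^sup>2))) 0 f" "f 0 = 1" by blast
    have u: "p z = p z \<and> 2 * \<i> * of_real \<omega> * z * deriv f z = q z \<and> r z = r z \<and> f z = s z" if "z \<in> S_up" for z
      by (rule nrm_unique[OF open_sector connected_sector _ _ \<mu> n nrm_column2[OF n zero_notin_sector f] that])
        (erule sectors_contain_reals)+
    have u': "p' z = p' z \<and> 2 * \<i> * of_real \<omega> * z * deriv f z = q' z \<and> r' z = r' z \<and> f z = s' z" if "z \<in> S_lo" for z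
      by (rule nrm_unique[OF open_sector connected_sector _ _ \<mu> n' nrm_column2[OF n' zero_notin_sector f] that])
        (erule sectors_contain_reals)+
    have "q' z = q z \<and> s' z = s z" if "z \<in> Sig0" for z
      using u[OF subsetD[OF overlap_subset(1) that]] u'[OF subsetD[OF overlap_subset(2) that]] by metis
    then show "stokes_c0 \<omega> l \<mu> = 0" using c0 by blast
  qed
qed

text \<open>The same argument with the columns and the overlaps exchanged: first columns always
  agree on the left overlap.\<close>

theorem stokes_c1_zero_iff:
  "stokes_c1 \<omega> l \<mu> = 0 \<longleftrightarrow>
    (\<exists>f. entire_solution (of_real (1 - l)) (- of_real \<mu>) (- of_real \<mu>) (of_real (1 / (4 * \<omega>\<^sup>2))) 0 f \<and> f 0 = 1)"
proof -
  obtain p q r s p' q' r' s' where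
    n: "nrm \<omega> l \<mu> S_up p q r s" and n': "nrm \<omega> l \<mu> S_lo p' q' r' s'"
    and e0: "\<forall>z\<in>Sig0. p' z = p z \<and> r' z = r z"
    and "\<forall>z\<in>Sig1. q' z = q z \<and> s' z = s z"
    and "stokes_c0 \<omega> l \<mu> = 0 \<longleftrightarrow> (\<forall>z\<in>Sig0. q' z = q z \<and> s' z = s z)"
    and c1: "stokes_c1 \<omega> l \<mu> = 0 \<longleftrightarrow> (\<forall>z\<in>Sig1. p' z = p z \<and> r' z = r z)"
    by (rule stokes_structure[where l = l, OF \<omega> \<mu>])
  show ?thesis
  proof
    assume "stokes_c1 \<omega> l \<mu> = 0"
    then have e1: "\<And>z. z \<in> Sig1 \<Longrightarrow> p' z = p z \<and> r' z = r z" using c1 by blast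
    have d: "(r has_field_derivative - dd l \<mu> z * r z + 1 / (2 * \<i> * of_real \<omega> * z) * p z) (at z)" if "z \<in> S_up" for z
      using nrmD(3)[OF n that] by (simp add: algebra_simps)
    have d': "(r' has_field_derivative - dd l \<mu> z * r' z + 1 / (2 * \<i> * of_real \<omega> * z) * p' z) (at z)" if "z \<in> S_lo" for z
      using nrmD(3)[OF n' that] by (simp add: algebra_simps)
    obtain G where G: "G holomorphic_on UNIV" "G 0 = 1"
      "\<forall>z. z \<noteq> 0 \<longrightarrow> 2 * \<i> * of_real \<omega> * (deriv G z + z * deriv (deriv G) z) =
         - dd l \<mu> z * (2 * \<i> * of_real \<omega> * z * deriv G z) + 1 / (2 * \<i> * of_real \<omega> * z) * G z"
    proof (rule glued_entire[OF nrmD(1)[OF n] d nrmD(1)[OF n'] d' nrmD(5)[OF n] nrmD(5)[OF n'] nrmD(9)[OF n] nrmD(9)[OF n']])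
      show "p z = p' z \<and> r z = r' z" if "z \<in> Sig0" for z using e0 that by simp
      show "p z = p' z \<and> r z = r' z" if "z \<in> Sig1" for z using e1 that by simp
    qed
    have "entire_solution (of_real (1 - l)) (- of_real \<mu>) (- of_real \<mu>) (of_real (1 / (4 * \<omega>\<^sup>2))) 0 G"
    proof (rule entire_solutionI[OF G(1)])
      fix z :: complex assume z: "z \<noteq> 0"
      have "2 * \<i> * of_real \<omega> * (deriv G z + z * deriv (deriv G) z) =
         1 / (2 * \<i> * of_real \<omega> * z) * G z - dd l \<mu> z * (2 * \<i> * of_real \<omega> * z * deriv G z)"
        using G(3)[rule_format, OF z] by (simp add: algebra_simps)
      then show "z\<^sup>2 * deriv (deriv G) z + (of_real (1 - l) * z + - of_real \<mu> + - of_real \<mu> * z\<^sup>2) * deriv G z + (of_real (1 / (4 * \<omega>\<^sup>2)) + 0 * z) * G z = 0"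
        unfolding second_order_iff(2)[OF z \<omega>] by simp
    qed
    then show "\<exists>f. entire_solution (of_real (1 - l)) (- of_real \<mu>) (- of_real \<mu>) (of_real (1 / (4 * \<omega>\<^sup>2))) 0 f \<and> f 0 = 1"
      using G(2) by blast
  next
    assume "\<exists>f. entire_solution (of_real (1 - l)) (- of_real \<mu>) (- of_real \<mu>) (of_real (1 / (4 * \<omega>\<^sup>2))) 0 f \<and> f 0 = 1"
    then obtain f where f: "entire_solution (of_real (1 - l)) (- of_real \<mu>) (- of_real \<mu>) (of_real (1 / (4 * \<omega>\<^sup>2))) 0 f" "f 0 = 1" by blast
    have u: "f z = p z \<and> q z = q z \<and> 2 * \<i> * of_real \<omega> * z * deriv f z = r z \<and> s z = s z" if "z \<in> S_up" for z
      by (rule nrm_unique[OF open_sector connected_sector _ _ \<mu> n nrm_column1[OF n zero_notin_sector f] that])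
        (erule sectors_contain_reals)+
    have u': "f z = p' z \<and> q' z = q' z \<and> 2 * \<i> * of_real \<omega> * z * deriv f z = r' z \<and> s' z = s' z" if "z \<in> S_lo" for z
      by (rule nrm_unique[OF open_sector connected_sector _ _ \<mu> n' nrm_column1[OF n' zero_notin_sector f] that])
        (erule sectors_contain_reals)+
    have "p' z = p z \<and> r' z = r z" if "z \<in> Sig1" for z
      using u[OF subsetD[OF overlap_subset(3) that]] u'[OF subsetD[OF overlap_subset(4) that]] by metis
    then show "stokes_c1 \<omega> l \<mu> = 0" using c1 by blast
  qed
qed

end

section \<open>Symmetries and derivatives of entire solutions\<close>

lemma entire_solution_reflect:
  assumes "entire_solution \<alpha> \<beta> \<gamma> \<delta> \<epsilon> f"
  shows "entire_solution \<alpha> (- \<beta>) (- \<gamma>) \<delta> (- \<epsilon>) (\<lambda>z. f (- z))"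
proof -
  have h: "f holomorphic_on UNIV"
    and ode: "\<And>z. z\<^sup>2 * deriv (deriv f) z + (\<alpha> * z + \<beta> + \<gamma> * z\<^sup>2) * deriv f z + (\<delta> + \<epsilon> * z) * f z = 0"
    using assms by (auto simp: entire_solution_def)
  have neg: "(uminus has_field_derivative (- 1 :: complex)) (at z)" for z
    by (auto intro!: derivative_eq_intros)
  have d1: "((\<lambda>z. f (- z)) has_field_derivative - deriv f (- z)) (at z)" for z
    using DERIV_chain2[OF entire_derivs(1)[OF h] neg] by simp
  have d2: "((\<lambda>z. - deriv f (- z)) has_field_derivative deriv (deriv f) (- z)) (at z)" for z
    using DERIV_minus[OF DERIV_chain2[OF entire_derivs(2)[OF h] neg]] by simp
  have e1: "deriv (\<lambda>z. f (- z)) = (\<lambda>z. - deriv f (- z))" using DERIV_imp_deriv[OF d1] by auto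
  have e2: "deriv (\<lambda>z. - deriv f (- z)) = (\<lambda>z. deriv (deriv f) (- z))" using DERIV_imp_deriv[OF d2] by auto
  have "(\<lambda>z. f (- z)) holomorphic_on UNIV" using d1 by (auto simp: holomorphic_on_open)
  then show ?thesis
    unfolding entire_solution_def e1 e2
  proof (intro conjI allI)
    fix z
    show "z\<^sup>2 * deriv (deriv f) (- z) + (\<alpha> * z + - \<beta> + - \<gamma> * z\<^sup>2) * - deriv f (- z) + (\<delta> + - \<epsilon> * z) * f (- z) = 0"
      using ode[of "- z"] by (simp add: algebra_simps)
  qed
qed

text \<open>The exponent is chosen so that the cross term 2 \<gamma> z^2 f' of the second derivative
  flips the sign of the z^2 coefficient, while the terms in z^2 f cancel.\<close>

lemma entire_solution_exp:
  assumes "entire_solution \<alpha> \<beta> \<gamma> \<delta> \<epsilon> f"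
  shows "entire_solution \<alpha> \<beta> (- \<gamma>) (\<delta> - \<gamma> * \<beta>) (\<epsilon> - \<gamma> * \<alpha>) (\<lambda>z. exp (\<gamma> * z) * f z)"
proof -
  have h: "f holomorphic_on UNIV"
    and ode: "\<And>z. z\<^sup>2 * deriv (deriv f) z + (\<alpha> * z + \<beta> + \<gamma> * z\<^sup>2) * deriv f z + (\<delta> + \<epsilon> * z) * f z = 0"
    using assms by (auto simp: entire_solution_def)
  define g where "g z = exp (\<gamma> * z) * f z" for z
  define g1 where "g1 z = exp (\<gamma> * z) * (deriv f z + \<gamma> * f z)" for z
  define g2 where "g2 z = exp (\<gamma> * z) * (deriv (deriv f) z + 2 * \<gamma> * deriv f z + \<gamma>\<^sup>2 * f z)" for z
  have d1: "(g has_field_derivative g1 z) (at z)" for z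
    unfolding g_def[abs_def] g1_def
    by (rule derivative_eq_intros entire_derivs(1)[OF h] refl)+ (simp add: algebra_simps)
  have d2: "(g1 has_field_derivative g2 z) (at z)" for z
    unfolding g1_def[abs_def] g2_def
    by (rule derivative_eq_intros entire_derivs(1,2)[OF h] refl)+ (simp add: algebra_simps power2_eq_square)
  have e1: "deriv g = g1" using DERIV_imp_deriv[OF d1] by auto
  have e2: "deriv g1 = g2" using DERIV_imp_deriv[OF d2] by auto
  have "g holomorphic_on UNIV" using d1 by (auto simp: holomorphic_on_open)
  moreover have "z\<^sup>2 * g2 z + (\<alpha> * z + \<beta> + - \<gamma> * z\<^sup>2) * g1 z + ((\<delta> - \<gamma> * \<beta>) + (\<epsilon> - \<gamma> * \<alpha>) * z) * g z = 0" for z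
  proof -
    have "z\<^sup>2 * g2 z + (\<alpha> * z + \<beta> + - \<gamma> * z\<^sup>2) * g1 z + ((\<delta> - \<gamma> * \<beta>) + (\<epsilon> - \<gamma> * \<alpha>) * z) * g z =
      exp (\<gamma> * z) * (z\<^sup>2 * deriv (deriv f) z + (\<alpha> * z + \<beta> + \<gamma> * z\<^sup>2) * deriv f z + (\<delta> + \<epsilon> * z) * f z)"
      by (simp add: g_def g1_def g2_def algebra_simps power2_eq_square)
    then show ?thesis by (simp add: ode)
  qed
  ultimately have "entire_solution \<alpha> \<beta> (- \<gamma>) (\<delta> - \<gamma> * \<beta>) (\<epsilon> - \<gamma> * \<alpha>) g"
    unfolding entire_solution_def e1 e2 by blast
  then show ?thesis by (simp add: g_def[abs_def])
qed

lemma entire_solution_scale: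
  assumes "entire_solution \<alpha> \<beta> \<gamma> \<delta> \<epsilon> f"
  shows "entire_solution \<alpha> \<beta> \<gamma> \<delta> \<epsilon> (\<lambda>z. a * f z)"
proof -
  have h: "f holomorphic_on UNIV" using assms by (simp add: entire_solution_def)
  have d: "((\<lambda>z. a * f z) has_field_derivative a * deriv f z) (at z)"
    "((\<lambda>z. a * deriv f z) has_field_derivative a * deriv (deriv f) z) (at z)" for z
    by (intro DERIV_cmult entire_derivs[OF h])+
  have e: "deriv (\<lambda>z. a * f z) = (\<lambda>z. a * deriv f z)" "deriv (\<lambda>z. a * deriv f z) = (\<lambda>z. a * deriv (deriv f) z)"
    using DERIV_imp_deriv[OF d(1)] DERIV_imp_deriv[OF d(2)] by auto
  have "z\<^sup>2 * (a * deriv (deriv f) z) + (\<alpha> * z + \<beta> + \<gamma> * z\<^sup>2) * (a * deriv f z) + (\<delta> + \<epsilon> * z) * (a * f z) = 0" for z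
  proof -
    have "a * (z\<^sup>2 * deriv (deriv f) z + (\<alpha> * z + \<beta> + \<gamma> * z\<^sup>2) * deriv f z + (\<delta> + \<epsilon> * z) * f z) = 0"
      using assms by (simp add: entire_solution_def)
    then show ?thesis by (simp add: algebra_simps)
  qed
  moreover have "(\<lambda>z. a * f z) holomorphic_on UNIV" by (intro holomorphic_intros h)
  ultimately show ?thesis unfolding entire_solution_def e by blast
qed

lemma higher_deriv_entire:
  assumes "f holomorphic_on UNIV"
  shows "((deriv ^^ n) f has_field_derivative (deriv ^^ Suc n) f z) (at z)" "(deriv ^^ n) f holomorphic_on UNIV"
  using assms by (auto intro!: holomorphic_derivI[of _ UNIV] holomorphic_higher_deriv)

lemma entire_solution_leibniz:
  assumes f: "entire_solution \<alpha> \<beta> \<gamma> \<delta> \<epsilon> f"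
  shows "z\<^sup>2 * (deriv ^^ (n + 2)) f z + ((\<alpha> + 2 * of_nat n) * z + \<beta> + \<gamma> * z\<^sup>2) * (deriv ^^ (n + 1)) f z
     + (\<delta> + of_nat n * (of_nat n - 1) + of_nat n * \<alpha> + (\<epsilon> + 2 * of_nat n * \<gamma>) * z) * (deriv ^^ n) f z
     + (of_nat n * (of_nat n - 1) * \<gamma> + of_nat n * \<epsilon>) * (deriv ^^ (n - 1)) f z = 0"
proof (rule leibniz_ode[of UNIV "\<lambda>n. (deriv ^^ n) f"])
  have h: "f holomorphic_on UNIV" using f by (simp add: entire_solution_def)
  show "((deriv ^^ n) f has_field_derivative (deriv ^^ Suc n) f z) (at z)" for n z
    by (rule higher_deriv_entire(1)[OF h])
  show "z\<^sup>2 * (deriv ^^ 2) f z + (\<alpha> * z + \<beta> + \<gamma> * z\<^sup>2) * (deriv ^^ 1) f z + (\<delta> + \<epsilon> * z) * (deriv ^^ 0) f z = 0" for z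
    using f by (simp add: entire_solution_def numeral_2_eq_2)
qed auto

text \<open>At z = 0 the n times differentiated equation expresses \<beta> times the derivative of
  order n + 1 by lower ones. So f(0) determines all Taylor coefficients, although 0 is a singular
  point.\<close>

lemma entire_solution_zero:
  assumes f: "entire_solution \<alpha> \<beta> \<gamma> \<delta> \<epsilon> f" and \<beta>: "\<beta> \<noteq> 0" and f0: "f 0 = 0"
  shows "f z = 0"
proof -
  have h: "f holomorphic_on UNIV" using f by (simp add: entire_solution_def)
  have "(deriv ^^ k) f 0 = 0" for k
  proof (induction k rule: less_induct)
    case (less k)
    show ?case
    proof (cases k)
      case 0
      then show ?thesis using f0 by simp
    next
      case (Suc n)
      have "(deriv ^^ n) f 0 = 0" using less.IH[of n] Suc by simp
      moreover have "n - 1 < k" using Suc by simp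
      then have "(deriv ^^ (n - 1)) f 0 = 0" by (rule less.IH)
      ultimately have "\<beta> * (deriv ^^ (n + 1)) f 0 = 0"
        using entire_solution_leibniz[OF f, of 0 n] by simp
      then show ?thesis using \<beta> Suc by simp
    qed
  qed
  then show ?thesis
    using holomorphic_fun_eq_0_on_connected[OF h open_UNIV connected_UNIV] by blast
qed

text \<open>With this zero-order coefficient the term of order n - 1 in the differentiated equation
  cancels, and n (n - 1) + n (1 - n) = 0 leaves \<delta> unchanged.\<close>

lemma entire_solution_higher_deriv:
  assumes f: "entire_solution (1 - of_nat n) \<mu> (- \<mu>) \<delta> (\<mu> * (of_nat n - 1)) f"
  shows "entire_solution (1 + of_nat n) \<mu> (- \<mu>) \<delta> (- \<mu> * (1 + of_nat n)) ((deriv ^^ n) f)"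
proof -
  have h: "f holomorphic_on UNIV" using f by (simp add: entire_solution_def)
  have "z\<^sup>2 * (deriv ^^ (n + 2)) f z + ((1 + of_nat n) * z + \<mu> + - \<mu> * z\<^sup>2) * (deriv ^^ (n + 1)) f z +
      (\<delta> + - \<mu> * (1 + of_nat n) * z) * (deriv ^^ n) f z = 0" for z
    using entire_solution_leibniz[OF f, of z n] by (simp add: algebra_simps)
  then show ?thesis
    using higher_deriv_entire(2)[OF h] by (simp add: entire_solution_def)
qed

lemma taylor_polynomial:
  assumes h: "f holomorphic_on UNIV" and n: "\<And>z. (deriv ^^ n) f z = 0"
  shows "f z = (\<Sum>k<n. (deriv ^^ k) f 0 / fact k * z ^ k)"
proof -
  have "(deriv ^^ (n + j)) f = (\<lambda>z. 0)" for j
  proof (induction j)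
    case 0
    then show ?case using n by auto
  next
    case (Suc j)
    then show ?case by simp
  qed
  then have z: "(deriv ^^ k) f 0 = 0" if "k \<ge> n" for k
    using that by (metis le_add_diff_inverse)
  have "(\<lambda>k. (deriv ^^ k) f 0 / fact k * (z - 0) ^ k) sums f z"
    by (rule holomorphic_power_series[of f 0 "cmod z + 1"]) (auto intro: holomorphic_on_subset[OF h])
  moreover have "(\<lambda>k. (deriv ^^ k) f 0 / fact k * (z - 0) ^ k) sums (\<Sum>k<n. (deriv ^^ k) f 0 / fact k * (z - 0) ^ k)"
    by (rule sums_finite) (auto simp: z)
  ultimately show ?thesis using sums_unique2 by fastforce
qed

text \<open>The factor exp (\<mu> z) and its inverse pass between the two equations and keep the
  value at 0.\<close>

lemma stokes_c0_zero_iff_entire: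
  assumes \<omega>: "\<omega> > 0" and \<mu>: "\<mu> > 0"
  shows "stokes_c0 \<omega> l \<mu> = 0 \<longleftrightarrow>
    (\<exists>f. entire_solution (1 + of_real l) (of_real \<mu>) (- of_real \<mu>) (of_real (1 / (4 * \<omega>\<^sup>2) - \<mu>\<^sup>2)) (- of_real \<mu> * (1 + of_real l)) f \<and> f 0 = 1)"
  unfolding stokes_c0_zero_iff[OF \<omega> \<mu>]
proof
  assume "\<exists>f. entire_solution (of_real (1 + l)) (of_real \<mu>) (of_real \<mu>) (of_real (1 / (4 * \<omega>\<^sup>2))) 0 f \<and> f 0 = 1"
  then obtain f where f: "entire_solution (of_real (1 + l)) (of_real \<mu>) (of_real \<mu>) (of_real (1 / (4 * \<omega>\<^sup>2))) 0 f" "f 0 = 1" by blast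
  from entire_solution_exp[OF f(1)] f(2)
  show "\<exists>f. entire_solution (1 + of_real l) (of_real \<mu>) (- of_real \<mu>) (of_real (1 / (4 * \<omega>\<^sup>2) - \<mu>\<^sup>2)) (- of_real \<mu> * (1 + of_real l)) f \<and> f 0 = 1"
    by (intro exI[of _ "\<lambda>z. exp (of_real \<mu> * z) * f z"]) (simp add: power2_eq_square)
next
  assume "\<exists>f. entire_solution (1 + of_real l) (of_real \<mu>) (- of_real \<mu>) (of_real (1 / (4 * \<omega>\<^sup>2) - \<mu>\<^sup>2)) (- of_real \<mu> * (1 + of_real l)) f \<and> f 0 = 1"
  then obtain f where f: "entire_solution (1 + of_real l) (of_real \<mu>) (- of_real \<mu>) (of_real (1 / (4 * \<omega>\<^sup>2) - \<mu>\<^sup>2)) (- of_real \<mu> * (1 + of_real l)) f" "f 0 = 1" by blast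
  from entire_solution_exp[OF f(1)] f(2)
  show "\<exists>f. entire_solution (of_real (1 + l)) (of_real \<mu>) (of_real \<mu>) (of_real (1 / (4 * \<omega>\<^sup>2))) 0 f \<and> f 0 = 1"
    by (intro exI[of _ "\<lambda>z. exp (- of_real \<mu> * z) * f z"]) (simp add: power2_eq_square)
qed

text \<open>The exponential corrects the sign of the z^2 coefficient but then leaves - \<mu> and
  \<mu> interchanged; the reflection swaps them.\<close>

lemma stokes_c1_zero_iff_entire:
  assumes \<omega>: "\<omega> > 0" and \<mu>: "\<mu> > 0"
  shows "stokes_c1 \<omega> l \<mu> = 0 \<longleftrightarrow>
    (\<exists>f. entire_solution (1 - of_real l) (of_real \<mu>) (- of_real \<mu>) (of_real (1 / (4 * \<omega>\<^sup>2) - \<mu>\<^sup>2)) (of_real \<mu> * (of_real l - 1)) f \<and> f 0 = 1)"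
  unfolding stokes_c1_zero_iff[OF \<omega> \<mu>]
proof
  assume "\<exists>f. entire_solution (of_real (1 - l)) (- of_real \<mu>) (- of_real \<mu>) (of_real (1 / (4 * \<omega>\<^sup>2))) 0 f \<and> f 0 = 1"
  then obtain f where f: "entire_solution (of_real (1 - l)) (- of_real \<mu>) (- of_real \<mu>) (of_real (1 / (4 * \<omega>\<^sup>2))) 0 f" "f 0 = 1" by blast
  from entire_solution_reflect[OF entire_solution_exp[OF f(1)]] f(2)
  show "\<exists>f. entire_solution (1 - of_real l) (of_real \<mu>) (- of_real \<mu>) (of_real (1 / (4 * \<omega>\<^sup>2) - \<mu>\<^sup>2)) (of_real \<mu> * (of_real l - 1)) f \<and> f 0 = 1"
    by (intro exI[of _ "\<lambda>z. exp (- of_real \<mu> * - z) * f (- z)"]) (simp add: power2_eq_square algebra_simps)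
next
  assume "\<exists>f. entire_solution (1 - of_real l) (of_real \<mu>) (- of_real \<mu>) (of_real (1 / (4 * \<omega>\<^sup>2) - \<mu>\<^sup>2)) (of_real \<mu> * (of_real l - 1)) f \<and> f 0 = 1"
  then obtain f where f: "entire_solution (1 - of_real l) (of_real \<mu>) (- of_real \<mu>) (of_real (1 / (4 * \<omega>\<^sup>2) - \<mu>\<^sup>2)) (of_real \<mu> * (of_real l - 1)) f" "f 0 = 1" by blast
  from entire_solution_exp[OF entire_solution_reflect[OF f(1)]] f(2)
  show "\<exists>f. entire_solution (of_real (1 - l)) (- of_real \<mu>) (- of_real \<mu>) (of_real (1 / (4 * \<omega>\<^sup>2))) 0 f \<and> f 0 = 1"
    by (intro exI[of _ "\<lambda>z. exp (of_real \<mu> * z) * f (- z)"]) (simp add: power2_eq_square algebra_simps)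
qed

section \<open>Polynomial solutions\<close>

text \<open>This is 2 pi I_m(2 t), with I_m the modified Bessel function. The argument 2 t removes
  the factor 1 / 2 from the recurrence for the derivative.\<close>

definition bessel_int :: "real \<Rightarrow> int \<Rightarrow> real" where
  "bessel_int t m = integral {-pi..pi} (\<lambda>\<tau>. exp (2 * t * cos \<tau>) * cos (of_int m * \<tau>))"

lemma bessel_int_minus: "bessel_int t (- m) = bessel_int t m"
  by (simp add: bessel_int_def)

lemma bessel_int_heat_flow:
  assumes T: "T > 0"
  shows "lattice_heat_flow bessel_int T (2 * pi * exp (2 * T)) (2 * pi)"
proof
  fix t :: real and m :: int
  have "((\<lambda>t. integral (cbox (-pi) pi) (\<lambda>\<tau>. exp (2 * t * cos \<tau>) * cos (of_int m * \<tau>))) has_field_derivative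
     integral (cbox (-pi) pi) (\<lambda>\<tau>. 2 * cos \<tau> * exp (2 * t * cos \<tau>) * cos (of_int m * \<tau>))) (at t within UNIV)"
    by (rule leibniz_rule_field_derivative)
       (auto intro!: derivative_eq_intros integrable_continuous_real continuous_intros simp: case_prod_beta)
  moreover have "integral (cbox (-pi) pi) (\<lambda>\<tau>. 2 * cos \<tau> * exp (2 * t * cos \<tau>) * cos (of_int m * \<tau>)) =
      bessel_int t (m - 1) + bessel_int t (m + 1)"
  proof -
    have "(\<lambda>\<tau>. 2 * cos \<tau> * exp (2 * t * cos \<tau>) * cos (of_int m * \<tau>)) =
        (\<lambda>\<tau>. exp (2 * t * cos \<tau>) * cos (of_int (m - 1) * \<tau>) + exp (2 * t * cos \<tau>) * cos (of_int (m + 1) * \<tau>))"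
      by (auto simp: ring_distribs cos_add cos_diff)
    moreover have int: "(\<lambda>\<tau>. exp (2 * t * cos \<tau>) * cos (of_int k * \<tau>)) integrable_on {-pi..pi}" for k :: int
      by (intro integrable_continuous_real continuous_intros)
    ultimately show ?thesis
      using Henstock_Kurzweil_Integration.integral_add[OF int[of "m - 1"] int[of "m + 1"]]
      unfolding bessel_int_def by (simp only: cbox_interval)
  qed
  ultimately show "((\<lambda>t. bessel_int t m) has_real_derivative bessel_int t (m - 1) + bessel_int t (m + 1)) (at t)"
    by (simp add: bessel_int_def)
next
  fix m :: int
  show "bessel_int 0 m = (if m = 0 then 2 * pi else 0)"
  proof (cases "m = 0")
    case False
    have "((\<lambda>\<tau>. cos (of_int m * \<tau>)) has_integral
        sin (of_int m * pi) / of_int m - sin (of_int m * (- pi)) / of_int m) {-pi..pi}"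
      by (rule fundamental_theorem_of_calculus)
         (use False in \<open>auto intro!: derivative_eq_intros simp: has_real_derivative_iff_has_vector_derivative[symmetric]\<close>)
    then show ?thesis
      using False by (simp add: bessel_int_def integral_unique sin_times_pi_eq_0)
  qed (simp add: bessel_int_def)
next
  fix t :: real and m :: int assume t: "0 \<le> t" "t \<le> T"
  have "norm (bessel_int t m) \<le> exp (2 * T) * (pi - - pi)"
    unfolding bessel_int_def
  proof (rule integral_bound)
    fix \<tau> :: real
    have "\<bar>exp (2 * t * cos \<tau>) * cos (of_int m * \<tau>)\<bar> \<le> exp (2 * T) * 1"
      unfolding abs_mult
    proof (intro mult_mono)
      have "t * cos \<tau> \<le> t * 1" using t by (intro mult_left_mono) auto
      then show "\<bar>exp (2 * t * cos \<tau>)\<bar> \<le> exp (2 * T)" using t by simp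
    qed auto
    then show "norm (exp (2 * t * cos \<tau>) * cos (of_int m * \<tau>)) \<le> exp (2 * T)" by simp
  qed (auto intro!: continuous_intros)
  then show "\<bar>bessel_int t m\<bar> \<le> 2 * pi * exp (2 * T)" by (simp add: mult_ac)
qed (use T in auto)

text \<open>The matrix belongs to the configuration shifted by one, whose determinant is positive at
  time \<mu>. As it is real, complex coefficients split into real and imaginary parts.\<close>

lemma bessel_toeplitz_injective:
  assumes \<mu>: "\<mu> > 0"
    and eq: "\<And>i. i < n \<Longrightarrow> (\<Sum>j<n. a j * complex_of_real (bessel_int \<mu> (int i + 1 - int j))) = 0"
    and k: "k < n"
  shows "a k = 0"
proof -
  interpret lattice_heat_flow bessel_int \<mu> "2 * pi * exp (2 * \<mu>)" "2 * pi"
    by (rule bessel_int_heat_flow[OF \<mu>])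
  have real: "b k = 0" if "\<And>i. i < n \<Longrightarrow> (\<Sum>j<n. b j * bessel_int \<mu> (int i + 1 - int j)) = 0" for b :: "nat \<Rightarrow> real"
    using toep_dependent[where f = "bessel_int \<mu>" and x = "\<lambda>i. int i + 1" and a = b, OF k _ that] toep_shift_pos[of n] by force
  have "Re (\<Sum>j<n. a j * complex_of_real (bessel_int \<mu> (int i + 1 - int j))) = 0"
    "Im (\<Sum>j<n. a j * complex_of_real (bessel_int \<mu> (int i + 1 - int j))) = 0" if "i < n" for i
    using eq[OF that] by simp_all
  then have "Re (a k) = 0" "Im (a k) = 0"
    using real[of "\<lambda>j. Re (a j)"] real[of "\<lambda>j. Im (a j)"] by auto
  then show ?thesis by (simp add: complex_eq_iff)
qed

text \<open>The integral of \<open>\<phi>\<close> over the circle \<open>z = - cis \<tau>\<close> against \<open>z powr (- n) * exp (- \<mu> * (z + 1 / z)) / z\<close>, up to a constant: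
  this weight makes the operator of the theorem self-adjoint.\<close>
definition circ :: "real \<Rightarrow> nat \<Rightarrow> (complex \<Rightarrow> complex) \<Rightarrow> complex" where
  "circ \<mu> n \<phi> = integral {-pi..pi} (\<lambda>\<tau>. of_real (exp (2 * \<mu> * cos \<tau>)) * cis (- (of_nat n * \<tau>)) * \<phi> (- cis \<tau>))"

lemma circ_integrable:
  assumes "continuous_on UNIV \<phi>"
  shows "(\<lambda>\<tau>. of_real (exp (2 * \<mu> * cos \<tau>)) * cis (- (of_nat n * \<tau>)) * \<phi> (- cis \<tau>)) integrable_on {-pi..pi}"
proof -
  have "continuous_on {-pi..pi} (\<lambda>\<tau>. \<phi> (- cis \<tau>))"
    by (rule continuous_on_compose2[OF assms]) (auto intro!: continuous_intros)
  then show ?thesis by (intro integrable_continuous_real continuous_intros) auto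
qed

lemma circ_add:
  assumes "continuous_on UNIV \<phi>" "continuous_on UNIV \<psi>"
  shows "circ \<mu> n (\<lambda>z. \<phi> z + \<psi> z) = circ \<mu> n \<phi> + circ \<mu> n \<psi>"
  unfolding circ_def ring_distribs
  by (rule Henstock_Kurzweil_Integration.integral_add) (intro circ_integrable assms)+

lemma circ_cmult: "circ \<mu> n (\<lambda>z. c * \<phi> z) = c * circ \<mu> n \<phi>"
  unfolding circ_def mult.left_commute[of _ c] by (rule integral_mult_right)

lemma circ_sum:
  assumes "finite A" "\<And>j. j \<in> A \<Longrightarrow> continuous_on UNIV (\<phi> j)"
  shows "circ \<mu> n (\<lambda>z. \<Sum>j\<in>A. \<phi> j z) = (\<Sum>j\<in>A. circ \<mu> n (\<phi> j))"
  unfolding circ_def sum_distrib_left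
  by (rule integral_sum) (use assms in \<open>auto intro: circ_integrable\<close>)

text \<open>The sine part is odd and integrates to 0. The sign is due to the parametrisation by -
  cis \<tau>, chosen so that the weight becomes exp (2 \<mu> cos \<tau>).\<close>

lemma circ_power: "circ \<mu> n (\<lambda>z. z ^ s) = (-1) ^ s * of_real (bessel_int \<mu> (int s - int n))"
proof -
  define g where "g \<tau> = exp (2 * \<mu> * cos \<tau>) * sin (of_int (int s - int n) * \<tau>)" for \<tau>
  have int: "(\<lambda>\<tau>. exp (2 * \<mu> * cos \<tau>) * cos (of_int (int s - int n) * \<tau>)) integrable_on {-pi..pi}"
    "g integrable_on {-pi..pi}"
    unfolding g_def[abs_def] by (intro integrable_continuous_real continuous_intros)+
  have "integral {-pi..pi} (\<lambda>\<tau>. g (- \<tau>)) = integral {-pi..pi} g"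
    using Henstock_Kurzweil_Integration.integral_reflect_real[of pi "- pi" g] by simp
  moreover have "(\<lambda>\<tau>. g (- \<tau>)) = (\<lambda>\<tau>. - g \<tau>)" by (simp add: g_def)
  ultimately have 0: "integral {-pi..pi} g = 0" by simp
  have "(\<lambda>\<tau>. of_real (exp (2 * \<mu> * cos \<tau>)) * cis (- (of_nat n * \<tau>)) * (- cis \<tau>) ^ s) =
      (\<lambda>\<tau>. (-1) ^ s * (complex_of_real (exp (2 * \<mu> * cos \<tau>) * cos (of_int (int s - int n) * \<tau>)) + \<i> * complex_of_real (g \<tau>)))"
  proof
    fix \<tau>
    have "cis (- (of_nat n * \<tau>)) * (- cis \<tau>) ^ s = (-1) ^ s * (cis (- (of_nat n * \<tau>)) * cis \<tau> ^ s)"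
      by (subst power_minus) (rule mult.left_commute)
    also have "cis (- (of_nat n * \<tau>)) * cis \<tau> ^ s = cis (of_int (int s - int n) * \<tau>)"
    proof -
      have "- (of_nat n * \<tau>) + of_nat s * \<tau> = of_int (int s - int n) * \<tau>" by (simp add: algebra_simps)
      then show ?thesis by (simp only: Complex.DeMoivre cis_mult)
    qed
    also have "cis (of_int (int s - int n) * \<tau>) =
        of_real (cos (of_int (int s - int n) * \<tau>)) + \<i> * of_real (sin (of_int (int s - int n) * \<tau>))"
      by (simp add: complex_eq_iff)
    finally show "of_real (exp (2 * \<mu> * cos \<tau>)) * cis (- (of_nat n * \<tau>)) * (- cis \<tau>) ^ s =
      (-1) ^ s * (complex_of_real (exp (2 * \<mu> * cos \<tau>) * cos (of_int (int s - int n) * \<tau>)) + \<i> * complex_of_real (g \<tau>))"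
      unfolding g_def mult.assoc by (simp only: of_real_mult) (simp only: algebra_simps)
  qed
  moreover have "((\<lambda>\<tau>. (-1) ^ s * (complex_of_real (exp (2 * \<mu> * cos \<tau>) * cos (of_int (int s - int n) * \<tau>)) + \<i> * complex_of_real (g \<tau>)))
      has_integral (-1) ^ s * (of_real (bessel_int \<mu> (int s - int n)) + \<i> * of_real 0)) {-pi..pi}"
    unfolding bessel_int_def 0[symmetric]
    by (intro has_integral_mult_right has_integral_add has_integral_of_real integrable_integral int)
  ultimately have "((\<lambda>\<tau>. of_real (exp (2 * \<mu> * cos \<tau>)) * cis (- (of_nat n * \<tau>)) * (- cis \<tau>) ^ s)
      has_integral (-1) ^ s * (of_real (bessel_int \<mu> (int s - int n)) + \<i> * of_real 0)) {-pi..pi}"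
    by (simp only:)
  from integral_unique[OF this] show ?thesis
    unfolding circ_def by simp
qed

text \<open>\<open>w\<close> is the Sturm-Liouville factor: w' / w is the first order coefficient
  divided by z^2. Hence \<open>w\<close> times the Wronskian is a primitive of the weighted
  integrand. It is single-valued because n is an integer, so its increment over the circle is
  0.\<close>

lemma circ_self_adjoint:
  fixes F P :: "nat \<Rightarrow> complex \<Rightarrow> complex" and \<mu> :: real and \<delta> :: complex
  assumes F: "\<And>k z. (F k has_field_derivative F (Suc k) z) (at z)"
    and P: "\<And>k z. (P k has_field_derivative P (Suc k) z) (at z)"
    and ode: "\<And>z. z\<^sup>2 * P 2 z + ((1 - of_nat n) * z + of_real \<mu> + - of_real \<mu> * z\<^sup>2) * P 1 z
       + (\<delta> + of_real \<mu> * (of_nat n - 1) * z) * P 0 z = 0"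
  shows "circ \<mu> n (\<lambda>z. P 0 z * (z\<^sup>2 * F 2 z + ((1 - of_nat n) * z + of_real \<mu> + - of_real \<mu> * z\<^sup>2) * F 1 z
       + (\<delta> + of_real \<mu> * (of_nat n - 1) * z) * F 0 z)) = 0"
proof -
  define N where "N z = z\<^sup>2 * F 2 z + ((1 - of_nat n) * z + of_real \<mu> + - of_real \<mu> * z\<^sup>2) * F 1 z
       + (\<delta> + of_real \<mu> * (of_nat n - 1) * z) * F 0 z" for z
  define w where "w z = exp (- of_real \<mu> * (z + inverse z)) * z * inverse z ^ n" for z :: complex
  define D where "D z = P 0 z * F 1 z - F 0 z * P 1 z" for z
  have F2: "(F 0 has_field_derivative F 1 z) (at z)" "(F 1 has_field_derivative F 2 z) (at z)" 
    and P2: "(P 0 has_field_derivative P 1 z) (at z)" "(P 1 has_field_derivative P 2 z) (at z)" for z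
    using F[of 0] F[of 1] P[of 0] P[of 1] by (simp_all add: numeral_2_eq_2)
  have dD: "(D has_field_derivative P 0 z * F 2 z - F 0 z * P 2 z) (at z)" for z
    unfolding D_def[abs_def] by (rule derivative_eq_intros F2 P2 refl)+ simp
  have dw: "(w has_field_derivative w z * (1 - of_nat n - of_real \<mu> * z + of_real \<mu> * inverse z) * inverse z) (at z)" if "z \<noteq> 0" for z
  proof -
    have "(w has_field_derivative - of_real \<mu> * (1 - inverse z * inverse z) * exp (- of_real \<mu> * (z + inverse z)) * z * inverse z ^ n
        + exp (- of_real \<mu> * (z + inverse z)) * (inverse z ^ n - of_nat n * inverse z ^ (n - 1) * inverse z)) (at z)"
      unfolding w_def[abs_def]
      by (rule derivative_eq_intros refl that)+ (use that in \<open>simp add: algebra_simps\<close>)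
    also have "of_nat n * inverse z ^ (n - 1) * inverse z = of_nat n * inverse z ^ n"
      by (cases n) auto
    also have "- of_real \<mu> * (1 - inverse z * inverse z) * exp (- of_real \<mu> * (z + inverse z)) * z * inverse z ^ n
        + exp (- of_real \<mu> * (z + inverse z)) * (inverse z ^ n - of_nat n * inverse z ^ n) =
        w z * (1 - of_nat n - of_real \<mu> * z + of_real \<mu> * inverse z) * inverse z"
      unfolding w_def
      using that by (simp add: field_simps)
    finally show ?thesis .
  qed
  define G where "G z = w z * D z" for z
  have dG: "(G has_field_derivative w z * inverse z * inverse z * P 0 z * N z) (at z)" if z: "z \<noteq> 0" for z
  proof -
    \<comment> \<open>The subtracted term is 0 by the equation for \<open>P\<close>; it completes
      the Lagrange identity, in which the zero-order terms cancel.\<close>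
    have "w z * inverse z * inverse z * P 0 z * N z = w z * (inverse z * inverse z) * (P 0 z * N z - F 0 z * 
      (z\<^sup>2 * P 2 z + ((1 - of_nat n) * z + of_real \<mu> + - of_real \<mu> * z\<^sup>2) * P 1 z
       + (\<delta> + of_real \<mu> * (of_nat n - 1) * z) * P 0 z))"
      unfolding ode by simp
    also have "\<dots> = w z * (P 0 z * F 2 z - F 0 z * P 2 z) + w z * (1 - of_nat n - of_real \<mu> * z + of_real \<mu> * inverse z) * inverse z * D z"
      using z unfolding N_def D_def by (simp add: field_simps power2_eq_square)
    finally have eq: "w z * inverse z * inverse z * P 0 z * N z = \<dots>" .
    show ?thesis
      unfolding eq G_def[abs_def] by (rule DERIV_cong[OF DERIV_mult[OF dw[OF z] dD]]) (simp only: ac_simps)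
  qed
  have "((\<lambda>\<tau>. - \<i> * cis \<tau> * (w (- cis \<tau>) * inverse (- cis \<tau>) * inverse (- cis \<tau>) * P 0 (- cis \<tau>) * N (- cis \<tau>)))
      has_integral G (- cis pi) - G (- cis (- pi))) {-pi..pi}"
  proof (rule fundamental_theorem_of_calculus)
    fix \<tau> :: real
    have "((\<lambda>\<tau>. - cis \<tau>) has_vector_derivative - (\<i> * cis \<tau>)) (at \<tau>)"
      by (auto intro!: derivative_eq_intros simp: has_vector_derivative_def)
    moreover have "- cis \<tau> \<noteq> 0" by simp
    ultimately have "((G \<circ> (\<lambda>\<tau>. - cis \<tau>)) has_vector_derivative - (\<i> * cis \<tau>) *
      (w (- cis \<tau>) * inverse (- cis \<tau>) * inverse (- cis \<tau>) * P 0 (- cis \<tau>) * N (- cis \<tau>))) (at \<tau>)"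
      by (intro field_vector_diff_chain_at dG)
    from has_vector_derivative_at_within[OF this, of "{-pi..pi}"]
    show "((\<lambda>\<tau>. G (- cis \<tau>)) has_vector_derivative
        - \<i> * cis \<tau> * (w (- cis \<tau>) * inverse (- cis \<tau>) * inverse (- cis \<tau>) * P 0 (- cis \<tau>) * N (- cis \<tau>))) (at \<tau> within {-pi..pi})"
      by (simp add: o_def)
  qed auto
  moreover have "cis (- pi) = cis pi" by (simp add: complex_eq_iff)
  moreover have "- \<i> * cis \<tau> * (w (- cis \<tau>) * inverse (- cis \<tau>) * inverse (- cis \<tau>) * P 0 (- cis \<tau>) * N (- cis \<tau>)) =
     (- \<i> * (-1) ^ n) * (- (of_real (exp (2 * \<mu> * cos \<tau>)) * cis (- (of_nat n * \<tau>)) * (P 0 (- cis \<tau>) * N (- cis \<tau>))))" for \<tau>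
  proof -
    have i: "inverse (- cis \<tau>) = - cis (- \<tau>)" by (simp add: cis_inverse)
    have "exp (- of_real \<mu> * (- cis \<tau> + - cis (- \<tau>))) = complex_of_real (exp (2 * \<mu> * cos \<tau>))"
    proof -
      have "- of_real \<mu> * (- cis \<tau> + - cis (- \<tau>)) = complex_of_real (2 * \<mu> * cos \<tau>)" by (simp add: complex_eq_iff)
      then show ?thesis by (simp only: exp_of_real)
    qed
    moreover have "(- cis (- \<tau>)) ^ n = (-1) ^ n * cis (- (of_nat n * \<tau>))"
      unfolding power_minus[of "cis (- \<tau>)"] by (simp add: Complex.DeMoivre)
    moreover have "cis \<tau> * cis (- \<tau>) = 1" by (simp add: cis_mult)
    then have "cis \<tau> * (cis \<tau> * (cis (- \<tau>) * cis (- \<tau>))) = 1" by (metis mult.assoc mult_1)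
    ultimately show ?thesis
      unfolding w_def i by (simp add: mult_ac)
  qed
  ultimately have "((\<lambda>\<tau>. (- \<i> * (-1) ^ n) * (- (of_real (exp (2 * \<mu> * cos \<tau>)) * cis (- (of_nat n * \<tau>)) * (P 0 (- cis \<tau>) * N (- cis \<tau>)))))
      has_integral 0) {-pi..pi}" by simp
  from integral_unique[OF this]
  have "circ \<mu> n (\<lambda>z. P 0 z * N z) = 0"
    unfolding circ_def by simp
  then show ?thesis by (simp add: N_def)
qed

lemma iterated_primitive:
  assumes "f holomorphic_on UNIV"
  shows "\<exists>g. g holomorphic_on UNIV \<and> (deriv ^^ n) g = f \<and> (\<forall>k<n. (deriv ^^ k) g 0 = 0)"
  using assms
proof (induction n arbitrary: f)
  case (Suc n)
  obtain p where p: "\<And>z. (p has_field_derivative f z) (at z)"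
    using holomorphic_convex_primitive'[OF convex_UNIV open_UNIV Suc.prems] by auto
  define q where "q z = p z - p 0" for z
  have q: "(q has_field_derivative f z) (at z)" for z
    unfolding q_def[abs_def] using DERIV_diff[OF p DERIV_const] by simp
  have "q holomorphic_on UNIV" using q by (auto simp: holomorphic_on_open)
  then obtain g where g: "g holomorphic_on UNIV" "(deriv ^^ n) g = q" "\<forall>k<n. (deriv ^^ k) g 0 = 0"
    using Suc.IH by blast
  have "deriv q = f" using DERIV_imp_deriv[OF q] by auto
  moreover have "q 0 = 0" by (simp add: q_def)
  ultimately show ?case using g by (intro exI[of _ g]) (auto simp: less_Suc_eq)
qed auto

lemma conjugate_solution_excluded_by_polynomial:
  fixes E :: "complex poly" and \<mu> :: real and \<delta> :: complex
  assumes \<mu>: "\<mu> > 0" and E: "E \<noteq> 0" and n: "n = degree E + 1"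
    and P: "entire_solution (1 - of_nat n) (of_real \<mu>) (- of_real \<mu>) \<delta> (of_real \<mu> * (of_nat n - 1)) (poly E)"
    and g: "entire_solution (1 + of_nat n) (of_real \<mu>) (- of_real \<mu>) \<delta> (- of_real \<mu> * (1 + of_nat n)) g"
  shows "g 0 \<noteq> 1"
proof
  assume g0: "g 0 = 1"
  have hP: "poly E holomorphic_on UNIV" using P by (simp add: entire_solution_def)
  have hg: "g holomorphic_on UNIV" using g by (simp add: entire_solution_def)
  have Pode: "z\<^sup>2 * (deriv ^^ 2) (poly E) z + ((1 - of_nat n) * z + of_real \<mu> + - of_real \<mu> * z\<^sup>2) * (deriv ^^ 1) (poly E) z
       + (\<delta> + of_real \<mu> * (of_nat n - 1) * z) * (deriv ^^ 0) (poly E) z = 0" for z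
    using P by (simp add: entire_solution_def numeral_2_eq_2)
  define m where "m k = circ \<mu> n (\<lambda>z. poly E z * z ^ k)" for k
  have cont: "continuous_on UNIV (\<lambda>z. poly E z * z ^ k)" for k
    by (intro continuous_intros)
  have orth: "circ \<mu> n (\<lambda>z. poly E z * (z\<^sup>2 * F 2 z + ((1 - of_nat n) * z + of_real \<mu> + - of_real \<mu> * z\<^sup>2) * F 1 z
       + (\<delta> + of_real \<mu> * (of_nat n - 1) * z) * F 0 z)) = 0"
    if "\<And>k z. (F k has_field_derivative F (Suc k) z) (at z)" for F
  proof -
    have dP: "((deriv ^^ k) (poly E) has_field_derivative (deriv ^^ Suc k) (poly E) z) (at z)" for k z
      by (rule higher_deriv_entire(1)[OF hP])
    show ?thesis
      using circ_self_adjoint[where F = F and P = "\<lambda>k. (deriv ^^ k) (poly E)" and n = n and \<mu> = \<mu> and \<delta> = \<delta>] that dP Pode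
      by simp
  qed
  have m_top: "m (n - 1) = 0"
  proof -
    obtain h where h: "h holomorphic_on UNIV" "(deriv ^^ n) h = g" "\<forall>k<n. (deriv ^^ k) h 0 = 0"
      using iterated_primitive[OF hg] by blast
    \<comment> \<open>\<open>M k\<close> is the k-th derivative of the operator applied to
      \<open>h\<close>. For k = n it is the second equation for \<open>g\<close>, hence 0. For k < n
      only \<mu> times the derivative of \<open>h\<close> of order k + 1 survives at 0, which is
      nonzero just for k = n - 1, where it equals \<mu> * g 0.\<close>
    define M where "M = (\<lambda>k z. z\<^sup>2 * (deriv ^^ (k + 2)) h z + ((1 - of_nat n + 2 * of_nat k) * z + of_real \<mu> + - of_real \<mu> * z\<^sup>2) * (deriv ^^ (k + 1)) h z
      + (\<delta> + of_nat k * (of_nat k - 1) + of_nat k * (1 - of_nat n) + (of_real \<mu> * (of_nat n - 1) + 2 * of_nat k * (- of_real \<mu>)) * z) * (deriv ^^ k) h z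
      + (of_nat k * (of_nat k - 1) * (- of_real \<mu>) + of_nat k * (of_real \<mu> * (of_nat n - 1))) * (deriv ^^ (k - 1)) h z)"
    have dM: "(M k has_field_derivative M (Suc k) z) (at z)" for k z
      unfolding M_def by (rule leibniz_deriv[where F = "\<lambda>n. (deriv ^^ n) h"]) (rule higher_deriv_entire(1)[OF h(1)])
    have M: "(deriv ^^ k) (M 0) = M k" for k
    proof (induction k)
      case (Suc k)
      then show ?case using DERIV_imp_deriv[OF dM[of k]] by auto
    qed simp
    have "M n z = 0" for z
    proof -
      have "M n z = z\<^sup>2 * deriv (deriv g) z + ((1 + of_nat n) * z + of_real \<mu> + - of_real \<mu> * z\<^sup>2) * deriv g z
          + (\<delta> + - of_real \<mu> * (1 + of_nat n) * z) * g z"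
        unfolding M_def using h(2) by (simp add: algebra_simps)
      then show ?thesis using g by (simp add: entire_solution_def)
    qed
    moreover have "M k 0 = (if k = n - 1 then of_real \<mu> else 0)" if "k < n" for k
    proof -
      have "(deriv ^^ k) h 0 = 0" "(deriv ^^ (k - 1)) h 0 = 0" using h(3) that by auto
      then have "M k 0 = of_real \<mu> * (deriv ^^ Suc k) h 0" by (simp add: M_def)
      moreover have "(deriv ^^ Suc k) h 0 = (if k = n - 1 then 1 else 0)"
      proof (cases "k = n - 1")
        case True
        then have "Suc k = n" using that by simp
        then show ?thesis using h(2) g0 True by (simp del: funpow.simps)
      next
        case False
        then have "Suc k < n" using that by simp
        then show ?thesis using h(3) False by (simp del: funpow.simps)
      qed
      ultimately show ?thesis by simp
    qed
    moreover have "M 0 holomorphic_on UNIV" using dM by (auto simp: holomorphic_on_open)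
    ultimately have "M 0 z = (\<Sum>k<n. (if k = n - 1 then of_real \<mu> else 0) / fact k * z ^ k)" for z
      using taylor_polynomial[of "M 0" n z] by (simp add: M)
    also have "(\<Sum>k<n. (if k = n - 1 then of_real \<mu> else 0) / fact k * z ^ k) =
        (\<Sum>k<n. if k = n - 1 then of_real \<mu> / fact k * z ^ k else 0)" for z :: complex
      by (rule sum.cong) auto
    finally have "M 0 z = of_real \<mu> / fact (n - 1) * z ^ (n - 1)" for z
      using n by simp
    moreover have "circ \<mu> n (\<lambda>z. poly E z * M 0 z) = 0"
      using orth[of "\<lambda>k. (deriv ^^ k) h", OF higher_deriv_entire(1)[OF h(1)]] unfolding M_def by (simp add: numeral_2_eq_2)
    ultimately have "circ \<mu> n (\<lambda>z. of_real \<mu> / fact (n - 1) * (poly E z * z ^ (n - 1))) = 0"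
      by (simp add: mult_ac)
    then show ?thesis
      unfolding circ_cmult m_def using \<mu> by simp
  qed
  \<comment> \<open>Orthogonality to the operator applied to z^k, a combination of the powers k - 1,
    k and k + 1.\<close>
  have rec: "(of_nat k * (of_nat k - of_nat n) + \<delta>) * m k + of_real \<mu> * of_nat k * m (k - 1)
      + of_real \<mu> * (of_nat n - 1 - of_nat k) * m (k + 1) = 0" for k
  proof -
    have h: "(\<lambda>z :: complex. z ^ k) holomorphic_on UNIV" by (intro holomorphic_intros)
    have "((\<lambda>z. z ^ k) has_field_derivative of_nat k * z ^ (k - 1)) (at z)" for z :: complex
      by (rule derivative_eq_intros refl)+ simp
    then have d1: "deriv (\<lambda>z :: complex. z ^ k) = (\<lambda>z. of_nat k * z ^ (k - 1))" by (auto intro!: DERIV_imp_deriv)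
    have "((\<lambda>z. of_nat k * z ^ (k - 1)) has_field_derivative of_nat k * (of_nat (k - 1) * z ^ (k - 1 - 1))) (at z)" for z :: complex
      by (rule derivative_eq_intros refl)+ simp
    then have d2: "deriv (\<lambda>z :: complex. of_nat k * z ^ (k - 1)) = (\<lambda>z. of_nat k * (of_nat (k - 1) * z ^ (k - 1 - 1)))"
      by (auto intro!: DERIV_imp_deriv)
    have "circ \<mu> n (\<lambda>z. poly E z * (z\<^sup>2 * (of_nat k * (of_nat (k - 1) * z ^ (k - 1 - 1))) +
        ((1 - of_nat n) * z + of_real \<mu> + - of_real \<mu> * z\<^sup>2) * (of_nat k * z ^ (k - 1))
       + (\<delta> + of_real \<mu> * (of_nat n - 1) * z) * z ^ k)) = 0"
      using orth[of "\<lambda>j. (deriv ^^ j) (\<lambda>z. z ^ k)", OF higher_deriv_entire(1)[OF h]]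
      by (simp only: numeral_2_eq_2 One_nat_def funpow.simps o_apply id_apply d1[unfolded One_nat_def] d2[unfolded One_nat_def])
    moreover have "poly E z * (z\<^sup>2 * (of_nat k * (of_nat (k - 1) * z ^ (k - 1 - 1))) +
        ((1 - of_nat n) * z + of_real \<mu> + - of_real \<mu> * z\<^sup>2) * (of_nat k * z ^ (k - 1))
       + (\<delta> + of_real \<mu> * (of_nat n - 1) * z) * z ^ k) =
       (of_nat k * (of_nat k - of_nat n) + \<delta>) * (poly E z * z ^ k) + (of_real \<mu> * of_nat k * (poly E z * z ^ (k - 1))
      + of_real \<mu> * (of_nat n - 1 - of_nat k) * (poly E z * z ^ (k + 1)))" for z
    proof -
      have "of_nat k * (of_nat (k - 1) * (z\<^sup>2 * z ^ (k - 1 - 1))) = (of_nat k * (of_nat k - 1) * z ^ k :: complex)"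
      proof -
        have "k \<le> 1 \<or> (\<exists>j. k = Suc (Suc j))" by presburger
        then show ?thesis by (auto simp: le_Suc_eq power2_eq_square)
      qed
      moreover have "of_nat k * (z * z ^ (k - 1)) = of_nat k * z ^ k" by (cases k) auto
      moreover have "of_nat k * (z\<^sup>2 * z ^ (k - 1)) = of_nat k * z ^ (k + 1)" by (cases k) (auto simp: power2_eq_square)
      moreover have "poly E z * (z\<^sup>2 * (of_nat k * (of_nat (k - 1) * z ^ (k - 1 - 1))) +
        ((1 - of_nat n) * z + of_real \<mu> + - of_real \<mu> * z\<^sup>2) * (of_nat k * z ^ (k - 1))
       + (\<delta> + of_real \<mu> * (of_nat n - 1) * z) * z ^ k) = poly E z * (of_nat k * (of_nat (k - 1) * (z\<^sup>2 * z ^ (k - 1 - 1)))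
        + (1 - of_nat n) * (of_nat k * (z * z ^ (k - 1))) + of_real \<mu> * (of_nat k * z ^ (k - 1))
        - of_real \<mu> * (of_nat k * (z\<^sup>2 * z ^ (k - 1))) + \<delta> * z ^ k + of_real \<mu> * (of_nat n - 1) * z ^ (k + 1))"
        by (simp add: ring_distribs mult_ac)
      ultimately show ?thesis by (simp only:) (simp add: algebra_simps)
    qed
    ultimately show ?thesis
      by (simp only: circ_add circ_cmult cont m_def continuous_on_add continuous_on_mult_left add.assoc)
  qed
  \<comment> \<open>The recursion descends. At k = n - 1 the coefficient of \<open>m (k + 1)\<close>
    vanishes, so \<open>m_top\<close> alone starts it.\<close>
  have m0: "m (n - 1 - i) = 0" if "i < n" for i
    using that
  proof (induction i rule: less_induct)
    case (less i)
    show ?case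
    proof (cases i)
      case 0
      then show ?thesis using m_top by simp
    next
      case (Suc j)
      define k where "k = n - 1 - j"
      have "m k = 0" using less.IH[of j] less.prems Suc by (simp add: k_def)
      moreover have "(of_nat n - 1 - of_nat k) * m (k + 1) = 0"
      proof (cases j)
        case 0
        then show ?thesis using less.prems Suc by (simp add: k_def of_nat_diff)
      next
        case (Suc j')
        then have "m (n - 1 - j') = 0" using less.IH[of j'] less.prems \<open>i = Suc j\<close> by simp
        moreover have "n - 1 - j' = k + 1" using Suc less.prems \<open>i = Suc j\<close> by (simp add: k_def)
        ultimately show ?thesis by simp
      qed
      ultimately have "of_real \<mu> * of_nat k * m (k - 1) = 0" using rec[of k] by (auto simp: mult.assoc)
      moreover have "k \<noteq> 0" "k - 1 = n - 1 - i" using Suc less.prems by (auto simp: k_def)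
      ultimately show ?thesis using \<mu> by simp
    qed
  qed
  \<comment> \<open>The signs come from z = - cis \<tau> and are absorbed into the unknowns of the
    Toeplitz system; the leading unknown is singled out because \<open>E\<close> is nonzero.\<close>
  have "coeff E (degree E) * (-1) ^ degree E = 0"
  proof (rule bessel_toeplitz_injective[OF \<mu>])
    show "degree E < n" using n by simp
    fix i assume i: "i < n"
    \<comment> \<open>Row i is the moment of order n - 1 - i. Then j + k - n = - (i + 1 - j), and
      the Bessel integrals are even in the index.\<close>
    define k where "k = n - 1 - i"
    have "m k = circ \<mu> n (\<lambda>z. \<Sum>j<n. coeff E j * z ^ (j + k))"
      unfolding m_def poly_altdef n by (simp add: lessThan_Suc_atMost sum_distrib_right power_add mult.assoc)
    also have "\<dots> = (\<Sum>j<n. coeff E j * circ \<mu> n (\<lambda>z. z ^ (j + k)))"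
      by (subst circ_sum) (auto intro!: continuous_intros simp: circ_cmult)
    also have "\<dots> = (\<Sum>j<n. (-1) ^ k * (coeff E j * (-1) ^ j * of_real (bessel_int \<mu> (int i + 1 - int j))))"
    proof (rule sum.cong[OF refl])
      fix j
      have "int (j + k) - int n = - (int i + 1 - int j)" using i by (simp add: k_def)
      then show "coeff E j * circ \<mu> n (\<lambda>z. z ^ (j + k)) = (-1) ^ k * (coeff E j * (-1) ^ j * of_real (bessel_int \<mu> (int i + 1 - int j)))"
        unfolding circ_power by (simp only: bessel_int_minus) (simp add: power_add)
    qed
    also have "\<dots> = (-1) ^ k * (\<Sum>j<n. coeff E j * (-1) ^ j * of_real (bessel_int \<mu> (int i + 1 - int j)))"
      by (rule sum_distrib_left[symmetric])
    finally show "(\<Sum>j<n. coeff E j * (-1) ^ j * complex_of_real (bessel_int \<mu> (int i + 1 - int j))) = 0"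
      using m0[OF i] by (simp add: k_def)
  qed
  then show False using E by simp
qed

lemma deriv_poly: "deriv (poly p) = poly (pderiv p)" for p :: "complex poly"
  by (rule ext) (rule DERIV_imp_deriv[OF poly_DERIV])

lemma entire_solution_poly:
  "entire_solution \<alpha> \<beta> \<gamma> \<delta> \<epsilon> (poly p) \<longleftrightarrow>
    (\<forall>z. z\<^sup>2 * poly (pderiv (pderiv p)) z + (\<alpha> * z + \<beta> + \<gamma> * z\<^sup>2) * poly (pderiv p) z + (\<delta> + \<epsilon> * z) * poly p z = 0)"
  by (simp add: entire_solution_def deriv_poly holomorphic_intros)

text \<open>This is the coefficient of z^(degree + 1). For the theorem it reads \<mu> (l - 1 -
  degree) = 0, which makes l a positive integer.\<close>

lemma polynomial_solution_degree:
  fixes p :: "complex poly"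
  assumes p: "entire_solution \<alpha> \<beta> \<gamma> \<delta> \<epsilon> (poly p)" "p \<noteq> 0"
  shows "\<gamma> * of_nat (degree p) + \<epsilon> = 0"
proof -
  define q where "q = [:0, 0, 1:] * pderiv (pderiv p) + [:\<beta>, \<alpha>, \<gamma>:] * pderiv p + [:\<delta>, \<epsilon>:] * p"
  have "poly q z = 0" for z
    using p(1)[unfolded entire_solution_poly, rule_format, of z] by (simp add: q_def algebra_simps power2_eq_square)
  then have "q = 0" using poly_all_0_iff_0[of q] by blast
  moreover have "coeff q (Suc (degree p)) = (\<gamma> * of_nat (degree p) + \<epsilon>) * lead_coeff p"
    by (simp add: q_def mult_pCons_left coeff_pderiv coeff_eq_0 coeff_pCons split: nat.splits)
       (auto simp: algebra_simps)
  ultimately show ?thesis using p(2) by simp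
qed

theorem mainTheorem5:
  fixes \<omega> l \<mu> :: real
  assumes "\<omega> > 0" and "l \<ge> 0" and "\<mu> > 0"
  shows "(\<exists>E :: complex poly. E \<noteq> 0 \<and>
            (\<forall>z. z^2 * poly (pderiv (pderiv E)) z
                 + ((- of_real l + 1) * z + of_real \<mu> * (1 - z^2)) * poly (pderiv E) z
                 + (of_real (1 / (4 * \<omega>^2) - \<mu>^2) + of_real \<mu> * (of_real l - 1) * z) * poly E z = 0))
         \<longleftrightarrow> (l \<in> \<nat> \<and> stokes_c1 \<omega> l \<mu> = 0 \<and> stokes_c0 \<omega> l \<mu> \<noteq> 0)"
    (is "?L \<longleftrightarrow> ?R")
proof -
  note c0 = stokes_c0_zero_iff_entire[OF assms(1,3), of l]
  note c1 = stokes_c1_zero_iff_entire[OF assms(1,3), of l]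
  define \<delta> where "\<delta> = complex_of_real (1 / (4 * \<omega>\<^sup>2) - \<mu>\<^sup>2)"
  let ?star = "entire_solution (1 - of_real l) (of_real \<mu>) (- of_real \<mu>) \<delta> (of_real \<mu> * (of_real l - 1))"
  have "?L \<longleftrightarrow> (\<exists>E. E \<noteq> 0 \<and> ?star (poly E))"
    unfolding entire_solution_poly \<delta>_def by (simp add: algebra_simps)
  also have "\<dots> \<longleftrightarrow> ?R"
  proof
    assume "\<exists>E. E \<noteq> 0 \<and> ?star (poly E)"
    then obtain E where E: "E \<noteq> 0" "?star (poly E)" by blast
    define n where "n = degree E + 1"
    have "complex_of_real \<mu> * (of_real l - of_nat n) = 0"
      using polynomial_solution_degree[OF E(2,1)] by (simp add: n_def algebra_simps)
    then have "complex_of_real l = complex_of_real (real n)" using assms(3) by simp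
    then have l: "l = real n" using of_real_eq_iff by blast
    \<comment> \<open>Needed to normalise \<open>E\<close> to the value 1 at 0, as the criterion for
      c1 = 0 demands.\<close>
    have "poly E 0 \<noteq> 0"
    proof
      assume "poly E 0 = 0"
      then have "poly E z = 0" for z using entire_solution_zero[OF E(2)] assms(3) by simp
      then show False using E(1) poly_all_0_iff_0[of E] by blast
    qed
    then have "stokes_c1 \<omega> l \<mu> = 0"
      unfolding c1 \<delta>_def[symmetric]
      using entire_solution_scale[OF E(2), of "1 / poly E 0"] \<open>poly E 0 \<noteq> 0\<close>
      by (intro exI[of _ "\<lambda>z. 1 / poly E 0 * poly E z"]) simp
    moreover have "stokes_c0 \<omega> l \<mu> \<noteq> 0"
      unfolding c0 \<delta>_def[symmetric]
      using conjugate_solution_excluded_by_polynomial[OF assms(3) E(1) n_def] E(2) by (auto simp: l)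
    ultimately show ?R using l by simp
  next
    assume R: ?R
    then obtain n where n: "l = real n" by (auto elim: Nats_cases)
    obtain f where f: "?star f" "f 0 = 1" using R c1 unfolding \<delta>_def by blast
    have h: "f holomorphic_on UNIV" using f(1) by (simp add: entire_solution_def)
    have g: "entire_solution (1 + of_real l) (of_real \<mu>) (- of_real \<mu>) \<delta> (- of_real \<mu> * (1 + of_real l)) ((deriv ^^ n) f)"
      using entire_solution_higher_deriv[of n "of_real \<mu>" \<delta> f] f(1) by (simp add: n)
    \<comment> \<open>This includes n = 0, where the assumption on c0 is contradictory: both
      equations coincide, and \<open>f\<close> itself with \<open>f 0 = 1\<close> would force c0 =
      0.\<close>
    have "(deriv ^^ n) f 0 = 0"
    proof (rule ccontr)
      assume "(deriv ^^ n) f 0 \<noteq> 0"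
      then have "stokes_c0 \<omega> l \<mu> = 0"
        unfolding c0 \<delta>_def[symmetric]
        using entire_solution_scale[OF g, of "1 / (deriv ^^ n) f 0"]
        by (intro exI[of _ "\<lambda>z. 1 / (deriv ^^ n) f 0 * (deriv ^^ n) f z"]) simp
      then show False using R by simp
    qed
    then have "(deriv ^^ n) f z = 0" for z
      using entire_solution_zero[OF g] assms(3) by simp
    from taylor_polynomial[OF h this]
    have "f z = poly (\<Sum>k<n. monom ((deriv ^^ k) f 0 / fact k) k) z" for z
      by (simp add: poly_sum poly_monom)
    then have "f = poly (\<Sum>k<n. monom ((deriv ^^ k) f 0 / fact k) k)" by blast
    then obtain E where E: "f = poly E" by blast
    then have "E \<noteq> 0" using f(2) by auto
    then show "\<exists>E. E \<noteq> 0 \<and> ?star (poly E)" using f(1) E by blast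
  qed
  finally show ?thesis .
qed

end
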